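(* Fix an integer $N\ge4$ and an affine motion $A$ as in the context. There is $\lambda_0>0$ such that for every fixed $\lambda\in(0,\lambda_0]$ the following holds. Let $(\theta,\mathbf V)$ be a unique local solution to (P) on $[0,T^*]$, for fixed $T^*>0$, with $\mathrm{supp}\,\theta_0\subseteq B_1(\mathbf 0)$ and $\mathrm{supp}\,\mathbf V_0\subseteq B_1(\mathbf 0)$, with $\mathcal{S}^N+\mathcal{B}^N[\mathbf V]<\infty$ on $[0,T^*]$, and satisfying the a priori assumptions (AP). Suppose $\beta$ in (P) satisfies $\|\beta\|^2_{H^{N+1}(\mathbb{R}^3)}\le\lambda$ and $\mathrm{supp}\,\beta\subseteq B_1(\mathbf 0)$. Then there exists $K>0$ such that $$(\theta(\tau,y),\mathbf V(\tau,y))=(0,0)$$ for all $\tau\in[0,T^*]$ and all $y\in\mathbb{R}^3$ with $|y|>1+K\tau$.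
   Context: Repeated indices are summed; $F_{,k}=\partial F/\partial y_k$; $\|\cdot\|=\|\cdot\|_{L^2(\mathbb{R}^3)}$; $\partial^\nu=\partial_{y_1}^{\nu_1}\partial_{y_2}^{\nu_2}\partial_{y_3}^{\nu_3}$; $B_1(\mathbf 0)$ is the unit ball of $\mathbb{R}^3$. Affine motion. Fix $\alpha>0$, $\overline T>0$, and a global solution $A(t)$ of $A''(t)=\overline{T}[\det A(0)]^{1/\alpha}(\det A(t))^{-1/\alpha}A(t)^{-\top}$, $(A(0),A'(0))\in\mathrm{GL}^+(3)\times\mathbb{M}^{3\times3}$ ($\mathrm{GL}^+(3)$: positive determinant; $\mathbb{M}^{3\times3}$: all real $3\times3$ matrices), with $\det A(t)\sim1+t^3$, i.e. $c^{-1}(1+t^3)\le\det A(t)\le c(1+t^3)$ for all $t\ge0$ and some $c>0$. Put $\overline C=\overline T[\det A(0)]^{1/\alpha}$, $\mu=(\det A)^{1/3}$, $O=\mu^{-1}A$, $\Lambda=(\det A)^{2/3}A^{-1}A^{-\top}$. Change time by $d\tau/dt=1/\mu$, $\tau(0)=0$, regard these as functions of $\tau$, and put $\Gamma^*=O^{-1}O_\tau$. Fix $\sigma$ with $0<\sigma<\min(3/\alpha,2)$ and set $\delta=3/\alpha-\sigma>0$. System (P). Let $w(y)=e^{-|y|^2/2}$ and let $\beta:\mathbb{R}^3\to\mathbb{R}$ be smooth and compactly supported. The unknown is $\theta(\tau,y)\in\mathbb{R}^3$, $y\in\mathbb{R}^3$; $\mathbf{V}=\partial_\tau\theta$, $\eta(\tau,y)=y+\theta(\tau,y)$,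 $\mathscr{A}=[D\eta]^{-1}$ (so $\mathscr{A}^k_\ell\eta^\ell_{,j}=\delta^k_j$), $\mathscr{J}=\det D\eta$. System (P) is $$\mu^{\sigma}\partial_{\tau\tau}\theta_i+\mu_\tau\mu^{-1+\sigma}\partial_\tau\theta_i+2\mu^\sigma\Gamma^*_{ij}\partial_\tau\theta_j+\overline C\mu^{-\delta}\Lambda_{i\ell}\theta_\ell+\frac{\overline C\mu^{-\delta}}{w}\Big(w\Lambda_{ij}(1+\beta)\big(\mathscr{A}^k_j\mathscr{J}^{-1/\alpha}-\delta^k_j\big)\Big)_{,k}+\frac{\overline C\mu^{-\delta}}{w}\Lambda_{ik}(w\beta)_{,k}=0,$$ $i=1,2,3$, with $\theta(0,y)=\theta_0(y)$, $\partial_\tau\theta(0,y)=\mathbf{V}_0(y)$. Norms. $[\nabla_\eta\mathbf F]^i_r=\mathscr{A}^s_r\mathbf F^i_{,s}$, $\mathrm{div}_\eta\mathbf F=\mathscr{A}^s_\ell\mathbf F^\ell_{,s}$, $[\mathrm{Curl}_{\Lambda\mathscr{A}}\mathbf F]^i_j=\Lambda_{jm}\mathscr{A}^s_m\mathbf F^i_{,s}-\Lambda_{im}\mathscr{A}^s_m\mathbf F^j_{,s}$, $$\mathcal{S}^N(\tau)=\sup_{0\le\tau'\le\tau}\Big\{\sum_{|\nu|\le N}\big(\mu^\sigma\|\partial^\nu\mathbf V\|^2+\|\partial^\nu\theta\|^2\big)+\sum_{|\nu|\le N-1}\big(\|\nabla_\eta\partial^\nu\theta\|^2+\|\mathrm{div}_\eta\partial^\nu\theta\|^2\big)+\sum_{|\nu|=N}\mu^{-\delta}\big(\|\nabla_\eta\partial^\nu\theta\|^2+\|\mathrm{div}_\eta\partial^\nu\theta\|^2\big)\Big\},$$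 $$\mathcal{B}^N[\mathbf V](\tau)=\sup_{0\le\tau'\le\tau}\Big\{\sum_{|\nu|\le N-1}\|\mathrm{Curl}_{\Lambda\mathscr{A}}\partial^\nu\mathbf V\|^2+\sum_{|\nu|=N}\mu^{-\delta}\|\mathrm{Curl}_{\Lambda\mathscr{A}}\partial^\nu\mathbf V\|^2\Big\}.$$ A priori assumptions (AP): for all $\tau\in[0,T^*]$, $\|\mathscr{A}-\mathrm{Id}\|_{L^\infty}<\frac13$, $\|D\theta\|_{L^\infty}<\frac13$, $\|\mathscr{J}-1\|_{L^\infty}<\frac13$, $\mathcal{S}^N(\tau)<\frac13$, $\|D\mathbf V\|_{L^\infty}\le C$ and $\|D\mathbf V_\tau\|_{L^\infty}\le C$ for some constant $C$. *)

theory Defs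
  imports "HOL-Analysis.Analysis" "HOL-Probability.Essential_Supremum"
begin

section \<open>Calculus on three-dimensional space\<close>

definition partial_deriv :: "3 \<Rightarrow> (real^3 \<Rightarrow> 'a::real_normed_vector) \<Rightarrow> real^3 \<Rightarrow> 'a" where
  "partial_deriv k f y = frechet_derivative f (at y) (axis k 1)"

definition order :: "nat^3 \<Rightarrow> nat" where
  "order \<nu> = (\<Sum>i\<in>UNIV. \<nu> $ i)"

definition multi_deriv :: "nat^3 \<Rightarrow> (real^3 \<Rightarrow> 'a::real_normed_vector) \<Rightarrow> real^3 \<Rightarrow> 'a" where
  "multi_deriv \<nu> f =
     (partial_deriv 1 ^^ (\<nu> $ 1)) ((partial_deriv 2 ^^ (\<nu> $ 2)) ((partial_deriv 3 ^^ (\<nu> $ 3)) f))"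

primrec C_k :: "nat \<Rightarrow> (real^3 \<Rightarrow> 'a::real_normed_vector) \<Rightarrow> bool" where
  "C_k 0 f \<longleftrightarrow> continuous_on UNIV f"
| "C_k (Suc n) f \<longleftrightarrow> f differentiable_on UNIV \<and> (\<forall>k. C_k n (partial_deriv k f))"

definition smooth :: "(real^3 \<Rightarrow> 'a::real_normed_vector) \<Rightarrow> bool" where
  "smooth f \<longleftrightarrow> (\<forall>n. C_k n f)"

definition supp :: "(real^3 \<Rightarrow> 'a::real_normed_vector) \<Rightarrow> (real^3) set" where
  "supp f = closure {y. f y \<noteq> 0}"

definition test_function :: "(real^3 \<Rightarrow> real) \<Rightarrow> bool" where
  "test_function \<phi> \<longleftrightarrow> smooth \<phi> \<and> compact (supp \<phi>)"

text \<open>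
  Matrices carry the norm of \<^typ>\<open>real^3^3\<close>, which is the Euclidean (Frobenius) norm.
\<close>

definition Linf_norm :: "(real^3 \<Rightarrow> 'a::real_normed_vector) \<Rightarrow> ennreal" where
  "Linf_norm f = esssup lborel (\<lambda>y. ennreal (norm (f y)))"

section \<open>Weak derivatives and the norms built from them\<close>

definition locally_integrable :: "(real^3 \<Rightarrow> 'a::euclidean_space) \<Rightarrow> bool" where
  "locally_integrable f \<longleftrightarrow> (\<forall>K. compact K \<longrightarrow> set_integrable lborel K f)"

definition is_weak_deriv ::
  "nat^3 \<Rightarrow> (real^3 \<Rightarrow> 'a::euclidean_space) \<Rightarrow> (real^3 \<Rightarrow> 'a) \<Rightarrow> bool" where
  "is_weak_deriv \<nu> F G \<longleftrightarrow> locally_integrable F \<and> locally_integrable G \<and>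
     (\<forall>\<phi>. test_function \<phi> \<longrightarrow>
        (LINT y|lborel. \<phi> y *\<^sub>R G y) =
        (-1) ^ order \<nu> *\<^sub>R (LINT y|lborel. multi_deriv \<nu> \<phi> y *\<^sub>R F y))"

text \<open>
  The first-order operators with coefficients \<open>\<A>\<close> are read in the sense of distributions:
  the top-order derivatives of the velocity are only square integrable, so their full gradient
  need not be a function even where their curl is.
  \<open>grad_pairing \<A> F i r \<phi>\<close> is the value at \<open>\<phi>\<close> of the distribution
  \<open>\<A>\<^sup>s\<^sub>r F\<^sup>i\<^sub>,\<^sub>s\<close>; the coefficients
  are continuously differentiable where it is used.
\<close>

definition grad_pairing ::
  "(real^3 \<Rightarrow> real^3^3) \<Rightarrow> (real^3 \<Rightarrow> real^3) \<Rightarrow> 3 \<Rightarrow> 3 \<Rightarrow> (real^3 \<Rightarrow> real) \<Rightarrow> real" where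
  "grad_pairing \<A> F i r \<phi> =
     - (LINT y|lborel. F y $ i * (\<Sum>s\<in>UNIV. partial_deriv s (\<lambda>z. \<phi> z * \<A> z $ s $ r) y))"

definition is_grad_eta ::
  "(real^3 \<Rightarrow> real^3^3) \<Rightarrow> (real^3 \<Rightarrow> real^3) \<Rightarrow> (real^3 \<Rightarrow> real^3^3) \<Rightarrow> bool" where
  "is_grad_eta \<A> F G \<longleftrightarrow> locally_integrable G \<and>
     (\<forall>\<phi> i r. test_function \<phi> \<longrightarrow>
        (LINT y|lborel. \<phi> y * G y $ i $ r) = grad_pairing \<A> F i r \<phi>)"

definition is_div_eta ::
  "(real^3 \<Rightarrow> real^3^3) \<Rightarrow> (real^3 \<Rightarrow> real^3) \<Rightarrow> (real^3 \<Rightarrow> real) \<Rightarrow> bool" where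
  "is_div_eta \<A> F g \<longleftrightarrow> locally_integrable g \<and>
     (\<forall>\<phi>. test_function \<phi> \<longrightarrow>
        (LINT y|lborel. \<phi> y * g y) = (\<Sum>l\<in>UNIV. grad_pairing \<A> F l l \<phi>))"

definition is_Curl ::
  "real^3^3 \<Rightarrow> (real^3 \<Rightarrow> real^3^3) \<Rightarrow> (real^3 \<Rightarrow> real^3) \<Rightarrow> (real^3 \<Rightarrow> real^3^3) \<Rightarrow> bool" where
  "is_Curl L \<A> F G \<longleftrightarrow> locally_integrable G \<and>
     (\<forall>\<phi> i j. test_function \<phi> \<longrightarrow>
        (LINT y|lborel. \<phi> y * G y $ i $ j) =
        (\<Sum>m\<in>UNIV. L $ j $ m * grad_pairing \<A> F i m \<phi> - L $ i $ m * grad_pairing \<A> F j m \<phi>))"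

text \<open>
  Squared \<open>L\<^sup>2\<close> norm of the function singled out, up to null sets, by \<open>P\<close>.
  The infimum only ranges over representatives that agree almost everywhere; it is
  \<open>\<infinity>\<close> if there is none, that is, if the distribution is not a locally integrable function.
\<close>

definition weak_L2sq :: "((real^3 \<Rightarrow> 'a::euclidean_space) \<Rightarrow> bool) \<Rightarrow> ennreal" where
  "weak_L2sq P = (INF G\<in>{G. P G}. \<integral>\<^sup>+y. ennreal ((norm (G y))\<^sup>2) \<partial>lborel)"

definition L2sq_deriv :: "nat^3 \<Rightarrow> (real^3 \<Rightarrow> 'a::euclidean_space) \<Rightarrow> ennreal" where
  "L2sq_deriv \<nu> F = weak_L2sq (is_weak_deriv \<nu> F)"

definition L2sq_grad_eta :: "(real^3 \<Rightarrow> real^3^3) \<Rightarrow> nat^3 \<Rightarrow> (real^3 \<Rightarrow> real^3) \<Rightarrow> ennreal" where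
  "L2sq_grad_eta \<A> \<nu> F = weak_L2sq (\<lambda>G. \<exists>H. is_weak_deriv \<nu> F H \<and> is_grad_eta \<A> H G)"

definition L2sq_div_eta :: "(real^3 \<Rightarrow> real^3^3) \<Rightarrow> nat^3 \<Rightarrow> (real^3 \<Rightarrow> real^3) \<Rightarrow> ennreal" where
  "L2sq_div_eta \<A> \<nu> F = weak_L2sq (\<lambda>g. \<exists>H. is_weak_deriv \<nu> F H \<and> is_div_eta \<A> H g)"

definition L2sq_Curl ::
  "real^3^3 \<Rightarrow> (real^3 \<Rightarrow> real^3^3) \<Rightarrow> nat^3 \<Rightarrow> (real^3 \<Rightarrow> real^3) \<Rightarrow> ennreal" where
  "L2sq_Curl L \<A> \<nu> F = weak_L2sq (\<lambda>G. \<exists>H. is_weak_deriv \<nu> F H \<and> is_Curl L \<A> H G)"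

definition sobolev_normsq :: "nat \<Rightarrow> (real^3 \<Rightarrow> 'a::euclidean_space) \<Rightarrow> ennreal" where
  "sobolev_normsq k F = (\<Sum>\<nu> | order \<nu> \<le> k. L2sq_deriv \<nu> F)"

section \<open>Affine motions\<close>

definition Cbar :: "real \<Rightarrow> real \<Rightarrow> (real \<Rightarrow> real^3^3) \<Rightarrow> real" where
  "Cbar \<alpha> Tbar A = Tbar * det (A 0) powr (1 / \<alpha>)"

definition affine_motion :: "real \<Rightarrow> real \<Rightarrow> (real \<Rightarrow> real^3^3) \<Rightarrow> bool" where
  "affine_motion \<alpha> Tbar A \<longleftrightarrow>
     det (A 0) > 0 \<and>
     (\<exists>A'. \<forall>t\<ge>0.
        (A has_vector_derivative A' t) (at t within {0..}) \<and>
        (A' has_vector_derivative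
           (Cbar \<alpha> Tbar A * det (A t) powr (- 1 / \<alpha>)) *\<^sub>R transpose (matrix_inv (A t)))
          (at t within {0..})) \<and>
     (\<exists>c>0. \<forall>t\<ge>0. inverse c * (1 + t ^ 3) \<le> det (A t) \<and> det (A t) \<le> c * (1 + t ^ 3))"

text \<open>
  For an affine motion, \<open>tau_of A\<close> is an increasing bijection of the half-line
  \<open>{0..}\<close>, because the determinant grows like \<open>1 + t\<^sup>3\<close>; \<open>t_of A\<close> is its inverse.
\<close>

definition tau_of :: "(real \<Rightarrow> real^3^3) \<Rightarrow> real \<Rightarrow> real" where
  "tau_of A t = integral {0..t} (\<lambda>s. 1 / det (A s) powr (1 / 3))"

definition t_of :: "(real \<Rightarrow> real^3^3) \<Rightarrow> real \<Rightarrow> real" where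
  "t_of A = the_inv_into {0..} (tau_of A)"

text \<open>From here on every function of time is a function of the new variable \<open>\<tau>\<close>.\<close>

definition mu :: "(real \<Rightarrow> real^3^3) \<Rightarrow> real \<Rightarrow> real" where
  "mu A \<tau> = det (A (t_of A \<tau>)) powr (1 / 3)"

definition mu_tau :: "(real \<Rightarrow> real^3^3) \<Rightarrow> real \<Rightarrow> real" where
  "mu_tau A \<tau> = vector_derivative (mu A) (at \<tau> within {0..})"

definition Omat :: "(real \<Rightarrow> real^3^3) \<Rightarrow> real \<Rightarrow> real^3^3" where
  "Omat A \<tau> = inverse (mu A \<tau>) *\<^sub>R A (t_of A \<tau>)"

definition Gamma_star :: "(real \<Rightarrow> real^3^3) \<Rightarrow> real \<Rightarrow> real^3^3" where
  "Gamma_star A \<tau> =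
     matrix_inv (Omat A \<tau>) ** vector_derivative (Omat A) (at \<tau> within {0..})"

definition Lam :: "(real \<Rightarrow> real^3^3) \<Rightarrow> real \<Rightarrow> real^3^3" where
  "Lam A \<tau> = det (A (t_of A \<tau>)) powr (2 / 3) *\<^sub>R
     (matrix_inv (A (t_of A \<tau>)) ** transpose (matrix_inv (A (t_of A \<tau>))))"

section \<open>The system and its solutions\<close>

definition delta :: "real \<Rightarrow> real \<Rightarrow> real" where
  "delta \<alpha> \<sigma> = 3 / \<alpha> - \<sigma>"

definition w :: "real^3 \<Rightarrow> real" where
  "w y = exp (- (norm y)\<^sup>2 / 2)"

definition D :: "(real^3 \<Rightarrow> real^3) \<Rightarrow> real^3 \<Rightarrow> real^3^3" where
  "D F y = jacobian F (at y)"

definition eta :: "(real^3 \<Rightarrow> real^3) \<Rightarrow> real^3 \<Rightarrow> real^3" where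
  "eta \<theta> y = y + \<theta> y"

definition Ainv :: "(real^3 \<Rightarrow> real^3) \<Rightarrow> real^3 \<Rightarrow> real^3^3" where
  "Ainv \<theta> y = matrix_inv (D (eta \<theta>) y)"

definition Jdet :: "(real^3 \<Rightarrow> real^3) \<Rightarrow> real^3 \<Rightarrow> real" where
  "Jdet \<theta> y = det (D (eta \<theta>) y)"

definition time_deriv ::
  "real \<Rightarrow> (real \<Rightarrow> real^3 \<Rightarrow> real^3) \<Rightarrow> real \<Rightarrow> real^3 \<Rightarrow> real^3" where
  "time_deriv T F \<tau> y = vector_derivative (\<lambda>s. F s y) (at \<tau> within {0..T})"

definition system_lhs ::
  "real \<Rightarrow> real \<Rightarrow> (real \<Rightarrow> real^3^3) \<Rightarrow> real \<Rightarrow> (real^3 \<Rightarrow> real) \<Rightarrow> real \<Rightarrow>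
   (real \<Rightarrow> real^3 \<Rightarrow> real^3) \<Rightarrow> (real \<Rightarrow> real^3 \<Rightarrow> real^3) \<Rightarrow> real \<Rightarrow> real^3 \<Rightarrow> 3 \<Rightarrow> real" where
  "system_lhs \<alpha> Tbar A \<sigma> \<beta> T \<theta> V \<tau> y i =
     mu A \<tau> powr \<sigma> * time_deriv T V \<tau> y $ i
     + mu_tau A \<tau> * mu A \<tau> powr (- 1 + \<sigma>) * V \<tau> y $ i
     + 2 * mu A \<tau> powr \<sigma> * (\<Sum>j\<in>UNIV. Gamma_star A \<tau> $ i $ j * V \<tau> y $ j)
     + Cbar \<alpha> Tbar A * mu A \<tau> powr (- delta \<alpha> \<sigma>) * (\<Sum>l\<in>UNIV. Lam A \<tau> $ i $ l * \<theta> \<tau> y $ l)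
     + Cbar \<alpha> Tbar A * mu A \<tau> powr (- delta \<alpha> \<sigma>) / w y *
         (\<Sum>k\<in>UNIV. partial_deriv k
            (\<lambda>z. \<Sum>j\<in>UNIV. w z * Lam A \<tau> $ i $ j * (1 + \<beta> z) *
               (Ainv (\<theta> \<tau>) z $ k $ j * Jdet (\<theta> \<tau>) z powr (- 1 / \<alpha>)
                 - (if k = j then 1 else 0))) y)
     + Cbar \<alpha> Tbar A * mu A \<tau> powr (- delta \<alpha> \<sigma>) / w y *
         (\<Sum>k\<in>UNIV. Lam A \<tau> $ i $ k * partial_deriv k (\<lambda>z. w z * \<beta> z) y)"

text \<open>
  The classical regularity demanded here is what the Sobolev embedding gives when the energy of
  order at least four is finite (for the continuous representative). It makes every derivative
  in the system, and in the a priori assumptions, a pointwise one; the derivatives of higher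
  order in the energies are weak. Time derivatives at the two endpoints are one-sided.
\<close>

definition local_solution ::
  "real \<Rightarrow> real \<Rightarrow> (real \<Rightarrow> real^3^3) \<Rightarrow> real \<Rightarrow> (real^3 \<Rightarrow> real) \<Rightarrow> real \<Rightarrow>
   (real^3 \<Rightarrow> real^3) \<Rightarrow> (real^3 \<Rightarrow> real^3) \<Rightarrow>
   (real \<Rightarrow> real^3 \<Rightarrow> real^3) \<Rightarrow> (real \<Rightarrow> real^3 \<Rightarrow> real^3) \<Rightarrow> bool" where
  "local_solution \<alpha> Tbar A \<sigma> \<beta> T \<theta>0 V0 \<theta> V \<longleftrightarrow>
     (\<forall>y. \<theta> 0 y = \<theta>0 y \<and> V 0 y = V0 y) \<and>
     (\<forall>\<tau>\<in>{0..T}.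
        C_k 2 (\<theta> \<tau>) \<and> C_k 1 (V \<tau>) \<and> C_k 1 (time_deriv T V \<tau>) \<and>
        (\<forall>y. ((\<lambda>s. \<theta> s y) has_vector_derivative V \<tau> y) (at \<tau> within {0..T}) \<and>
             (\<lambda>s. V s y) differentiable (at \<tau> within {0..T}) \<and>
             Jdet (\<theta> \<tau>) y > 0 \<and>
             (\<forall>i. system_lhs \<alpha> Tbar A \<sigma> \<beta> T \<theta> V \<tau> y i = 0)))"

definition S_norm ::
  "real \<Rightarrow> (real \<Rightarrow> real^3^3) \<Rightarrow> real \<Rightarrow> nat \<Rightarrow>
   (real \<Rightarrow> real^3 \<Rightarrow> real^3) \<Rightarrow> (real \<Rightarrow> real^3 \<Rightarrow> real^3) \<Rightarrow> real \<Rightarrow> ennreal" where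
  "S_norm \<alpha> A \<sigma> N \<theta> V \<tau> = (SUP s\<in>{0..\<tau>}.
     (\<Sum>\<nu> | order \<nu> \<le> N. ennreal (mu A s powr \<sigma>) * L2sq_deriv \<nu> (V s) + L2sq_deriv \<nu> (\<theta> s))
     + (\<Sum>\<nu> | order \<nu> \<le> N - 1.
          L2sq_grad_eta (Ainv (\<theta> s)) \<nu> (\<theta> s) + L2sq_div_eta (Ainv (\<theta> s)) \<nu> (\<theta> s))
     + (\<Sum>\<nu> | order \<nu> = N. ennreal (mu A s powr (- delta \<alpha> \<sigma>)) *
          (L2sq_grad_eta (Ainv (\<theta> s)) \<nu> (\<theta> s) + L2sq_div_eta (Ainv (\<theta> s)) \<nu> (\<theta> s))))"

definition B_norm ::
  "real \<Rightarrow> (real \<Rightarrow> real^3^3) \<Rightarrow> real \<Rightarrow> nat \<Rightarrow>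
   (real \<Rightarrow> real^3 \<Rightarrow> real^3) \<Rightarrow> (real \<Rightarrow> real^3 \<Rightarrow> real^3) \<Rightarrow> real \<Rightarrow> ennreal" where
  "B_norm \<alpha> A \<sigma> N \<theta> V \<tau> = (SUP s\<in>{0..\<tau>}.
     (\<Sum>\<nu> | order \<nu> \<le> N - 1. L2sq_Curl (Lam A s) (Ainv (\<theta> s)) \<nu> (V s))
     + (\<Sum>\<nu> | order \<nu> = N. ennreal (mu A s powr (- delta \<alpha> \<sigma>)) *
          L2sq_Curl (Lam A s) (Ainv (\<theta> s)) \<nu> (V s)))"

definition finite_energy_solution ::
  "real \<Rightarrow> real \<Rightarrow> (real \<Rightarrow> real^3^3) \<Rightarrow> real \<Rightarrow> nat \<Rightarrow> (real^3 \<Rightarrow> real) \<Rightarrow> real \<Rightarrow>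
   (real^3 \<Rightarrow> real^3) \<Rightarrow> (real^3 \<Rightarrow> real^3) \<Rightarrow>
   (real \<Rightarrow> real^3 \<Rightarrow> real^3) \<Rightarrow> (real \<Rightarrow> real^3 \<Rightarrow> real^3) \<Rightarrow> bool" where
  "finite_energy_solution \<alpha> Tbar A \<sigma> N \<beta> T \<theta>0 V0 \<theta> V \<longleftrightarrow>
     local_solution \<alpha> Tbar A \<sigma> \<beta> T \<theta>0 V0 \<theta> V \<and>
     (\<forall>\<tau>\<in>{0..T}. S_norm \<alpha> A \<sigma> N \<theta> V \<tau> + B_norm \<alpha> A \<sigma> N \<theta> V \<tau> < \<infinity>)"

definition unique_finite_energy_solution ::
  "real \<Rightarrow> real \<Rightarrow> (real \<Rightarrow> real^3^3) \<Rightarrow> real \<Rightarrow> nat \<Rightarrow> (real^3 \<Rightarrow> real) \<Rightarrow> real \<Rightarrow>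
   (real^3 \<Rightarrow> real^3) \<Rightarrow> (real^3 \<Rightarrow> real^3) \<Rightarrow>
   (real \<Rightarrow> real^3 \<Rightarrow> real^3) \<Rightarrow> (real \<Rightarrow> real^3 \<Rightarrow> real^3) \<Rightarrow> bool" where
  "unique_finite_energy_solution \<alpha> Tbar A \<sigma> N \<beta> T \<theta>0 V0 \<theta> V \<longleftrightarrow>
     finite_energy_solution \<alpha> Tbar A \<sigma> N \<beta> T \<theta>0 V0 \<theta> V \<and>
     (\<forall>\<theta>' V'. finite_energy_solution \<alpha> Tbar A \<sigma> N \<beta> T \<theta>0 V0 \<theta>' V' \<longrightarrow>
        (\<forall>\<tau>\<in>{0..T}. \<forall>y. \<theta>' \<tau> y = \<theta> \<tau> y \<and> V' \<tau> y = V \<tau> y))"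

definition a_priori ::
  "real \<Rightarrow> (real \<Rightarrow> real^3^3) \<Rightarrow> real \<Rightarrow> nat \<Rightarrow> real \<Rightarrow>
   (real \<Rightarrow> real^3 \<Rightarrow> real^3) \<Rightarrow> (real \<Rightarrow> real^3 \<Rightarrow> real^3) \<Rightarrow> bool" where
  "a_priori \<alpha> A \<sigma> N T \<theta> V \<longleftrightarrow>
     (\<forall>\<tau>\<in>{0..T}.
        Linf_norm (\<lambda>y. Ainv (\<theta> \<tau>) y - mat 1) < ennreal (1 / 3) \<and>
        Linf_norm (D (\<theta> \<tau>)) < ennreal (1 / 3) \<and>
        Linf_norm (\<lambda>y. Jdet (\<theta> \<tau>) y - 1) < ennreal (1 / 3) \<and>
        S_norm \<alpha> A \<sigma> N \<theta> V \<tau> < ennreal (1 / 3)) \<and>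
     (\<exists>C::real. \<forall>\<tau>\<in>{0..T}.
        Linf_norm (D (V \<tau>)) \<le> ennreal C \<and>
        Linf_norm (D (time_deriv T V \<tau>)) \<le> ennreal C)"

end

theory Submission
  imports Defs
begin

text \<open>
  Off the support of \<open>\<beta>\<close> the Piola identity reduces the system to
  \<open>\<V>\<^sub>\<tau> + L \<V> + N \<A>\<^sup>T(\<nabla>\<phi> + (1 - q) y) = 0\<close> with
  \<open>q = J\<^bsup>-1/\<alpha>\<^esup>\<close> and \<open>\<phi> = (1 + \<alpha>)(q - 1) + y \<bullet> \<theta> + |\<theta>|\<^sup>2/2\<close>, while
  \<open>\<phi>\<^sub>\<tau> = - (1 + \<alpha>)/\<alpha> q div\<^sub>\<eta> \<V> + \<eta> \<bullet> \<V>\<close>. This is a symmetrizable first-order system for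
  \<open>(\<V>, \<phi>, \<theta>)\<close>: with \<open>P\<^sup>T P N = I\<close>, the energy \<open>J (|P \<V>|\<^sup>2 + \<alpha>/(1 + \<alpha>) \<phi>\<^sup>2/q + |\<theta>|\<^sup>2)\<close>,
  weighted by a \<open>C\<^sup>1\<close> cutoff to a backward cone that avoids the unit ball, satisfies a Gronwall
  inequality as soon as the slope of the cone exceeds the propagation speed; the speed is bounded
  on \<open>[0, T]\<close> by the a priori assumptions. Only the slope has to be uniform in the vertex of the
  cone, so the unbounded factor \<open>y\<close> does no harm.
\<close>

section \<open>Calculus\<close>

text \<open>Origin of \<phi>: write eta = y + \<theta> and M = D eta. The term in \<theta> and the
  constant part of the pressure tensor contribute \<theta> + y, which is A^T M^T eta, and M^T eta is
  the gradient of |eta|^2/2. Together with the pressure part (1 + \<alpha>) grad q - q y this puts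
  the gradient of (1 + \<alpha>) q + (|eta|^2 - |y|^2)/2 under A^T, up to (1 - q) y; and 1 - q is
  controlled by \<phi> and \<theta> without derivatives. The obstacle is regularity. The solution is
  smooth enough in space at each time and differentiable in time at each point, but nothing is
  jointly continuous, so neither bounds on compact sets nor differentiation under the integral come
  for free. The bound on the spatial derivative of V_\<tau> is the substitute: it makes V_\<tau>
  Lipschitz in space uniformly in time, which gives the time derivative of D\<theta> and, through
  the equation, a local bound on V_\<tau>. This is enough, since the time derivative of the energy
  density contains V_\<tau> but no second derivative of \<theta>; those occur only in a divergence,
  integrated at a fixed time.\<close>

lemma norm_matrix_vector_mult_le:
  fixes M :: "real^'n^'m"
  shows "norm (M *v x) \<le> norm M * norm x"
proof -
  have "norm (M *v x) \<le> L2_set (\<lambda>i. norm (M $ i) * norm x) UNIV"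
    unfolding norm_vec_def[of "M *v x"]
    by (intro L2_set_mono) (auto simp: matrix_vector_mul_component intro: Cauchy_Schwarz_ineq2)
  also have "\<dots> = norm M * norm x"
    by (simp add: norm_vec_def[of M] L2_set_left_distrib)
  finally show ?thesis .
qed

lemma has_derivative_line:
  assumes "\<And>x. (f has_derivative f' x) (at x)"
  shows "((\<lambda>s. f (x + s *\<^sub>R v)) has_vector_derivative f' (x + s *\<^sub>R v) v) (at s within S)"
proof -
  have "((\<lambda>s. x + s *\<^sub>R v) has_derivative (\<lambda>h. h *\<^sub>R v)) (at s within S)"
    by (auto intro!: derivative_eq_intros)
  from has_derivative_compose[OF this assms]
  have "((\<lambda>s. f (x + s *\<^sub>R v)) has_derivative (\<lambda>h. f' (x + s *\<^sub>R v) (h *\<^sub>R v))) (at s within S)"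
    by simp
  moreover have "linear (f' (x + s *\<^sub>R v))"
    using assms has_derivative_linear by blast
  ultimately show ?thesis
    by (simp add: has_vector_derivative_def linear_cmul)
qed

lemma difference_mvt:
  fixes f :: "'a::euclidean_space \<Rightarrow> real"
  assumes "\<And>x. (f has_derivative f' x) (at x)" "0 < (h::real)"
  obtains t where "0 < t" "t < h" "f (x + h *\<^sub>R v) - f x = h * f' (x + t *\<^sub>R v) v"
proof -
  have 1: "((\<lambda>s. f (x + s *\<^sub>R v)) has_derivative (\<lambda>u. u * f' (x + s *\<^sub>R v) v)) (at s)" for s
    using has_derivative_line[OF assms(1), of x v s UNIV]
    by (simp add: has_vector_derivative_def)
  have "continuous_on {0..h} (\<lambda>s. f (x + s *\<^sub>R v))"
    by (rule has_derivative_continuous_on[OF has_derivative_at_withinI[OF 1]])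
  from mvt[OF assms(2) this 1] obtain z where "0 < z" "z < h"
    "f (x + h *\<^sub>R v) - f (x + 0 *\<^sub>R v) = (h - 0) * f' (x + z *\<^sub>R v) v"
    by blast
  then show ?thesis using that by simp
qed

text \<open>The second difference of \<open>f\<close> over the parallelogram spanned by h u and h v
  is symmetric in u and v. Two mean value theorems write it as h^2 times either mixed derivative at
  a point that tends to \<open>x\<close> with h, and continuity of both derivatives identifies the
  limits.\<close>

lemma mixed_partials_commute:
  fixes f :: "'a::euclidean_space \<Rightarrow> real"
  assumes f: "\<And>x. (f has_derivative f' x) (at x)"
    and u: "\<And>x. ((\<lambda>z. f' z u) has_derivative fu x) (at x)" "continuous_on UNIV (\<lambda>x. fu x v)"
    and v: "\<And>x. ((\<lambda>z. f' z v) has_derivative fv x) (at x)" "continuous_on UNIV (\<lambda>x. fv x u)"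
  shows "fu x v = fv x u"
proof -
  have key: "\<exists>s t. 0 < s \<and> s < h \<and> 0 < t \<and> t < h \<and>
      f (x + h *\<^sub>R a + h *\<^sub>R b) - f (x + h *\<^sub>R a) - f (x + h *\<^sub>R b) + f x = h * h * fa (x + s *\<^sub>R a + t *\<^sub>R b) b"
    if "h > 0" and fa: "\<And>x. ((\<lambda>z. f' z a) has_derivative fa x) (at x)" for h a b fa
  proof -
    \<comment> \<open>The second difference is the increment in direction \<open>a\<close> of this
      increment in direction \<open>b\<close>, so the two mean value theorems can act one after the
      other.\<close>
    have g: "((\<lambda>x. f (x + h *\<^sub>R b) - f x) has_derivative (\<lambda>w. f' (x + h *\<^sub>R b) w - f' x w)) (at x)" for x
      by (intro has_derivative_diff f has_derivative_compose[OF _ f, of "\<lambda>x. x + h *\<^sub>R b" "\<lambda>w. w"])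
        (auto intro!: derivative_eq_intros)
    obtain s where s: "0 < s" "s < h"
      "(f (x + h *\<^sub>R a + h *\<^sub>R b) - f (x + h *\<^sub>R a)) - (f (x + h *\<^sub>R b) - f x) =
        h * (f' (x + s *\<^sub>R a + h *\<^sub>R b) a - f' (x + s *\<^sub>R a) a)"
      by (rule difference_mvt[OF g \<open>h > 0\<close>, of x a], rule that)
    obtain t where "0 < t" "t < h"
      "f' (x + s *\<^sub>R a + h *\<^sub>R b) a - f' (x + s *\<^sub>R a) a = h * fa (x + s *\<^sub>R a + t *\<^sub>R b) b"
      by (rule difference_mvt[OF fa \<open>h > 0\<close>, of "x + s *\<^sub>R a" b], rule that)
    with s show ?thesis by (intro exI[of _ s] exI[of _ t]) (auto simp: algebra_simps)
  qed
  define h where "h n = inverse (real (Suc n))" for n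
  have h: "h n > 0" "h \<longlonglongrightarrow> 0" for n
    unfolding h_def by (simp, rule LIMSEQ_inverse_real_of_nat)
  have "\<forall>n. \<exists>s t s' t'. 0 < s \<and> s < h n \<and> 0 < t \<and> t < h n \<and> 0 < s' \<and> s' < h n \<and> 0 < t' \<and> t' < h n \<and>
     fu (x + s *\<^sub>R u + t *\<^sub>R v) v = fv (x + s' *\<^sub>R v + t' *\<^sub>R u) u"
  proof
    fix n
    obtain s t where st: "0 < s" "s < h n" "0 < t" "t < h n"
      "f (x + h n *\<^sub>R u + h n *\<^sub>R v) - f (x + h n *\<^sub>R u) - f (x + h n *\<^sub>R v) + f x
         = h n * h n * fu (x + s *\<^sub>R u + t *\<^sub>R v) v"
      using key[OF h(1) u(1)] by blast
    obtain s' t' where st': "0 < s'" "s' < h n" "0 < t'" "t' < h n"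
      "f (x + h n *\<^sub>R v + h n *\<^sub>R u) - f (x + h n *\<^sub>R v) - f (x + h n *\<^sub>R u) + f x
         = h n * h n * fv (x + s' *\<^sub>R v + t' *\<^sub>R u) u"
      using key[OF h(1) v(1)] by blast
    have "h n * h n * fu (x + s *\<^sub>R u + t *\<^sub>R v) v = h n * h n * fv (x + s' *\<^sub>R v + t' *\<^sub>R u) u"
      using st(5) st'(5) by (simp add: algebra_simps)
    then have "fu (x + s *\<^sub>R u + t *\<^sub>R v) v = fv (x + s' *\<^sub>R v + t' *\<^sub>R u) u"
      using h(1)[of n] by simp
    with st st' show "\<exists>s t s' t'. 0 < s \<and> s < h n \<and> 0 < t \<and> t < h n \<and> 0 < s' \<and> s' < h n \<and> 0 < t' \<and> t' < h n \<and>
     fu (x + s *\<^sub>R u + t *\<^sub>R v) v = fv (x + s' *\<^sub>R v + t' *\<^sub>R u) u" by blast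
  qed
  then obtain s t s' t' where st: "\<And>n. 0 < s n \<and> s n < h n \<and> 0 < t n \<and> t n < h n \<and> 0 < s' n \<and> s' n < h n \<and> 0 < t' n \<and> t' n < h n"
    and eq: "\<And>n. fu (x + s n *\<^sub>R u + t n *\<^sub>R v) v = fv (x + s' n *\<^sub>R v + t' n *\<^sub>R u) u"
    by metis
  have lim: "a \<longlonglongrightarrow> 0" if "\<And>n. 0 < a n \<and> a n < h n" for a
    by (rule tendsto_sandwich[of "\<lambda>_. 0" _ _ h]) (use that h(2) in \<open>auto simp: less_imp_le\<close>)
  have lims: "s \<longlonglongrightarrow> 0" "t \<longlonglongrightarrow> 0" "s' \<longlonglongrightarrow> 0" "t' \<longlonglongrightarrow> 0"
    using st by (auto intro!: lim)
  have *: "(\<lambda>n. x + s n *\<^sub>R u + t n *\<^sub>R v) \<longlonglongrightarrow> x + 0 *\<^sub>R u + 0 *\<^sub>R v"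
    "(\<lambda>n. x + s' n *\<^sub>R v + t' n *\<^sub>R u) \<longlonglongrightarrow> x + 0 *\<^sub>R v + 0 *\<^sub>R u"
    by (intro tendsto_intros lims)+
  have "(\<lambda>n. fu (x + s n *\<^sub>R u + t n *\<^sub>R v) v) \<longlonglongrightarrow> fu x v"
    using continuous_on_tendsto_compose[OF u(2) *(1)] by simp
  moreover have "(\<lambda>n. fv (x + s' n *\<^sub>R v + t' n *\<^sub>R u) u) \<longlonglongrightarrow> fv x u"
    using continuous_on_tendsto_compose[OF v(2) *(2)] by simp
  ultimately show ?thesis
    unfolding eq using LIMSEQ_unique by blast
qed

section \<open>Exchanging time derivatives with spatial derivatives\<close>

lemma vector_derivative_bound_Icc:
  fixes f :: "real \<Rightarrow> 'a::real_normed_vector"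
  assumes "\<And>s. s \<in> {0..T} \<Longrightarrow> (f has_vector_derivative f' s) (at s within {0..T})"
    and "\<And>s. s \<in> {0..T} \<Longrightarrow> norm (f' s) \<le> C"
    and "s \<in> {0..T}" "t \<in> {0..T}"
  shows "norm (f t - f s) \<le> C * \<bar>t - s\<bar>"
proof -
  have "norm (f t - f s) \<le> C * norm (t - s)"
  proof (rule differentiable_bound[OF convex_closed_interval])
    show "(f has_derivative (\<lambda>h. h *\<^sub>R f' x)) (at x within {0..T})" if "x \<in> {0..T}" for x
      using assms(1)[OF that] by (simp add: has_vector_derivative_def)
    show "onorm (\<lambda>h. h *\<^sub>R f' x) \<le> C" if "x \<in> {0..T}" for x
      using assms(2)[OF that] by (intro onorm_le) (simp add: mult.commute[of C] mult_left_mono)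
  qed (use assms in auto)
  then show ?thesis by simp
qed

text \<open>The bound on \<open>H\<close> makes the difference quotients of \<open>G\<close> equi-Lipschitz in time, so those of
  \<open>F\<close> have a second-order Taylor expansion that survives the limit.\<close>

lemma directional_derivative_time_derivative:
  fixes F G H :: "real \<Rightarrow> 'a::real_normed_vector \<Rightarrow> 'b::real_normed_vector"
  assumes F: "\<And>s y. s \<in> {0..T} \<Longrightarrow> ((\<lambda>s. F s y) has_vector_derivative G s y) (at s within {0..T})"
    and G: "\<And>s y. s \<in> {0..T} \<Longrightarrow> ((\<lambda>s. G s y) has_vector_derivative H s y) (at s within {0..T})"
    and dF: "\<And>s y. s \<in> {0..T} \<Longrightarrow> (F s has_derivative F' s y) (at y)"
    and dG: "\<And>s y. s \<in> {0..T} \<Longrightarrow> (G s has_derivative G' s y) (at y)"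
    and H: "\<And>s y z. s \<in> {0..T} \<Longrightarrow> norm (H s y - H s z) \<le> C * norm (y - z)"
    and s: "s \<in> {0..T}"
  shows "((\<lambda>s. F' s y v) has_vector_derivative G' s y v) (at s within {0..T})"
proof -
  define Q where "Q K k s = (1 / k) *\<^sub>R (K s (y + k *\<^sub>R v) - K s y)" for K :: "real \<Rightarrow> 'a \<Rightarrow> 'b" and k :: real and s
  define c where "c = C * norm v"
  have der: "(Q F k has_vector_derivative Q G k s) (at s within {0..T})"
    "(Q G k has_vector_derivative Q H k s) (at s within {0..T})" if "s \<in> {0..T}" for k s
    unfolding Q_def
    by (intro bounded_linear.has_vector_derivative[OF bounded_linear_scaleR_right]
        has_vector_derivative_diff F G that)+
  have QH: "norm (Q H k s) \<le> c" if "k > 0" "s \<in> {0..T}" for k s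
  proof -
    have "norm (H s (y + k *\<^sub>R v) - H s y) \<le> C * (k * norm v)"
      using H[OF that(2), of "y + k *\<^sub>R v" y] that(1) by simp
    then have "norm (H s (y + k *\<^sub>R v) - H s y) / k \<le> c"
      using that(1) by (simp add: c_def field_simps)
    then show ?thesis using that(1) by (simp add: Q_def)
  qed
  have est: "norm (Q F k t - Q F k s - (t - s) *\<^sub>R Q G k s) \<le> c * \<bar>t - s\<bar> * \<bar>t - s\<bar>"
    if k: "k > 0" and t: "t \<in> {0..T}" for k t
  proof -
    \<comment> \<open>On the interval between \<open>s\<close> and \<open>t\<close> the Lipschitz
      bound c |r - s| is at most c |t - s|, which makes the remainder quadratic.\<close>
    define S where "S = {min s t..max s t}"
    have sub: "S \<subseteq> {0..T}" using s t unfolding S_def by auto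
    have "norm (Q F k t - Q F k s - (t - s) *\<^sub>R Q G k s) \<le> norm (t - s) * (c * \<bar>t - s\<bar>)"
    proof (rule vector_differentiable_bound_linearization[where S = S])
      show "closed_segment s t \<subseteq> S" by (auto simp: S_def closed_segment_eq_real_ivl)
      show "s \<in> S" by (auto simp: S_def)
      fix r assume r: "r \<in> S"
      then have r': "r \<in> {0..T}" using sub by blast
      show "(Q F k has_vector_derivative Q G k r) (at r within S)"
        by (rule has_vector_derivative_within_subset[OF der(1)[OF r'] sub])
      have "norm (Q G k r - Q G k s) \<le> c * \<bar>r - s\<bar>"
        by (rule vector_derivative_bound_Icc[OF der(2) QH[OF k] s r'])
      also have "\<dots> \<le> c * \<bar>t - s\<bar>"
        using r order_trans[OF norm_ge_zero QH[OF k s]] unfolding S_def by (intro mult_left_mono) auto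
      finally show "norm (Q G k r - Q G k s) \<le> c * \<bar>t - s\<bar>" .
    qed
    then show ?thesis by (simp add: mult.commute)
  qed
  have lim: "((\<lambda>k. Q K k s) \<longlongrightarrow> K' v) (at_right 0)"
    if "(K s has_derivative K') (at y)" for K K' s
  proof -
    have "((\<lambda>k. K s (y + k *\<^sub>R v)) has_derivative (\<lambda>h. K' (h *\<^sub>R v))) (at 0)"
      by (rule has_derivative_compose[of "\<lambda>k. y + k *\<^sub>R v" "\<lambda>h. h *\<^sub>R v" 0 UNIV "K s" K'])
        (auto intro!: derivative_eq_intros that)
    then have "((\<lambda>k. K s (y + k *\<^sub>R v)) has_vector_derivative K' v) (at 0)"
      using has_derivative_linear[OF that] by (simp add: has_vector_derivative_def linear_cmul)
    then have "((\<lambda>k. norm (K s (y + k *\<^sub>R v) - K s y - k *\<^sub>R K' v) / norm k) \<longlongrightarrow> 0) (at 0)"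
      unfolding has_vector_derivative_def has_derivative_at by simp
    then have "((\<lambda>k. norm (Q K k s - K' v)) \<longlongrightarrow> 0) (at 0)"
    proof (rule Lim_transform_eventually)
      have "norm (K s (y + k *\<^sub>R v) - K s y - k *\<^sub>R K' v) / norm k = norm (Q K k s - K' v)" if "k \<noteq> 0" for k
      proof -
        have "Q K k s - K' v = (1 / k) *\<^sub>R (K s (y + k *\<^sub>R v) - K s y - k *\<^sub>R K' v)"
          using that by (simp add: Q_def scaleR_diff_right)
        then show ?thesis by simp
      qed
      then show "\<forall>\<^sub>F k in at 0. norm (K s (y + k *\<^sub>R v) - K s y - k *\<^sub>R K' v) / norm k = norm (Q K k s - K' v)"
        by (auto simp: eventually_at intro: exI[of _ 1])
    qed
    then have "((\<lambda>k. Q K k s) \<longlongrightarrow> K' v) (at 0)"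
      by (rule LIM_zero_cancel[OF tendsto_norm_zero_cancel])
    then show ?thesis using filterlim_at_split by blast
  qed
  \<comment> \<open>\<open>c\<close> does not depend on the spatial increment \<open>k\<close>, so
    the quadratic remainder passes to the limit; no continuity of \<open>G'\<close> in time
    enters.\<close>
  have fin: "norm (F' t y v - F' s y v - (t - s) *\<^sub>R G' s y v) \<le> c * \<bar>t - s\<bar> * \<bar>t - s\<bar>"
    if t: "t \<in> {0..T}" for t
  proof (rule tendsto_upperbound)
    show "((\<lambda>k. norm (Q F k t - Q F k s - (t - s) *\<^sub>R Q G k s)) \<longlongrightarrow>
        norm (F' t y v - F' s y v - (t - s) *\<^sub>R G' s y v)) (at_right 0)"
      by (intro tendsto_intros lim dF dG s t)
    show "\<forall>\<^sub>F k in at_right 0. norm (Q F k t - Q F k s - (t - s) *\<^sub>R Q G k s) \<le> c * \<bar>t - s\<bar> * \<bar>t - s\<bar>"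
      using est[OF _ t] by (auto simp: eventually_at_right_field intro: exI[of _ 1])
  qed simp
  show ?thesis
    unfolding has_vector_derivative_def has_derivative_within_alt
  proof (intro conjI allI impI)
    show "bounded_linear (\<lambda>x. x *\<^sub>R G' s y v)" by (simp add: bounded_linear_scaleR_left)
    fix e :: real assume "e > 0"
    have c: "c \<ge> 0" using QH[of 1 s] s norm_ge_zero[of "Q H 1 s"] by linarith
    show "\<exists>d>0. \<forall>t\<in>{0..T}. norm (t - s) < d \<longrightarrow> norm (F' t y v - F' s y v - (t - s) *\<^sub>R G' s y v) \<le> e * norm (t - s)"
    proof (intro exI[of _ "e / (c + 1)"] conjI ballI impI)
      show "e / (c + 1) > 0" using \<open>e > 0\<close> c by simp
      fix t assume t: "t \<in> {0..T}" "norm (t - s) < e / (c + 1)"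
      then have "(c + 1) * \<bar>t - s\<bar> < e" using c by (simp add: field_simps)
      then have "c * \<bar>t - s\<bar> \<le> e" by (simp add: algebra_simps)
      then have "c * \<bar>t - s\<bar> * \<bar>t - s\<bar> \<le> e * \<bar>t - s\<bar>" by (intro mult_right_mono) auto
      then show "norm (F' t y v - F' s y v - (t - s) *\<^sub>R G' s y v) \<le> e * norm (t - s)"
        using fin[OF t(1)] by simp
    qed
  qed
qed

section \<open>A local Gronwall argument\<close>

text \<open>The mean value inequality dominates the difference quotients by the bound on
  \<open>F'\<close>, so dominated convergence applies along every sequence tending to
  \<open>s\<close>. Measurability of \<open>F' s\<close> comes from its being a pointwise limit of
  difference quotients; this matters because \<open>F'\<close> will contain the acceleration, whose
  dependence on time is not controlled beforehand.\<close>

lemma integral_dominated_time_derivative: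
  fixes F :: "real \<Rightarrow> 'a::euclidean_space \<Rightarrow> real"
  assumes "T > 0" and s: "s \<in> {0..T}"
    and F': "\<And>s y. s \<in> {0..T} \<Longrightarrow> ((\<lambda>s. F s y) has_real_derivative F' s y) (at s within {0..T})"
    and bound: "\<And>s y. s \<in> {0..T} \<Longrightarrow> \<bar>F' s y\<bar> \<le> B * indicator (cball x r) y"
    and int: "\<And>s. s \<in> {0..T} \<Longrightarrow> integrable lborel (F s)"
  shows "((\<lambda>s. LINT y|lborel. F s y) has_real_derivative (LINT y|lborel. F' s y)) (at s within {0..T})"
    and "integrable lborel (F' s)"
proof -
  have key: "(\<lambda>n. LINT y|lborel. (F (X n) y - F s y) / (X n - s)) \<longlonglongrightarrow> (LINT y|lborel. F' s y)"
    "integrable lborel (F' s)"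
    if X: "\<And>n. X n \<in> {0..T} - {s}" "X \<longlonglongrightarrow> s" for X
  proof -
    have lim: "(\<lambda>n. (F (X n) y - F s y) / (X n - s)) \<longlonglongrightarrow> F' s y" for y
    proof -
      have "((\<lambda>t. (F t y - F s y) / (t - s)) \<longlongrightarrow> F' s y) (at s within {0..T})"
        using F'[OF s] by (simp add: has_field_derivative_iff)
      then show ?thesis
        using X unfolding tendsto_at_iff_sequentially comp_def by blast
    qed
    have meas: "(\<lambda>y. (F (X n) y - F s y) / (X n - s)) \<in> borel_measurable lborel" for n
      using int[of "X n"] int[of s] X(1)[of n] s by (intro borel_measurable_divide borel_measurable_diff) auto
    have meas': "F' s \<in> borel_measurable lborel"
      by (rule borel_measurable_LIMSEQ_real[OF lim meas])
    have "norm (F (X n) y - F s y) \<le> (B * indicator (cball x r) y) * \<bar>X n - s\<bar>" for n y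
      by (rule vector_derivative_bound_Icc[where f="\<lambda>s. F s y" and f'="\<lambda>s. F' s y" and T=T])
        (use F' bound s X(1)[of n] in \<open>auto simp: has_real_derivative_iff_has_vector_derivative\<close>)
    then have dom: "norm ((F (X n) y - F s y) / (X n - s)) \<le> B * indicator (cball x r) y" for n y
      using X(1)[of n] by (simp add: divide_le_eq)
    have intw: "integrable lborel (\<lambda>y. B * indicator (cball x r) y)"
      by (intro integrable_mult_right integrable_real_indicator)
        (use emeasure_bounded_finite[OF bounded_cball, of x r] in \<open>auto simp: less_top\<close>)
    note dct = meas' meas intw AE_I2[OF lim] AE_I2[OF dom]
    show "(\<lambda>n. LINT y|lborel. (F (X n) y - F s y) / (X n - s)) \<longlonglongrightarrow> (LINT y|lborel. F' s y)"
      by (rule integral_dominated_convergence[OF dct])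
    show "integrable lborel (F' s)"
      by (rule integrable_dominated_convergence[OF dct])
  qed
  \<comment> \<open>Integrability of \<open>F' s\<close> needs one actual sequence tending to
    \<open>s\<close>, which exists because the interval is nondegenerate.\<close>
  have "s islimpt {0..T}" using assms(1,2) by (simp add: islimpt_Icc)
  then obtain X where "\<And>n. X n \<in> {0..T} - {s}" "X \<longlonglongrightarrow> s"
    unfolding islimpt_sequential by blast
  then show "integrable lborel (F' s)" by (rule key)
  show "((\<lambda>s. LINT y|lborel. F s y) has_real_derivative (LINT y|lborel. F' s y)) (at s within {0..T})"
    unfolding has_field_derivative_iff tendsto_at_iff_sequentially
  proof (intro allI impI)
    fix X :: "nat \<Rightarrow> real" assume X: "\<forall>n. X n \<in> {0..T} - {s}" "X \<longlonglongrightarrow> s"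
    have "(LINT y|lborel. (F (X n) y - F s y) / (X n - s)) =
        ((LINT y|lborel. F (X n) y) - (LINT y|lborel. F s y)) / (X n - s)" for n
      using int[of "X n"] int[of s] X(1) s by simp
    then show "((\<lambda>t. ((LINT y|lborel. F t y) - (LINT y|lborel. F s y)) / (t - s)) \<circ> X) \<longlonglongrightarrow> (LINT y|lborel. F' s y)"
      using key(1)[of X] X by (simp add: comp_def)
  qed
qed

section \<open>Integrals of directional derivatives over the whole space\<close>

lemma integrable_continuous_compact_support:
  fixes f :: "'a::euclidean_space \<Rightarrow> real"
  assumes "continuous_on UNIV f" "\<And>y. y \<notin> cball x r \<Longrightarrow> f y = 0"
  shows "integrable lborel f"
proof -
  have "integrable lborel (\<lambda>y. indicator (cball x r) y *\<^sub>R f y)"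
    by (rule borel_integrable_compact) (auto intro: continuous_on_subset[OF assms(1)])
  moreover have "(\<lambda>y. indicator (cball x r) y *\<^sub>R f y) = f"
    using assms(2) by (auto simp: indicator_def fun_eq_iff)
  ultimately show ?thesis by simp
qed

text \<open>By translation invariance the integral of f (y + s v) does not depend on s;
  differentiating under the integral at s = 0 shows that the derivative integrates to 0. This is the
  divergence theorem for compact support, with neither Fubini nor boundary terms.\<close>

lemma
  fixes f :: "'a::euclidean_space \<Rightarrow> real"
  assumes f: "\<And>y. (f has_derivative f' y) (at y)"
    and cont: "continuous_on UNIV (\<lambda>y. f' y v)"
    and supp: "\<And>y. y \<notin> cball x r \<Longrightarrow> f y = 0"
  shows integrable_directional_derivative: "integrable lborel (\<lambda>y. f' y v)"
    and integral_directional_derivative: "(LINT y|lborel. f' y v) = 0"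
proof -
  have supp': "f' y v = 0" if "y \<notin> cball x r" for y
  proof -
    have "((\<lambda>_. 0) has_derivative f' y) (at y)"
      by (rule has_derivative_transform_within_open[OF f, of "- cball x r"])
        (use that supp in auto)
    then have "f' y = (\<lambda>_. 0)"
      by (metis has_derivative_const has_derivative_unique)
    then show ?thesis by simp
  qed
  show int: "integrable lborel (\<lambda>y. f' y v)"
    by (rule integrable_continuous_compact_support[OF cont supp'])
  have "bounded ((\<lambda>y. f' y v) ` cball x r)"
    by (intro compact_imp_bounded compact_continuous_image continuous_on_subset[OF cont]) auto
  then obtain B where "\<And>y. y \<in> cball x r \<Longrightarrow> norm (f' y v) \<le> B"
    unfolding bounded_iff by blast
  then have B: "\<bar>f' y v\<bar> \<le> max B 0" for y
    using supp'[of y] by (cases "y \<in> cball x r") (auto simp: le_max_iff_disj)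
  have cf: "continuous_on UNIV f"
    by (rule has_derivative_continuous_on[OF has_derivative_at_withinI[OF f]])
  have transl: "(LINT y|lborel. f (y + s *\<^sub>R v)) = (LINT y|lborel. f y)" for s :: real
  proof -
    have "(LINT y|distr lborel borel ((+) (s *\<^sub>R v)). f y) = (LINT y|lborel. f (s *\<^sub>R v + y))"
      using cf by (intro integral_distr) (auto intro: borel_measurable_continuous_onI)
    then show ?thesis by (simp add: lborel_distr_plus add.commute)
  qed
  \<comment> \<open>For s in [0, 1] a translation moves the support by at most |v|, so the radius r
    + |v| serves all s at once.\<close>
  have out: "y + s *\<^sub>R v \<notin> cball x r" if "s \<in> {0..1}" "y \<notin> cball x (r + norm v)" for y and s :: real
  proof -
    have "norm (s *\<^sub>R v) \<le> norm v" using that(1) by (simp add: mult_left_le_one_le)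
    moreover have "dist x y \<le> dist x (y + s *\<^sub>R v) + norm (s *\<^sub>R v)"
      using dist_triangle[of x y "y + s *\<^sub>R v"] by (simp add: dist_norm)
    ultimately show ?thesis using that(2) by auto
  qed
  have "((\<lambda>s. LINT y|lborel. f (y + s *\<^sub>R v)) has_real_derivative (LINT y|lborel. f' (y + 0 *\<^sub>R v) v)) (at 0 within {0..1})"
  proof (rule integral_dominated_time_derivative)
    fix s :: real and y assume s: "s \<in> {0..1}"
    show "((\<lambda>s. f (y + s *\<^sub>R v)) has_real_derivative f' (y + s *\<^sub>R v) v) (at s within {0..1})"
      using has_derivative_line[OF f] by (simp add: has_real_derivative_iff_has_vector_derivative)
    show "\<bar>f' (y + s *\<^sub>R v) v\<bar> \<le> max B 0 * indicator (cball x (r + norm v)) y"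
      using B supp'[OF out[OF s]] by (auto simp: indicator_def)
    show "integrable lborel (\<lambda>y. f (y + s *\<^sub>R v))"
      by (rule integrable_continuous_compact_support[where x=x and r="r + norm v"])
        (use supp[OF out[OF s]] in \<open>auto intro!: continuous_on_compose2[OF cf] continuous_intros\<close>)
  qed auto
  then have "((\<lambda>s. LINT y|lborel. f y) has_real_derivative (LINT y|lborel. f' y v)) (at 0 within {0..1})"
    unfolding transl by simp
  then have *: "((\<lambda>s. LINT y|lborel. f y) has_vector_derivative (LINT y|lborel. f' y v)) (at 0 within {0..1})"
    by (simp add: has_real_derivative_iff_has_vector_derivative)
  \<comment> \<open>A constant function of s also has derivative 0, and one-sided derivatives at the
    end of an interval are unique.\<close>
  show "(LINT y|lborel. f' y v) = 0"
    using vector_derivative_unique_within_closed_interval[of 0 1 0, OF _ _ *[folded box_real(2)] has_vector_derivative_const]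
    by simp
qed

text \<open>Integration removes the divergence, so the total energy E satisfies E' \<le> C E with E
  0 = 0, and Gronwall forces E = 0. A nonnegative continuous density with zero integral vanishes
  everywhere, hence the pointwise conclusion.\<close>

lemma local_energy_vanishes:
  fixes F :: "real \<Rightarrow> 'a::euclidean_space \<Rightarrow> real" and G :: "real \<Rightarrow> 'a \<Rightarrow> 'a"
  assumes "T > 0"
    and F': "\<And>s y. s \<in> {0..T} \<Longrightarrow> ((\<lambda>s. F s y) has_real_derivative F' s y) (at s within {0..T})"
    and bound: "\<And>s y. s \<in> {0..T} \<Longrightarrow> \<bar>F' s y\<bar> \<le> B * indicator (cball x r) y"
    and cont: "\<And>s. s \<in> {0..T} \<Longrightarrow> continuous_on UNIV (F s)"
    and supp: "\<And>s y. s \<in> {0..T} \<Longrightarrow> y \<notin> cball x r \<Longrightarrow> F s y = 0 \<and> G s y = 0"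
    and nonneg: "\<And>s y. s \<in> {0..T} \<Longrightarrow> 0 \<le> F s y" and init: "\<And>y. F 0 y = 0"
    and G: "\<And>s y. s \<in> {0..T} \<Longrightarrow> (G s has_derivative G' s y) (at y)"
    and contG: "\<And>s v w. s \<in> {0..T} \<Longrightarrow> continuous_on UNIV (\<lambda>y. G' s y v \<bullet> w)"
    and le: "\<And>s y. s \<in> {0..T} \<Longrightarrow> F' s y \<le> C * F s y - (\<Sum>b\<in>Basis. G' s y b \<bullet> b)"
    and s: "s \<in> {0..T}"
  shows "F s y = 0"
proof -
  define E where "E s = (LINT y|lborel. F s y)" for s
  have intF: "integrable lborel (F s)" if "s \<in> {0..T}" for s
    by (rule integrable_continuous_compact_support[OF cont[OF that]]) (use supp that in blast)
  note dE = integral_dominated_time_derivative[OF \<open>T > 0\<close> _ F' bound intF, folded E_def]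
  have dG: "integrable lborel (\<lambda>y. G' s y b \<bullet> b)" "(LINT y|lborel. G' s y b \<bullet> b) = 0"
    if s: "s \<in> {0..T}" for s b
  proof -
    have "((\<lambda>y. G s y \<bullet> b) has_derivative (\<lambda>v. G' s y v \<bullet> b)) (at y)" for y
      by (intro has_derivative_inner_left G s)
    moreover have "G s y \<bullet> b = 0" if "y \<notin> cball x r" for y
      using supp[OF s that] by simp
    ultimately show "integrable lborel (\<lambda>y. G' s y b \<bullet> b)" "(LINT y|lborel. G' s y b \<bullet> b) = 0"
      using integrable_directional_derivative[of "\<lambda>y. G s y \<bullet> b" "\<lambda>y v. G' s y v \<bullet> b" b x r]
        integral_directional_derivative[of "\<lambda>y. G s y \<bullet> b" "\<lambda>y v. G' s y v \<bullet> b" b x r] contG[OF s]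
      by auto
  qed
  have E': "(LINT y|lborel. F' s y) \<le> C * E s" if s: "s \<in> {0..T}" for s
  proof -
    have "(LINT y|lborel. F' s y) \<le> (LINT y|lborel. C * F s y - (\<Sum>b\<in>Basis. G' s y b \<bullet> b))"
      using dE(2)[OF s] intF[OF s] dG(1)[OF s] by (intro integral_mono le s) auto
    also have "\<dots> = C * E s - (\<Sum>b\<in>Basis. LINT y|lborel. G' s y b \<bullet> b)"
      using intF[OF s] dG(1)[OF s] by (simp add: E_def)
    finally show ?thesis using dG(2)[OF s] by simp
  qed
  \<comment> \<open>Gronwall with an integrating factor. Inside the interval the one-sided
    derivative is two-sided; continuity covers the end points.\<close>
  have "E s * exp (- C * s) \<le> E 0 * exp (- C * 0)"
  proof (rule DERIV_nonpos_imp_decreasing_open[of 0 s "\<lambda>s. E s * exp (- C * s)"])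
    show "0 \<le> s" using s by simp
    show "\<exists>y. ((\<lambda>s. E s * exp (- C * s)) has_real_derivative y) (at u) \<and> y \<le> 0" if u: "0 < u" "u < s" for u
    proof (intro exI conjI)
      have "at u within {0..T} = at u"
        using u s by (intro at_within_interior) (auto simp: interior_atLeastAtMost_real)
      then have "(E has_real_derivative (LINT y|lborel. F' u y)) (at u)"
        using dE(1)[of u] u s by auto
      then show "((\<lambda>s. E s * exp (- C * s)) has_real_derivative
          ((LINT y|lborel. F' u y) - C * E u) * exp (- C * u)) (at u)"
        by (auto intro!: derivative_eq_intros simp: algebra_simps)
      show "((LINT y|lborel. F' u y) - C * E u) * exp (- C * u) \<le> 0"
        using E'[of u] u s by (intro mult_nonpos_nonneg) auto
    qed
    have "continuous_on {0..T} E"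
      using dE(1) by (intro DERIV_continuous_on) auto
    then show "continuous_on {0..s} (\<lambda>s. E s * exp (- C * s))"
      using s by (intro continuous_intros) (auto intro: continuous_on_subset)
  qed
  then have "E s \<le> 0" using exp_gt_zero[of "- C * s"] init
    by (simp add: E_def mult_le_0_iff)
  moreover have "E s \<ge> 0" unfolding E_def using nonneg[OF s] by simp
  ultimately have "AE y in lborel. F s y = 0"
    using integral_nonneg_eq_0_iff_AE[OF intF[OF s]] nonneg[OF s] unfolding E_def by simp
  \<comment> \<open>The zero set of a continuous function is closed, and a closed set of full
    measure is the whole space.\<close>
  then have "AE y in lebesgue. y \<in> {y. F s y = 0}" using AE_completion by auto
  then have "y \<in> {y. F s y = 0}"
    by (intro mem_closed_if_AE_lebesgue)
      (use closed_vimage[OF closed_singleton[of 0] cont[OF s]] in \<open>auto simp: vimage_def\<close>)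
  then show ?thesis by simp
qed

section \<open>Cofactors and the Piola identity\<close>

lemma bounded_bilinear_matrix_vector_mult:
  "bounded_bilinear ((*v) :: real^'n^'m \<Rightarrow> real^'n \<Rightarrow> real^'m)"
  by (simp add: bilinear_conv_bounded_bilinear[symmetric] bilinear_def linear_iff
      matrix_vector_right_distrib matrix_vector_mult_add_rdistrib
      scaleR_matrix_vector_assoc matrix_vector_mult_scaleR)

lemma bounded_bilinear_matrix_matrix_mult:
  "bounded_bilinear ((**) :: real^'n^'m \<Rightarrow> real^'k^'n \<Rightarrow> real^'k^'m)"
  by (simp add: bilinear_conv_bounded_bilinear[symmetric] bilinear_def linear_iff
      matrix_matrix_mult_def vec_eq_iff sum.distrib sum_distrib_left algebra_simps)

text \<open>The cofactor indices j + 1 and j + 2 run up to 5 in the type \<open>3\<close>, so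
  evaluating them needs these reductions.\<close>

lemma mod_three_simps [simp]: "(4::3) = 1" "(5::3) = 2"
  by simp_all

text \<open>Indices are taken modulo 3, which absorbs the signs of the cofactors.\<close>

definition mixed_cofactor :: "real^3^3 \<Rightarrow> real^3^3 \<Rightarrow> real^3^3" where
  "mixed_cofactor M N =
     (\<chi> k j. M $ (j+1) $ (k+1) * N $ (j+2) $ (k+2) - M $ (j+1) $ (k+2) * N $ (j+2) $ (k+1))"

definition adjugate :: "real^3^3 \<Rightarrow> real^3^3" where
  "adjugate M = mixed_cofactor M M"

lemma bounded_bilinear_mixed_cofactor: "bounded_bilinear mixed_cofactor"
  by (simp add: bilinear_conv_bounded_bilinear[symmetric] bilinear_def linear_iff
      mixed_cofactor_def vec_eq_iff algebra_simps)

lemma matrix_mult_adjugate: "M ** adjugate M = det M *\<^sub>R mat 1"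
  and adjugate_mult_matrix: "adjugate M ** M = det M *\<^sub>R mat 1"
  by (simp_all add: vec_eq_iff forall_3 adjugate_def mixed_cofactor_def matrix_matrix_mult_def
      sum_3 det_3 mat_def algebra_simps)

lemma matrix_inv_adjugate:
  assumes "det M \<noteq> 0"
  shows "matrix_inv M = inverse (det M) *\<^sub>R adjugate M"
proof -
  interpret bounded_bilinear "(**) :: real^3^3 \<Rightarrow> real^3^3 \<Rightarrow> real^3^3"
    by (rule bounded_bilinear_matrix_matrix_mult)
  have "M ** (inverse (det M) *\<^sub>R adjugate M) = mat 1"
    "(inverse (det M) *\<^sub>R adjugate M) ** M = mat 1"
    using assms by (simp_all add: scaleR_left scaleR_right matrix_mult_adjugate adjugate_mult_matrix)
  then have inv: "M ** matrix_inv M = mat 1 \<and> matrix_inv M ** M = mat 1"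
    unfolding matrix_inv_def by (intro someI_ex[of "\<lambda>A'. M ** A' = mat 1 \<and> A' ** M = mat 1"]) blast
  have "matrix_inv M = matrix_inv M ** (M ** (inverse (det M) *\<^sub>R adjugate M))"
    using \<open>M ** _ = mat 1\<close> by simp
  then show ?thesis using inv by (simp only: matrix_mul_assoc matrix_mul_lid)
qed

text \<open>The adjugate is quadratic in its entries, the diagonal of the bilinear map
  \<open>mixed_cofactor\<close>, so this is the product rule.\<close>

lemma has_derivative_adjugate:
  assumes "(M has_derivative M') (at x within S)"
  shows "((\<lambda>x. adjugate (M x)) has_derivative (\<lambda>h. mixed_cofactor (M x) (M' h) + mixed_cofactor (M' h) (M x))) (at x within S)"
  unfolding adjugate_def by (rule bounded_bilinear.FDERIV[OF bounded_bilinear_mixed_cofactor assms assms])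

text \<open>Jacobi's formula, read off from the expanded 3 by 3 determinant.\<close>

lemma has_derivative_det:
  assumes "(M has_derivative M') (at x within S)"
  shows "((\<lambda>x. det (M x)) has_derivative (\<lambda>h. trace (adjugate (M x) ** M' h))) (at x within S)"
proof -
  have [derivative_intros]: "((\<lambda>x. M x $ i $ j) has_derivative (\<lambda>h. M' h $ i $ j)) (at x within S)" for i j
    by (intro bounded_linear.has_derivative[OF bounded_linear_vec_nth] assms)
  show ?thesis
    unfolding det_3
    by (rule derivative_eq_intros refl)+
      (simp add: fun_eq_iff trace_def adjugate_def mixed_cofactor_def matrix_matrix_mult_def sum_3 algebra_simps)
qed

text \<open>Here \<open>B\<close> plays the role of the derivative of a Jacobian matrix field with value \<open>M\<close>, and the
  summands are derivatives of its adjugate.\<close>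

lemma piola:
  assumes "\<And>u v. B u *v v = B v *v u"
  shows "(\<Sum>k\<in>UNIV. ((mixed_cofactor M (B (axis k 1)) + mixed_cofactor (B (axis k 1)) M) *v v) $ k) = 0"
proof -
  have sym: "B (axis k 1) $ i $ m = B (axis m 1) $ i $ k" for i k m
    using arg_cong[OF assms[of "axis k 1" "axis m 1"], of "\<lambda>v. v $ i"]
    by (simp add: matrix_vector_mult_basis column_def)
  show ?thesis
    by (simp add: sum_3 mixed_cofactor_def matrix_vector_mult_def
        sym[of 2 _ 1] sym[of 3 _ 1] sym[of 3 _ 2] algebra_simps)
qed

lemma sum_Basis_real_vec:
  fixes f :: "real^'n \<Rightarrow> 'a::comm_monoid_add"
  shows "(\<Sum>b\<in>Basis. f b) = (\<Sum>k\<in>UNIV. f (axis k 1))"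
proof -
  have "inj (\<lambda>k::'n. axis k (1::real))" by (auto simp: inj_on_def axis_eq_axis)
  moreover have "(Basis :: (real^'n) set) = range (\<lambda>k. axis k 1)" by (auto simp: Basis_vec_def)
  ultimately show ?thesis using sum.reindex[of "\<lambda>k::'n. axis k (1::real)" UNIV f] by simp
qed

lemma trace_eq_sum_axis: "trace (A :: real^'n^'n) = (\<Sum>k\<in>UNIV. (A *v axis k 1) $ k)"
  by (simp add: trace_def matrix_vector_mult_basis column_def)

text \<open>When \<open>M\<close> is a Jacobian field, the columns of its adjugate are divergence
  free by the Piola identity, whose hypothesis \<open>sym\<close> is the symmetry of second
  derivatives. Hence the divergence of the flux differentiates only \<open>f\<close> and
  \<open>V\<close>, and second derivatives hidden in \<open>M\<close> cancel.\<close>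

lemma
  fixes f :: "real^3 \<Rightarrow> real"
  assumes f: "(f has_derivative (\<lambda>h. g \<bullet> h)) (at y)"
    and M: "(M has_derivative M') (at y)" and sym: "\<And>u v. M' u *v v = M' v *v u"
    and V: "(V has_derivative (\<lambda>h. DV *v h)) (at y)"
  defines "G' \<equiv> \<lambda>h. (g \<bullet> h) *\<^sub>R (adjugate (M y) *v V y) +
     f y *\<^sub>R ((mixed_cofactor (M y) (M' h) + mixed_cofactor (M' h) (M y)) *v V y + adjugate (M y) *v (DV *v h))"
  shows has_derivative_cofactor_flux: "((\<lambda>y. f y *\<^sub>R (adjugate (M y) *v V y)) has_derivative G') (at y)"
    and divergence_cofactor_flux: "(\<Sum>b\<in>Basis. G' b \<bullet> b) = g \<bullet> (adjugate (M y) *v V y) + f y * trace (adjugate (M y) ** DV)"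
proof -
  show "((\<lambda>y. f y *\<^sub>R (adjugate (M y) *v V y)) has_derivative G') (at y)"
    unfolding G'_def
    by (rule has_derivative_eq_rhs[OF has_derivative_scaleR[OF f
          bounded_bilinear.FDERIV[OF bounded_bilinear_matrix_vector_mult has_derivative_adjugate[OF M] V]]])
      (simp add: algebra_simps)
  have "(\<Sum>b\<in>Basis. G' b \<bullet> b) = (\<Sum>k\<in>UNIV. g $ k * (adjugate (M y) *v V y) $ k)
     + f y * ((\<Sum>k\<in>UNIV. ((mixed_cofactor (M y) (M' (axis k 1)) + mixed_cofactor (M' (axis k 1)) (M y)) *v V y) $ k)
     + (\<Sum>k\<in>UNIV. ((adjugate (M y) ** DV) *v axis k 1) $ k))"
    unfolding sum_Basis_real_vec G'_def
    by (simp add: inner_axis sum.distrib sum_distrib_left algebra_simps matrix_vector_mul_assoc)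
  then show "(\<Sum>b\<in>Basis. G' b \<bullet> b) = g \<bullet> (adjugate (M y) *v V y) + f y * trace (adjugate (M y) ** DV)"
    using piola[OF sym] by (simp add: trace_eq_sum_axis inner_vec_def)
qed

text \<open>For continuous \<open>f\<close> the set where the bound holds is closed, so an almost
  everywhere bound holds at every point. The maximum with 0 appears because \<open>ennreal\<close>
  sends negative reals to 0.\<close>

lemma norm_le_if_Linf_norm_le:
  assumes "continuous_on UNIV f" "Linf_norm f \<le> ennreal C"
  shows "norm (f y) \<le> max C 0"
proof -
  have "AE y in lborel. ennreal (norm (f y)) \<le> ennreal C"
    using esssup_AE[of "\<lambda>y. ennreal (norm (f y))" lborel] assms(2) unfolding Linf_norm_def
    by (auto elim!: eventually_mono intro: order_trans)
  then have "AE y in lborel. norm (f y) \<le> max C 0"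
    by (auto elim!: eventually_mono simp: ennreal_le_iff2)
  then have "AE y in lebesgue. y \<in> {y. norm (f y) \<le> max C 0}"
    using AE_completion by auto
  then have "y \<in> {y. norm (f y) \<le> max C 0}"
    by (intro mem_closed_if_AE_lebesgue)
      (auto intro!: closed_Collect_le continuous_intros assms(1))
  then show ?thesis by simp
qed

section \<open>The energy density\<close>

text \<open>In the equation for \<phi> the divergence of the velocity has the coefficient
  q/\<kappa>, with \<kappa> = \<alpha>/(1 + \<alpha>); the weight \<kappa>/q reduces it to 1, the
  coefficient with which the gradient of \<phi> enters after \<open>P\<close> has symmetrized the
  momentum equation. The last term is there because \<phi> alone does not control \<theta>.\<close>

definition energy_density :: "real \<Rightarrow> real^3^3 \<Rightarrow> real^3 \<Rightarrow> real \<Rightarrow> real \<Rightarrow> real^3 \<Rightarrow> real" where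
  "energy_density \<kappa> P v \<phi> q \<theta> = (P *v v) \<bullet> (P *v v) + \<kappa> * \<phi>\<^sup>2 / q + \<theta> \<bullet> \<theta>"

lemma transpose_adjoint: "(transpose A *v x) \<bullet> y = x \<bullet> (A *v y)" for A :: "real^3^3"
  using dot_lmul_matrix[of x A y] vector_transpose_matrix[of x "transpose A"] by simp

lemma norm_transpose [simp]: "norm (transpose A) = norm A" for A :: "real^'n^'m"
proof -
  have "(norm (transpose A))\<^sup>2 = (norm A)\<^sup>2"
    unfolding power2_norm_eq_inner inner_vec_def transpose_def vec_lambda_beta by (rule sum.swap)
  then show ?thesis by simp
qed

lemma energy_density_nonneg: "0 < q \<Longrightarrow> 0 < \<kappa> \<Longrightarrow> 0 \<le> energy_density \<kappa> P v \<phi> q \<theta>"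
  by (simp add: energy_density_def)

text \<open>A right inverse of a square matrix is a left inverse, so v = N P^T (P v), which costs
  B^2. For \<phi>, the bounds \<kappa> \<le> 1 and q \<le> B \<le> B^2 give (\<kappa> \<phi> / B)^2
  \<le> \<kappa> \<phi>^2 / q.\<close>

lemma energy_density_coercive:
  assumes "0 < \<kappa>" "1 \<le> B" "0 < q" "q \<le> B" "\<kappa> \<le> 1"
    and PN: "transpose P ** P ** N = mat 1" and B: "norm P \<le> B" "norm N \<le> B"
  shows "norm v \<le> B^2 * sqrt (energy_density \<kappa> P v \<phi> q \<theta>)"
    and "\<bar>\<phi>\<bar> \<le> (B / \<kappa>) * sqrt (energy_density \<kappa> P v \<phi> q \<theta>)"
    and "norm \<theta> \<le> sqrt (energy_density \<kappa> P v \<phi> q \<theta>)"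
    and "norm (P *v v) \<le> sqrt (energy_density \<kappa> P v \<phi> q \<theta>)"
proof -
  let ?e = "energy_density \<kappa> P v \<phi> q \<theta>"
  show P: "norm (P *v v) \<le> sqrt ?e" and "norm \<theta> \<le> sqrt ?e"
    using assms by (auto intro!: real_le_rsqrt simp: energy_density_def power2_norm_eq_inner)
  have "N ** (transpose P ** P) = mat 1"
    using PN matrix_left_right_inverse by blast
  then have "v = N *v (transpose P *v (P *v v))"
    by (simp add: matrix_vector_mul_assoc matrix_mul_assoc)
  then have "norm v \<le> norm N * norm (transpose P *v (P *v v))"
    by (metis norm_matrix_vector_mult_le)
  also have "\<dots> \<le> B * (B * norm (P *v v))"
    using norm_matrix_vector_mult_le[of "transpose P" "P *v v"] B assms(2)
    by (intro mult_mono order_trans[OF norm_matrix_vector_mult_le] mult_right_mono) auto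
  also have "\<dots> \<le> B * (B * sqrt ?e)" using P assms(2) by (intro mult_left_mono) auto
  finally show "norm v \<le> B^2 * sqrt ?e" by (simp add: power2_eq_square)
  have "\<kappa> * \<phi>\<^sup>2 / q \<le> ?e" by (simp add: energy_density_def)
  moreover have "(\<kappa> / B * \<bar>\<phi>\<bar>)\<^sup>2 \<le> \<kappa> * \<phi>\<^sup>2 / q"
  proof -
    have "\<kappa>\<^sup>2 * \<phi>\<^sup>2 / B\<^sup>2 \<le> \<kappa> * \<phi>\<^sup>2 / q"
    proof (rule frac_le)
      show "\<kappa>\<^sup>2 * \<phi>\<^sup>2 \<le> \<kappa> * \<phi>\<^sup>2"
        using assms by (intro mult_right_mono) (auto simp: power2_eq_square mult_left_le)
      show "q \<le> B\<^sup>2" using assms by (intro order_trans[OF \<open>q \<le> B\<close>]) (auto simp: power2_eq_square)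
    qed (use assms in auto)
    then show ?thesis by (simp add: power_mult_distrib power_divide)
  qed
  ultimately have "\<kappa> / B * \<bar>\<phi>\<bar> \<le> sqrt ?e" by (intro real_le_rsqrt) auto
  then show "\<bar>\<phi>\<bar> \<le> (B / \<kappa>) * sqrt ?e" using assms by (simp add: field_simps)
qed

text \<open>This yields the propagation speed B^4/\<kappa>: bounding \<phi> by the root of the
  energy costs B/\<kappa>, bounding \<open>v\<close> costs B^2, and \<open>A\<close> costs
  B.\<close>

lemma flux_bound:
  assumes "0 < \<kappa>" "1 \<le> B" "0 < q" "q \<le> B" "\<kappa> \<le> 1"
    and "transpose P ** P ** N = mat 1" "norm P \<le> B" "norm N \<le> B" and A: "norm A \<le> B"
  shows "\<bar>\<phi> * ((A *v v) \<bullet> u)\<bar> \<le> B^4 / \<kappa> * norm u * energy_density \<kappa> P v \<phi> q \<theta>"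
proof -
  let ?s = "sqrt (energy_density \<kappa> P v \<phi> q \<theta>)"
  note c = energy_density_coercive[OF assms(1-8), where v=v and \<phi>=\<phi> and \<theta>=\<theta>]
  have "\<bar>(A *v v) \<bullet> u\<bar> \<le> norm (A *v v) * norm u" by (rule Cauchy_Schwarz_ineq2)
  also have "\<dots> \<le> (B * (B^2 * ?s)) * norm u"
    using c assms energy_density_nonneg[OF assms(3,1)]
    by (intro mult_right_mono order_trans[OF norm_matrix_vector_mult_le] mult_mono) auto
  finally have "\<bar>\<phi> * ((A *v v) \<bullet> u)\<bar> \<le> ((B / \<kappa>) * ?s) * ((B * (B^2 * ?s)) * norm u)"
    unfolding abs_mult using c assms energy_density_nonneg[OF assms(3,1)] by (intro mult_mono) auto
  also have "\<dots> = B^4 / \<kappa> * norm u * (?s * ?s)"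
    by (simp add: field_simps power2_eq_square power4_eq_xxxx)
  finally show ?thesis using energy_density_nonneg[OF assms(3,1)] by simp
qed

text \<open>With d = div_eta V the Jacobian satisfies J_\<tau> = J d, so the left side is the time
  derivative of J times the energy density, divided by J. The two coupling terms combine to -2 (g .
  A v + \<phi> d), which up to J is a divergence by the Piola identity; all other terms are free of
  spatial derivatives of \<phi> and at most quadratic in (v, \<phi>, \<theta>), with coefficients
  bounded by \<open>B\<close>.\<close>

lemma energy_rate_bound:
  fixes \<alpha> :: real
  defines "\<kappa> \<equiv> \<alpha> / (1 + \<alpha>)"
  assumes "0 < \<alpha>" "1 \<le> B" "0 < q" "q \<le> B" "1 / q \<le> B"
    and PN: "transpose P ** P ** N = mat 1" "norm P \<le> B" "norm N \<le> B"
    and B: "norm A \<le> B" "norm P' \<le> B" "norm L \<le> B" "norm y \<le> B" "norm \<theta> \<le> B" "\<bar>d\<bar> \<le> B"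
    and z: "z + L *v v + N *v (transpose A *v (g + (1 - q) *\<^sub>R y)) = 0"
    and \<phi>: "\<phi> = (1 + \<alpha>) * (q - 1) + y \<bullet> \<theta> + \<theta> \<bullet> \<theta> / 2"
  shows "d * energy_density \<kappa> P v \<phi> q \<theta>
      + (2 * ((P *v v) \<bullet> (P' *v v + P *v z))
        + \<kappa> * (2 * \<phi> * (- ((1 + \<alpha>) / \<alpha>) * q * d + (y + \<theta>) \<bullet> v) / q
             - \<phi>\<^sup>2 * (- (1 / \<alpha>) * q * d) / q\<^sup>2)
        + 2 * (\<theta> \<bullet> v))
    \<le> 2 * (B + B / \<alpha> + 8 * B^3 * (B\<^sup>2 / \<kappa>)\<^sup>2) * energy_density \<kappa> P v \<phi> q \<theta>
       - 2 * (g \<bullet> (A *v v) + \<phi> * d)"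
proof -
  let ?e = "energy_density \<kappa> P v \<phi> q \<theta>"
  define s where "s = sqrt ?e"
  \<comment> \<open>One constant above all three coercivity constants B^2, B/\<kappa> and 1.\<close>
  define C where "C = B\<^sup>2 / \<kappa>"
  have \<kappa>: "0 < \<kappa>" "\<kappa> \<le> 1" unfolding \<kappa>_def using \<open>0 < \<alpha>\<close> by (auto simp: field_simps)
  have s0: "0 \<le> s" and ss: "s * s = ?e"
    using energy_density_nonneg[OF \<open>0 < q\<close> \<kappa>(1)] by (auto simp: s_def)
  note c = energy_density_coercive[OF \<kappa>(1) assms(3,4,5) \<kappa>(2) PN, where v=v and \<phi>=\<phi> and \<theta>=\<theta>, folded s_def]
  have B1: "1 \<le> B\<^sup>2" "B \<le> B\<^sup>2" using \<open>1 \<le> B\<close> by (auto intro: self_le_power)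
  have "B\<^sup>2 * \<kappa> \<le> B\<^sup>2" using \<kappa> B1 by (intro mult_left_le) auto
  then have "B\<^sup>2 \<le> C" using \<kappa> by (simp add: C_def le_divide_eq)
  moreover have "B / \<kappa> \<le> C" unfolding C_def using \<kappa> B1 by (intro divide_right_mono) auto
  ultimately have C: "1 \<le> C" "B\<^sup>2 \<le> C" "B / \<kappa> \<le> C" using B1 by auto
  have v: "norm v \<le> C * s" using c(1) mult_right_mono[OF C(2) s0] by linarith
  have \<phi>C: "\<bar>\<phi>\<bar> \<le> C * s" using c(2) mult_right_mono[OF C(3) s0] by linarith
  have \<theta>: "norm \<theta> \<le> C * s" using c(3) mult_right_mono[OF C(1) s0] by linarith
  have prod: "\<bar>x \<bullet> y\<bar> \<le> a * b" if "norm x \<le> a" "norm y \<le> b" for x y :: "real^3" and a b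
    using Cauchy_Schwarz_ineq2[of x y] mult_mono[OF that] that order_trans[OF norm_ge_zero that(1)] by auto
  have mat: "norm (M *v x) \<le> B * a" if "norm M \<le> B" "norm x \<le> a" for M :: "real^3^3" and x a
    using norm_matrix_vector_mult_le[of M x] mult_mono[OF that] that \<open>1 \<le> B\<close> by auto
  have B0: "0 \<le> B" using \<open>1 \<le> B\<close> by simp
  have Cs: "0 \<le> C * s" using C s0 by auto

  \<comment> \<open>The symmetrization: \<open>P\<close> cancels \<open>N\<close>, so the pressure
    term pairs with \<open>v\<close> exactly as in the flux.\<close>
  have "(P *v v) \<bullet> (P *v (N *v (transpose A *v x))) = x \<bullet> (A *v v)" for x
  proof -
    have "(P *v v) \<bullet> (P *v (N *v (transpose A *v x))) = v \<bullet> (transpose P *v (P *v (N *v (transpose A *v x))))"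
      by (metis inner_commute transpose_adjoint)
    also have "\<dots> = v \<bullet> ((transpose P ** P ** N) *v (transpose A *v x))"
      by (simp add: matrix_vector_mul_assoc matrix_mul_assoc)
    also have "\<dots> = x \<bullet> (A *v v)" using PN(1) transpose_adjoint[of A x v] by (simp add: inner_commute)
    finally show ?thesis .
  qed
  moreover have "P *v z = - (P *v (L *v v)) - P *v (N *v (transpose A *v (g + (1 - q) *\<^sub>R y)))"
  proof -
    have "z = - (L *v v) - N *v (transpose A *v (g + (1 - q) *\<^sub>R y))"
      using z by (simp add: algebra_simps eq_neg_iff_add_eq_0)
    then show ?thesis by (metis matrix_vector_mult_diff_distrib vec.neg)
  qed
  ultimately have Pz: "(P *v v) \<bullet> (P *v z) = - ((P *v v) \<bullet> (P *v (L *v v))) - g \<bullet> (A *v v) - (1 - q) * (y \<bullet> (A *v v))"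
    by (simp only: inner_diff_right inner_minus_right inner_add_left inner_scaleR_left)
  define R1 where "R1 = (P *v v) \<bullet> (P' *v v)"
  define R2 where "R2 = (P *v v) \<bullet> (P *v (L *v v))"
  define R3 where "R3 = (1 - q) * (y \<bullet> (A *v v))"
  define R4 where "R4 = \<kappa> * \<phi> * ((y + \<theta>) \<bullet> v) / q"
  define R5 where "R5 = (\<kappa> * \<phi>\<^sup>2 / q) * d / \<alpha>"
  define R6 where "R6 = \<theta> \<bullet> v"
  \<comment> \<open>Here \<kappa> (1 + \<alpha>)/\<alpha> = 1 produces exactly -2 \<phi> d. The term
    \<open>R5\<close> stems from differentiating the weight 1/q.\<close>
  have "\<kappa> * (2 * \<phi> * (- ((1 + \<alpha>) / \<alpha>) * q * d + (y + \<theta>) \<bullet> v) / q - \<phi>\<^sup>2 * (- (1 / \<alpha>) * q * d) / q\<^sup>2)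
      = - 2 * \<phi> * d + 2 * R4 + R5"
  proof -
    have "\<kappa> * (2 * \<phi> * (- ((1 + \<alpha>) / \<alpha>) * q * d) / q) = - 2 * \<phi> * d"
    proof -
      have "\<kappa> * (2 * \<phi> * (- c * q * d) / q) = - (\<kappa> * c) * (2 * \<phi> * d)" for c
        using \<open>0 < q\<close> by simp
      from this[of "(1 + \<alpha>) / \<alpha>"] have "\<kappa> * (2 * \<phi> * (- ((1 + \<alpha>) / \<alpha>) * q * d) / q)
          = - (\<kappa> * ((1 + \<alpha>) / \<alpha>)) * (2 * \<phi> * d)" .
      also have "\<kappa> * ((1 + \<alpha>) / \<alpha>) = 1"
        unfolding \<kappa>_def using \<open>0 < \<alpha>\<close> by (simp add: add_eq_0_iff)
      finally show ?thesis by simp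
    qed
    moreover have "\<phi>\<^sup>2 * (- (1 / \<alpha>) * q * d) / q\<^sup>2 = - (\<phi>\<^sup>2 / q) * d / \<alpha>"
      using \<open>0 < \<alpha>\<close> \<open>0 < q\<close> by (simp add: field_simps power2_eq_square)
    ultimately show ?thesis unfolding R4_def R5_def
      by (simp add: algebra_simps add_divide_distrib diff_divide_distrib)
  qed
  then have eq: "2 * ((P *v v) \<bullet> (P' *v v + P *v z))
        + \<kappa> * (2 * \<phi> * (- ((1 + \<alpha>) / \<alpha>) * q * d + (y + \<theta>) \<bullet> v) / q
             - \<phi>\<^sup>2 * (- (1 / \<alpha>) * q * d) / q\<^sup>2) + 2 * (\<theta> \<bullet> v)
      = 2 * R1 - 2 * R2 - 2 * R3 + 2 * R4 + R5 + 2 * R6 - 2 * (g \<bullet> (A *v v) + \<phi> * d)"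
    by (simp add: Pz inner_add_right R1_def R2_def R3_def R6_def)

  have B3: "1 \<le> B^3" "B \<le> B^3" "B\<^sup>2 \<le> B^3"
    using \<open>1 \<le> B\<close> power_increasing[of 1 3 B] power_increasing[of 2 3 B] by auto
  define X where "X = B^3 * C\<^sup>2 * ?e"
  have X: "X = B^3 * ((C * s) * (C * s))"
    by (simp add: X_def ss[symmetric] power2_eq_square)
  have upto: "a * ((C * s) * (C * s)) \<le> X" if "a \<le> B^3" for a
    unfolding X using that by (intro mult_right_mono) auto
  have "\<bar>R1\<bar> \<le> (B * (C * s)) * (B * (C * s))"
    unfolding R1_def by (intro prod mat PN B v)
  also have "\<dots> = B\<^sup>2 * ((C * s) * (C * s))" by (simp add: power2_eq_square)
  finally have R1: "\<bar>R1\<bar> \<le> X" using upto[OF B3(3)] by simp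
  have "\<bar>R2\<bar> \<le> (B * (C * s)) * (B * (B * (C * s)))"
    unfolding R2_def by (intro prod mat PN B v)
  also have "\<dots> = B^3 * ((C * s) * (C * s))" by (simp add: power3_eq_cube)
  finally have R2: "\<bar>R2\<bar> \<le> X" using upto[of "B^3"] by simp
  \<comment> \<open>The definition of \<phi> is solved for 1 - q; the three summands \<phi>, y .
    \<theta> and |\<theta>|^2/2 account for the factor 3, and dividing by 1 + \<alpha> \<ge> 1 only
    helps.\<close>
  have q1: "\<bar>1 - q\<bar> \<le> 3 * B * (C * s)"
  proof -
    have "\<bar>y \<bullet> \<theta>\<bar> \<le> B * (C * s)" "\<bar>\<theta> \<bullet> \<theta>\<bar> \<le> B * (C * s)"
      by (intro prod B \<theta>)+
    moreover have "(1 + \<alpha>) * \<bar>1 - q\<bar> = \<bar>y \<bullet> \<theta> + \<theta> \<bullet> \<theta> / 2 - \<phi>\<bar>"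
      using \<open>0 < \<alpha>\<close> \<phi> abs_mult[of "1 + \<alpha>" "1 - q"] by (simp add: algebra_simps)
    moreover have "\<bar>1 - q\<bar> \<le> (1 + \<alpha>) * \<bar>1 - q\<bar>" using \<open>0 < \<alpha>\<close> by (simp add: mult_left_le_one_le mult_le_cancel_right1)
    moreover have "C * s \<le> B * (C * s)" using \<open>1 \<le> B\<close> Cs mult_right_mono[of 1 B "C * s"] by simp
    ultimately show ?thesis using \<phi>C by linarith
  qed
  have "\<bar>R3\<bar> \<le> (3 * B * (C * s)) * (B * (B * (C * s)))"
    unfolding R3_def abs_mult by (intro mult_mono q1 prod B mat v) (use B0 Cs in auto)
  also have "\<dots> = 3 * (B^3 * ((C * s) * (C * s)))" by (simp add: power3_eq_cube)
  finally have R3: "\<bar>R3\<bar> \<le> 3 * X" using upto[of "B^3"] by simp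
  have "\<bar>R4\<bar> = \<kappa> * (\<bar>\<phi>\<bar> * \<bar>(y + \<theta>) \<bullet> v\<bar>) * (1 / q)"
    unfolding R4_def using \<kappa> \<open>0 < q\<close> by (simp add: abs_mult)
  also have "\<dots> \<le> 1 * ((C * s) * ((2 * B) * (C * s))) * B"
    by (intro mult_mono \<kappa> \<phi>C prod v assms(6)) (use B0 Cs \<kappa> \<open>0 < q\<close> norm_triangle_ineq[of y \<theta>] B in auto)
  also have "\<dots> = 2 * (B\<^sup>2 * ((C * s) * (C * s)))" by (simp add: power2_eq_square)
  finally have R4: "\<bar>R4\<bar> \<le> 2 * X" using upto[OF B3(3)] by simp
  have "\<bar>R6\<bar> \<le> 1 * ((C * s) * (C * s))"
    unfolding R6_def using prod[OF \<theta> v] by simp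
  then have R6: "\<bar>R6\<bar> \<le> X" using upto[OF B3(1)] by simp
  have "\<bar>R5\<bar> = (\<kappa> * \<phi>\<^sup>2 / q) * (\<bar>d\<bar> / \<alpha>)"
    unfolding R5_def using \<kappa> \<open>0 < q\<close> \<open>0 < \<alpha>\<close> by (simp add: abs_mult)
  also have "\<dots> \<le> ?e * (B / \<alpha>)"
    using B \<open>0 < \<alpha>\<close> \<open>0 < q\<close> \<kappa> B0 energy_density_nonneg[OF \<open>0 < q\<close> \<kappa>(1)]
    by (intro mult_mono divide_right_mono) (auto simp: energy_density_def)
  finally have R5: "\<bar>R5\<bar> \<le> B / \<alpha> * ?e" by (simp add: mult.commute)
  have e0: "0 \<le> ?e" using ss s0 by (metis mult_nonneg_nonneg)
  have de: "d * ?e \<le> B * ?e" using B(6) e0 by (intro mult_right_mono) auto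
  have BE: "0 \<le> B * ?e" "0 \<le> B / \<alpha> * ?e" using B0 e0 \<open>0 < \<alpha>\<close> by auto
  \<comment> \<open>\<open>R1\<close>, \<open>R2\<close> and \<open>R6\<close> cost X each,
    \<open>R3\<close> costs 3 X and \<open>R4\<close> costs 2 X, which makes 8 before the common
    factor 2.\<close>
  have "d * ?e + (2 * R1 - 2 * R2 - 2 * R3 + 2 * R4 + R5 + 2 * R6) \<le> 2 * (B * ?e + B / \<alpha> * ?e + 8 * X)"
  proof -
    have "D1 + (2 * R1 - 2 * R2 - 2 * R3 + 2 * R4 + R5 + 2 * R6) \<le> 2 * (E1 + E2 + 8 * X)"
      if "D1 \<le> E1" "0 \<le> E1" "0 \<le> E2" "\<bar>R5\<bar> \<le> E2" for D1 E1 E2 :: real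
      using R1 R2 R3 R4 R6 that by (smt (verit))
    then show ?thesis using R5 de BE by blast
  qed
  also have "\<dots> = 2 * (B + B / \<alpha> + 8 * B^3 * C\<^sup>2) * ?e"
    by (simp add: X_def algebra_simps)
  finally show ?thesis unfolding eq C_def by simp
qed

section \<open>The symmetrized system\<close>

text \<open>Bounds on composite expressions are assembled from bounds on their ingredients, since
  without joint continuity in time and space compactness gives nothing.\<close>

lemma bounded_bilinear_comp:
  assumes "bounded_bilinear p" "bounded (f ` S)" "bounded (g ` S)"
  shows "bounded ((\<lambda>x. p (f x) (g x)) ` S)"
proof -
  obtain a where a: "\<And>x. x \<in> S \<Longrightarrow> norm (f x) \<le> a" using assms(2) by (auto simp: bounded_iff)
  obtain b where b: "\<And>x. x \<in> S \<Longrightarrow> norm (g x) \<le> b" using assms(3) by (auto simp: bounded_iff)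
  obtain K where K: "K > 0" "\<And>x y. norm (p x y) \<le> norm x * norm y * K"
    using bounded_bilinear.pos_bounded[OF assms(1)] by blast
  have "norm (p (f x) (g x)) \<le> a * b * K" if "x \<in> S" for x
    using a[OF that] b[OF that] K order_trans[OF norm_ge_zero a[OF that]]
    by (intro order_trans[OF K(2)] mult_right_mono mult_mono) auto
  then show ?thesis by (auto simp: bounded_iff)
qed

lemma bounded_const_image: "bounded ((\<lambda>x. c) ` S)"
  by (rule bounded_subset[of "{c}"]) auto

lemmas bounded_comp_intros =
  bounded_bilinear_comp[OF bounded_bilinear_mult]
  bounded_bilinear_comp[OF bounded_bilinear_inner]
  bounded_bilinear_comp[OF bounded_bilinear_scaleR]
  bounded_bilinear_comp[OF bounded_bilinear_matrix_vector_mult]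
  bounded_bilinear_comp[OF bounded_bilinear_matrix_matrix_mult]
  bounded_plus_comp bounded_minus_comp bounded_const_image

lemma bounded_trace_comp:
  fixes f :: "'a \<Rightarrow> real^3^3"
  assumes "bounded (f ` S)"
  shows "bounded ((\<lambda>x. trace (f x)) ` S)"
proof -
  obtain a where a: "\<And>x. x \<in> S \<Longrightarrow> norm (f x) \<le> a" using assms by (auto simp: bounded_iff)
  have *: "\<bar>f x $ k $ k\<bar> \<le> a" if "x \<in> S" for x k
    using Finite_Cartesian_Product.norm_nth_le[of "f x $ k" k] Finite_Cartesian_Product.norm_nth_le[of "f x" k] a[OF that]
    by simp
  then have "\<bar>trace (f x)\<bar> \<le> 3 * a" if "x \<in> S" for x
    using *[OF that, of 1] *[OF that, of 2] *[OF that, of 3] unfolding trace_def sum_3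
    by linarith
  then show ?thesis by (auto simp: bounded_iff)
qed

lemma matrix_mult_scaleR:
  fixes X :: "real^'n^'m" and Y :: "real^'k^'n"
  shows "(c *\<^sub>R X) ** Y = c *\<^sub>R (X ** Y)" "X ** (c *\<^sub>R Y) = c *\<^sub>R (X ** Y)"
  using bounded_bilinear.scaleR_left[OF bounded_bilinear_matrix_matrix_mult]
    bounded_bilinear.scaleR_right[OF bounded_bilinear_matrix_matrix_mult] by blast+

lemma trace_scaleR: "trace (c *\<^sub>R X) = c * trace X" for X :: "real^'n^'n"
  by (simp add: trace_def sum_distrib_left)

text \<open>Squaring the positive part removes its kink at 0; this makes the cutoff continuously
  differentiable across the boundary of the cone.\<close>

lemma has_real_derivative_max_square:
  "((\<lambda>x::real. (max 0 x)\<^sup>2) has_real_derivative 2 * max 0 x) (at x within S)"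
proof -
  have "((\<lambda>x::real. (max 0 x)\<^sup>2) has_real_derivative 2 * max 0 x) (at x)"
  proof (cases x "0::real" rule: linorder_cases)
    case less
    have "((\<lambda>x::real. 0) has_real_derivative 0) (at x)" by simp
    then have "((\<lambda>x::real. (max 0 x)\<^sup>2) has_real_derivative 0) (at x)"
      by (rule has_field_derivative_transform_within_open[of _ _ _ "{..<0}"]) (use less in auto)
    then show ?thesis using less by simp
  next
    case equal
    have "((\<lambda>h. (max 0 h)\<^sup>2 / h) \<longlongrightarrow> 0) (at (0::real))"
    proof (rule tendsto_rabs_zero_cancel, rule tendsto_sandwich[of "\<lambda>_. 0" _ _ "\<lambda>h. \<bar>h\<bar>"])
      show "\<forall>\<^sub>F h in at (0::real). \<bar>(max 0 h)\<^sup>2 / h\<bar> \<le> \<bar>h\<bar>"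
        by (auto simp: max_def power2_eq_square intro!: always_eventually)
      show "((\<lambda>h. \<bar>h\<bar>) \<longlongrightarrow> 0) (at (0::real))" by (intro tendsto_eq_intros) auto
    qed auto
    then show ?thesis using equal by (simp add: has_field_derivative_iff)
  next
    case greater
    have "((\<lambda>x::real. x\<^sup>2) has_real_derivative 2 * x) (at x)" by (auto intro!: derivative_eq_intros)
    then have "((\<lambda>x::real. (max 0 x)\<^sup>2) has_real_derivative 2 * x) (at x)"
      by (rule has_field_derivative_transform_within_open[of _ _ _ "{0<..}"]) (use greater in auto)
    then show ?thesis using greater by simp
  qed
  then show ?thesis by (rule has_field_derivative_at_within)
qed

lemma linear_eq_inner_gradient:
  fixes f :: "real^'n \<Rightarrow> real"
  assumes "linear f"
  shows "f h = (\<chi> k. f (axis k 1)) \<bullet> h"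
proof -
  have "f h = f (\<Sum>k\<in>UNIV. h $ k *\<^sub>R axis k 1)"
    using basis_expansion[of h] unfolding scalar_mult_eq_scaleR by simp
  also have "\<dots> = (\<Sum>k\<in>UNIV. h $ k * f (axis k 1))"
    using assms by (simp add: linear_sum linear_cmul)
  finally show ?thesis by (simp add: inner_vec_def mult.commute)
qed

text \<open>The affine motion enters only through time-dependent matrices with P^T P N = I and their
  bounds. \<open>Z\<close> stands for the acceleration and \<open>D2\<theta>\<close> for the second
  derivative of \<theta>. A single constant \<open>B\<close> bounds all coefficients, and
  \<open>q_B\<close> makes it bound q and 1/q as well. Spatial continuity is assumed at fixed times
  only, and \<open>momentum\<close> only where |y| > 1, off the support of \<beta>.\<close>

locale lagrangian_flow =
  fixes \<alpha> T B :: real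
    and \<theta> V Z :: "real \<Rightarrow> real^3 \<Rightarrow> real^3"
    and D\<theta> DV :: "real \<Rightarrow> real^3 \<Rightarrow> real^3^3"
    and D2\<theta> :: "real \<Rightarrow> real^3 \<Rightarrow> real^3 \<Rightarrow> real^3^3"
    and P P' L N :: "real \<Rightarrow> real^3^3"
  fixes M A :: "real \<Rightarrow> real^3 \<Rightarrow> real^3^3" and J q \<phi> :: "real \<Rightarrow> real^3 \<Rightarrow> real"
    and gq g\<phi> :: "real \<Rightarrow> real^3 \<Rightarrow> real^3"
  defines "M \<equiv> \<lambda>\<tau> y. mat 1 + D\<theta> \<tau> y"
    and "A \<equiv> \<lambda>\<tau> y. matrix_inv (M \<tau> y)"
    and "J \<equiv> \<lambda>\<tau> y. det (M \<tau> y)"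
    and "q \<equiv> \<lambda>\<tau> y. J \<tau> y powr (- 1 / \<alpha>)"
    and "\<phi> \<equiv> \<lambda>\<tau> y. (1 + \<alpha>) * (q \<tau> y - 1) + y \<bullet> \<theta> \<tau> y + \<theta> \<tau> y \<bullet> \<theta> \<tau> y / 2"
    and "gq \<equiv> \<lambda>\<tau> y. \<chi> k. - 1 / \<alpha> * J \<tau> y powr (- 1 / \<alpha> - 1) * trace (adjugate (M \<tau> y) ** D2\<theta> \<tau> y (axis k 1))"
    and "g\<phi> \<equiv> \<lambda>\<tau> y. (1 + \<alpha>) *\<^sub>R gq \<tau> y + \<theta> \<tau> y + transpose (D\<theta> \<tau> y) *v (y + \<theta> \<tau> y)"
  assumes T_pos: "0 < T" and \<alpha>_pos: "0 < \<alpha>" and B_ge_1: "1 \<le> B" and q_B: "(2/3) powr (- 1 / \<alpha>) \<le> B"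
    and \<theta>_space: "\<And>\<tau> y. \<tau> \<in> {0..T} \<Longrightarrow> (\<theta> \<tau> has_derivative (\<lambda>h. D\<theta> \<tau> y *v h)) (at y)"
    and D\<theta>_space: "\<And>\<tau> y. \<tau> \<in> {0..T} \<Longrightarrow> (D\<theta> \<tau> has_derivative D2\<theta> \<tau> y) (at y)"
    and D2\<theta>_sym: "\<And>\<tau> y u v. \<tau> \<in> {0..T} \<Longrightarrow> D2\<theta> \<tau> y u *v v = D2\<theta> \<tau> y v *v u"
    and D2\<theta>_cont: "\<And>\<tau> u. \<tau> \<in> {0..T} \<Longrightarrow> continuous_on UNIV (\<lambda>y. D2\<theta> \<tau> y u)"
    and V_space: "\<And>\<tau> y. \<tau> \<in> {0..T} \<Longrightarrow> (V \<tau> has_derivative (\<lambda>h. DV \<tau> y *v h)) (at y)"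
    and DV_cont: "\<And>\<tau>. \<tau> \<in> {0..T} \<Longrightarrow> continuous_on UNIV (DV \<tau>)"
    and Z_lip: "\<And>\<tau> y z. \<tau> \<in> {0..T} \<Longrightarrow> norm (Z \<tau> y - Z \<tau> z) \<le> B * norm (y - z)"
    and \<theta>_time: "\<And>\<tau> y. \<tau> \<in> {0..T} \<Longrightarrow> ((\<lambda>s. \<theta> s y) has_vector_derivative V \<tau> y) (at \<tau> within {0..T})"
    and V_time: "\<And>\<tau> y. \<tau> \<in> {0..T} \<Longrightarrow> ((\<lambda>s. V s y) has_vector_derivative Z \<tau> y) (at \<tau> within {0..T})"
    and D\<theta>_time: "\<And>\<tau> y. \<tau> \<in> {0..T} \<Longrightarrow> ((\<lambda>s. D\<theta> s y) has_vector_derivative DV \<tau> y) (at \<tau> within {0..T})"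
    and P_time: "\<And>\<tau>. \<tau> \<in> {0..T} \<Longrightarrow> (P has_vector_derivative P' \<tau>) (at \<tau> within {0..T})"
    and D\<theta>_small: "\<And>\<tau> y. \<tau> \<in> {0..T} \<Longrightarrow> norm (D\<theta> \<tau> y) \<le> 1 / 3"
    and DV_B: "\<And>\<tau> y. \<tau> \<in> {0..T} \<Longrightarrow> norm (DV \<tau> y) \<le> B"
    and A_B: "\<And>\<tau> y. \<tau> \<in> {0..T} \<Longrightarrow> norm (A \<tau> y) \<le> B"
    and J_bounds: "\<And>\<tau> y. \<tau> \<in> {0..T} \<Longrightarrow> 2 / 3 \<le> J \<tau> y" "\<And>\<tau> y. \<tau> \<in> {0..T} \<Longrightarrow> J \<tau> y \<le> 4 / 3"
    and coeff_B: "\<And>\<tau>. \<tau> \<in> {0..T} \<Longrightarrow> norm (P \<tau>) \<le> B" "\<And>\<tau>. \<tau> \<in> {0..T} \<Longrightarrow> norm (P' \<tau>) \<le> B"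
      "\<And>\<tau>. \<tau> \<in> {0..T} \<Longrightarrow> norm (L \<tau>) \<le> B" "\<And>\<tau>. \<tau> \<in> {0..T} \<Longrightarrow> norm (N \<tau>) \<le> B"
    and PN: "\<And>\<tau>. \<tau> \<in> {0..T} \<Longrightarrow> transpose (P \<tau>) ** P \<tau> ** N \<tau> = mat 1"
    and momentum: "\<And>\<tau> y. \<tau> \<in> {0..T} \<Longrightarrow> 1 < norm y \<Longrightarrow>
      Z \<tau> y + L \<tau> *v V \<tau> y + N \<tau> *v (transpose (A \<tau> y) *v (g\<phi> \<tau> y + (1 - q \<tau> y) *\<^sub>R y)) = 0"
    and init: "\<And>y. 1 < norm y \<Longrightarrow> \<theta> 0 y = 0" "\<And>y. 1 < norm y \<Longrightarrow> V 0 y = 0"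
begin

section \<open>Space and time derivatives of the Jacobian, of q and of \<phi>\<close>

lemma J_pos: "\<tau> \<in> {0..T} \<Longrightarrow> 0 < J \<tau> y"
  using J_bounds(1)[of \<tau> y] by simp

lemma adjugate_eq: "\<tau> \<in> {0..T} \<Longrightarrow> adjugate (M \<tau> y) = J \<tau> y *\<^sub>R A \<tau> y"
  using J_pos[of \<tau> y] by (simp add: A_def matrix_inv_adjugate J_def)

lemma M_mult_A: "\<tau> \<in> {0..T} \<Longrightarrow> A \<tau> y ** M \<tau> y = mat 1"
  using J_pos[of \<tau> y] adjugate_mult_matrix[of "M \<tau> y"]
    bounded_bilinear.scaleR_left[OF bounded_bilinear_matrix_matrix_mult, of "inverse (J \<tau> y)" "adjugate (M \<tau> y)" "M \<tau> y"]
  by (simp add: A_def matrix_inv_adjugate J_def)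

lemma q_bounds:
  assumes "\<tau> \<in> {0..T}"
  shows "0 < q \<tau> y" "q \<tau> y \<le> B" "1 / q \<tau> y \<le> B"
proof -
  show "0 < q \<tau> y" using J_pos[OF assms, of y] by (simp add: q_def)
  have "q \<tau> y \<le> (2/3) powr (- 1 / \<alpha>)"
    unfolding q_def using J_bounds(1)[OF assms, of y] \<alpha>_pos by (intro powr_mono2') auto
  then show "q \<tau> y \<le> B" using q_B by simp
  have "1 / q \<tau> y = J \<tau> y powr (1 / \<alpha>)" by (simp add: q_def powr_minus_divide)
  \<comment> \<open>The bound 4/3 is relaxed to 3/2, the reciprocal of 2/3, so that one constant
    serves q and 1/q.\<close>
  also have "\<dots> \<le> (3/2) powr (1 / \<alpha>)"
    using J_bounds(2)[OF assms, of y] J_pos[OF assms, of y] \<alpha>_pos by (intro powr_mono2) auto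
  also have "\<dots> = (2/3) powr (- 1 / \<alpha>)" by (simp add: powr_minus_divide powr_divide)
  finally show "1 / q \<tau> y \<le> B" using q_B by simp
qed

lemma M_space: "\<tau> \<in> {0..T} \<Longrightarrow> (M \<tau> has_derivative D2\<theta> \<tau> y) (at y)"
  unfolding M_def using has_derivative_add[OF has_derivative_const D\<theta>_space, of \<tau> "mat 1"] by simp

lemma J_space: "\<tau> \<in> {0..T} \<Longrightarrow> (J \<tau> has_derivative (\<lambda>h. trace (adjugate (M \<tau> y) ** D2\<theta> \<tau> y h))) (at y)"
  unfolding J_def by (rule has_derivative_det[OF M_space])

lemma q_space:
  assumes "\<tau> \<in> {0..T}"
  shows "(q \<tau> has_derivative (\<lambda>h. gq \<tau> y \<bullet> h)) (at y)"
proof -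
  have "((\<lambda>x. x powr (- 1 / \<alpha>)) has_real_derivative - 1 / \<alpha> * J \<tau> y powr (- 1 / \<alpha> - 1)) (at (J \<tau> y))"
    using J_pos[OF assms, of y] by (intro has_real_derivative_powr) auto
  then have *: "(q \<tau> has_derivative (\<lambda>h. - 1 / \<alpha> * J \<tau> y powr (- 1 / \<alpha> - 1) * trace (adjugate (M \<tau> y) ** D2\<theta> \<tau> y h))) (at y)"
    unfolding q_def has_field_derivative_def by (rule has_derivative_compose[OF J_space[OF assms]])
  have "(\<lambda>h. - 1 / \<alpha> * J \<tau> y powr (- 1 / \<alpha> - 1) * trace (adjugate (M \<tau> y) ** D2\<theta> \<tau> y h)) = (\<lambda>h. gq \<tau> y \<bullet> h)"
    unfolding gq_def by (rule ext, rule linear_eq_inner_gradient[OF has_derivative_linear[OF *]])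
  with * show ?thesis by (rule has_derivative_eq_rhs)
qed

lemma \<phi>_space:
  assumes "\<tau> \<in> {0..T}"
  shows "(\<phi> \<tau> has_derivative (\<lambda>h. g\<phi> \<tau> y \<bullet> h)) (at y)"
proof -
  have "(\<phi> \<tau> has_derivative (\<lambda>h. (1 + \<alpha>) * (gq \<tau> y \<bullet> h - 0) + (y \<bullet> (D\<theta> \<tau> y *v h) + h \<bullet> \<theta> \<tau> y)
      + (\<theta> \<tau> y \<bullet> (D\<theta> \<tau> y *v h) + (D\<theta> \<tau> y *v h) \<bullet> \<theta> \<tau> y) / 2)) (at y)"
    unfolding \<phi>_def
    by (intro has_derivative_add has_derivative_mult_right has_derivative_diff has_derivative_const
      has_derivative_inner has_derivative_ident bounded_linear.has_derivative[OF bounded_linear_divide]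
      q_space[OF assms] \<theta>_space[OF assms])
  moreover have "(1 + \<alpha>) * (gq \<tau> y \<bullet> h - 0) + (y \<bullet> (D\<theta> \<tau> y *v h) + h \<bullet> \<theta> \<tau> y)
      + (\<theta> \<tau> y \<bullet> (D\<theta> \<tau> y *v h) + (D\<theta> \<tau> y *v h) \<bullet> \<theta> \<tau> y) / 2 = g\<phi> \<tau> y \<bullet> h" for h
    using transpose_adjoint[of "D\<theta> \<tau> y" "y + \<theta> \<tau> y" h]
      inner_commute[of h "\<theta> \<tau> y"] inner_commute[of "D\<theta> \<tau> y *v h" "\<theta> \<tau> y"]
    by (simp add: g\<phi>_def inner_add_left del: transpose_matrix_vector)
  ultimately show ?thesis by simp
qed

text \<open>Jacobi's formula with the adjugate written as J A; the trace is the Lagrangian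
  divergence of the velocity.\<close>

lemma J_time:
  assumes "\<tau> \<in> {0..T}"
  shows "((\<lambda>s. J s y) has_real_derivative J \<tau> y * trace (A \<tau> y ** DV \<tau> y)) (at \<tau> within {0..T})"
proof -
  have "((\<lambda>s. M s y) has_derivative (\<lambda>h. h *\<^sub>R DV \<tau> y)) (at \<tau> within {0..T})"
    unfolding M_def
    by (rule has_derivative_eq_rhs[OF has_derivative_add[OF has_derivative_const
          D\<theta>_time[OF assms, unfolded has_vector_derivative_def]]]) simp
  from has_derivative_det[OF this]
  have "((\<lambda>s. J s y) has_derivative (\<lambda>h. trace (adjugate (M \<tau> y) ** (h *\<^sub>R DV \<tau> y)))) (at \<tau> within {0..T})"
    unfolding J_def .
  moreover have "trace (adjugate (M \<tau> y) ** (h *\<^sub>R DV \<tau> y)) = J \<tau> y * trace (A \<tau> y ** DV \<tau> y) * h" for h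
    unfolding adjugate_eq[OF assms] matrix_mult_scaleR trace_scaleR by simp
  ultimately show ?thesis unfolding has_field_derivative_def by simp
qed

lemma q_time:
  assumes "\<tau> \<in> {0..T}"
  shows "((\<lambda>s. q s y) has_real_derivative - (1 / \<alpha>) * q \<tau> y * trace (A \<tau> y ** DV \<tau> y)) (at \<tau> within {0..T})"
proof -
  have "((\<lambda>x. x powr (- 1 / \<alpha>)) has_real_derivative - 1 / \<alpha> * J \<tau> y powr (- 1 / \<alpha> - 1)) (at (J \<tau> y))"
    using J_pos[OF assms, of y] by (intro has_real_derivative_powr) auto
  from DERIV_chain2[OF this J_time[OF assms]]
  have "((\<lambda>s. q s y) has_real_derivative - 1 / \<alpha> * J \<tau> y powr (- 1 / \<alpha> - 1) * (J \<tau> y * trace (A \<tau> y ** DV \<tau> y))) (at \<tau> within {0..T})"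
    unfolding q_def .
  moreover have "J \<tau> y powr (- 1 / \<alpha> - 1) * J \<tau> y = q \<tau> y"
    using J_pos[OF assms, of y] powr_add[of "J \<tau> y" "- 1 / \<alpha> - 1" 1] by (simp add: q_def)
  ultimately show ?thesis by (simp add: mult.assoc[symmetric])
qed

lemma \<phi>_time:
  assumes "\<tau> \<in> {0..T}"
  shows "((\<lambda>s. \<phi> s y) has_real_derivative
    (- ((1 + \<alpha>) / \<alpha>) * q \<tau> y * trace (A \<tau> y ** DV \<tau> y) + (y + \<theta> \<tau> y) \<bullet> V \<tau> y)) (at \<tau> within {0..T})"
proof -
  have "((\<lambda>s. \<phi> s y) has_derivative (\<lambda>h. (1 + \<alpha>) * (- (1 / \<alpha>) * q \<tau> y * trace (A \<tau> y ** DV \<tau> y) * h - 0)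
      + (y \<bullet> (h *\<^sub>R V \<tau> y) + 0 \<bullet> \<theta> \<tau> y)
      + (\<theta> \<tau> y \<bullet> (h *\<^sub>R V \<tau> y) + (h *\<^sub>R V \<tau> y) \<bullet> \<theta> \<tau> y) / 2)) (at \<tau> within {0..T})"
    unfolding \<phi>_def
    by (intro has_derivative_add has_derivative_mult_right has_derivative_diff has_derivative_const
      has_derivative_inner bounded_linear.has_derivative[OF bounded_linear_divide]
      q_time[OF assms, unfolded has_field_derivative_def]
      \<theta>_time[OF assms, unfolded has_vector_derivative_def])
  then show ?thesis
    unfolding has_field_derivative_def
    by (rule has_derivative_eq_rhs)
      (use \<alpha>_pos in \<open>simp add: fun_eq_iff inner_add_left inner_commute[of "V \<tau> y"] field_simps\<close>)
qed

end

section \<open>Bounds on space-time cylinders without joint continuity\<close>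

lemma lipschitz_if_jacobian_bounded:
  fixes f :: "real^3 \<Rightarrow> real^3"
  assumes "\<And>y. (f has_derivative (\<lambda>h. f' y *v h)) (at y)" "\<And>y. norm (f' y) \<le> c"
  shows "norm (f y - f z) \<le> c * norm (y - z)"
proof (rule differentiable_bound[OF convex_UNIV])
  show "(f has_derivative (\<lambda>h. f' y *v h)) (at y within UNIV)" for y using assms(1) by simp
  show "onorm (\<lambda>h. f' y *v h) \<le> c" for y
    by (rule onorm_le) (rule order_trans[OF norm_matrix_vector_mult_le mult_right_mono[OF assms(2) norm_ge_zero]])
qed auto

text \<open>A bound in time at the centre spreads over the ball by a spatial Lipschitz constant
  uniform in time. This takes the place of continuity on a compact cylinder.\<close>

lemma bounded_image_if_lipschitz:
  fixes F :: "'b \<Rightarrow> 'a::real_normed_vector \<Rightarrow> 'c::real_normed_vector"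
  assumes "bounded ((\<lambda>s. F s x) ` S)" "0 \<le> c"
    and "\<And>s y. s \<in> S \<Longrightarrow> norm (F s y - F s x) \<le> c * norm (y - x)"
  shows "bounded ((\<lambda>p. F (fst p) (snd p)) ` (S \<times> cball x r))"
proof -
  obtain b where b: "\<And>s. s \<in> S \<Longrightarrow> norm (F s x) \<le> b"
    using assms(1) by (auto simp: bounded_iff)
  have "norm (F s y) \<le> b + c * r" if "s \<in> S" "y \<in> cball x r" for s y
  proof -
    have "norm (F s y) \<le> norm (F s x) + norm (F s y - F s x)"
      using norm_triangle_ineq[of "F s x" "F s y - F s x"] by simp
    also have "\<dots> \<le> b + c * norm (y - x)" using b assms(3) that by (intro add_mono) auto
    also have "\<dots> \<le> b + c * r"
      using that(2) assms(2) by (intro add_left_mono mult_left_mono) (auto simp: dist_norm norm_minus_commute)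
    finally show ?thesis .
  qed
  then show ?thesis unfolding bounded_iff by (intro exI[of _ "b + c * r"]) auto
qed

lemma bounded_image_TimesD:
  assumes "bounded ((\<lambda>p. F (fst p) (snd p)) ` (S \<times> X))"
  obtains b where "\<And>s y. s \<in> S \<Longrightarrow> y \<in> X \<Longrightarrow> norm (F s y) \<le> b"
proof -
  obtain b where "\<forall>z\<in>(\<lambda>p. F (fst p) (snd p)) ` (S \<times> X). norm z \<le> b"
    using assms unfolding bounded_iff by blast
  then have "norm (F s y) \<le> b" if "s \<in> S" "y \<in> X" for s y using that by force
  then show ?thesis using that by blast
qed

lemma bounded_image_Icc:
  fixes f :: "real \<Rightarrow> 'a::real_normed_vector"
  assumes "\<And>s. s \<in> {0..T} \<Longrightarrow> (f has_vector_derivative f' s) (at s within {0..T})"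
  shows "bounded (f ` {0..T})"
  by (rule compact_imp_bounded[OF compact_continuous_image[OF continuous_on_vector_derivative[OF assms]]]) auto

context lagrangian_flow
begin

section \<open>Local bounds on the fields and the energy estimate in a cone\<close>

definition "\<kappa> = \<alpha> / (1 + \<alpha>)"

lemma \<kappa>: "0 < \<kappa>" "\<kappa> \<le> 1"
  unfolding \<kappa>_def using \<alpha>_pos by (auto simp: field_simps)

lemma M_bound:
  assumes "\<tau> \<in> {0..T}"
  shows "norm (M \<tau> y *v e) \<le> 2 * norm e"
proof -
  have "norm (D\<theta> \<tau> y *v e) \<le> 1 / 3 * norm e"
    by (rule order_trans[OF norm_matrix_vector_mult_le mult_right_mono[OF D\<theta>_small[OF assms] norm_ge_zero]])
  then have "norm (e + D\<theta> \<tau> y *v e) \<le> 2 * norm e"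
    using norm_triangle_ineq[of e "D\<theta> \<tau> y *v e"] norm_ge_zero[of e] by linarith
  then show ?thesis by (simp add: M_def matrix_vector_mult_add_rdistrib)
qed

text \<open>The momentum equation is solved for the gradient of \<phi>: P^T P inverts
  \<open>N\<close>, and replacing e by A (M e) removes the transposed inverse. The slope of \<phi>
  is thereby expressed through the acceleration.\<close>

lemma gradient_along:
  assumes "\<tau> \<in> {0..T}" "1 < norm y"
  shows "g\<phi> \<tau> y \<bullet> e = - (1 - q \<tau> y) * (y \<bullet> e)
    - (transpose (P \<tau>) *v (P \<tau> *v (Z \<tau> y + L \<tau> *v V \<tau> y))) \<bullet> (M \<tau> y *v e)"
proof -
  define X where "X = g\<phi> \<tau> y + (1 - q \<tau> y) *\<^sub>R y"
  define Q where "Q = transpose (P \<tau>) ** P \<tau>"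
  have "Q *v (Z \<tau> y + L \<tau> *v V \<tau> y + N \<tau> *v (transpose (A \<tau> y) *v X)) = 0"
    using momentum[OF assms] by (simp add: X_def)
  then have "Q *v (Z \<tau> y + L \<tau> *v V \<tau> y) + (Q ** N \<tau>) *v (transpose (A \<tau> y) *v X) = 0"
    by (simp add: matrix_vector_right_distrib matrix_vector_mul_assoc)
  then have AX: "transpose (A \<tau> y) *v X = - (Q *v (Z \<tau> y + L \<tau> *v V \<tau> y))"
    using PN[OF assms(1)] by (simp add: Q_def eq_neg_iff_add_eq_0 add.commute)
  have "X \<bullet> e = X \<bullet> (A \<tau> y *v (M \<tau> y *v e))"
    using M_mult_A[OF assms(1)] by (simp add: matrix_vector_mul_assoc)
  also have "\<dots> = (transpose (A \<tau> y) *v X) \<bullet> (M \<tau> y *v e)" by (rule transpose_adjoint[symmetric])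
  also have "\<dots> = - ((Q *v (Z \<tau> y + L \<tau> *v V \<tau> y)) \<bullet> (M \<tau> y *v e))" unfolding AX by simp
  finally show ?thesis
    by (simp add: X_def Q_def inner_add_left matrix_vector_mul_assoc[symmetric] algebra_simps del: transpose_matrix_vector)
qed

lemma fields_bounded:
  defines "S \<equiv> \<lambda>x r. {0..T} \<times> cball x r"
  shows "bounded ((\<lambda>p. \<theta> (fst p) (snd p)) ` S x r)" "bounded ((\<lambda>p. V (fst p) (snd p)) ` S x r)"
    "bounded ((\<lambda>p. q (fst p) (snd p)) ` S x r)" "bounded ((\<lambda>p. snd p) ` S x r)"
    "bounded ((\<lambda>p. \<phi> (fst p) (snd p)) ` S x r)"
proof -
  show \<theta>: "bounded ((\<lambda>p. \<theta> (fst p) (snd p)) ` S x r)" unfolding S_def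
    by (rule bounded_image_if_lipschitz[OF bounded_image_Icc[OF \<theta>_time] _
        lipschitz_if_jacobian_bounded[OF \<theta>_space D\<theta>_small]]) auto
  show "bounded ((\<lambda>p. V (fst p) (snd p)) ` S x r)" unfolding S_def
    by (rule bounded_image_if_lipschitz[OF bounded_image_Icc[OF V_time] _
        lipschitz_if_jacobian_bounded[OF V_space DV_B]]) (use B_ge_1 in auto)
  show q: "bounded ((\<lambda>p. q (fst p) (snd p)) ` S x r)"
    using q_bounds unfolding bounded_iff S_def by (intro exI[of _ B]) (auto simp: abs_of_pos)
  show y: "bounded ((\<lambda>p. snd p) ` S x r)" unfolding S_def
    by (rule bounded_subset[OF bounded_cball[of x r]]) auto
  have "bounded ((\<lambda>p. (1 + \<alpha>) * (q (fst p) (snd p) - 1) + snd p \<bullet> \<theta> (fst p) (snd p)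
     + (\<theta> (fst p) (snd p) \<bullet> \<theta> (fst p) (snd p)) * (1/2)) ` S x r)"
    by (intro bounded_comp_intros \<theta> q y)
  then show "bounded ((\<lambda>p. \<phi> (fst p) (snd p)) ` S x r)" by (simp add: \<phi>_def)
qed

text \<open>The acceleration \<open>Z\<close> could only be large if \<open>\<phi>\<close> had a large slope in a fixed direction on a
  whole ball, since \<open>Z\<close> is Lipschitz in space; but \<open>\<phi>\<close> is bounded.\<close>

lemma acceleration_bounded:
  assumes r: "0 < r" "1 + r < norm x"
  shows "bounded ((\<lambda>p. Z (fst p) (snd p)) ` ({0..T} \<times> cball x r))"
proof -
  obtain bV where bV: "\<And>s y. s \<in> {0..T} \<Longrightarrow> y \<in> cball x r \<Longrightarrow> norm (V s y) \<le> bV"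
    using bounded_image_TimesD[OF fields_bounded(2)] by blast
  obtain b\<phi> where b\<phi>: "\<And>s y. s \<in> {0..T} \<Longrightarrow> y \<in> cball x r \<Longrightarrow> \<bar>\<phi> s y\<bar> \<le> b\<phi>"
    using bounded_image_TimesD[OF fields_bounded(5)] unfolding real_norm_def by blast
  have yb: "norm y \<le> norm x + r" if "y \<in> cball x r" for y
    using that norm_triangle_ineq[of x "y - x"] by (simp add: dist_norm norm_minus_commute)
  \<comment> \<open>\<open>R\<close> bounds every term of the slope of \<phi> other than the main
    one, and \<open>U\<close> results from solving -2 b\<phi> \<le> r (R - 2/3 |u|) for |u|.\<close>
  define R where "R = (1 + B) * (norm x + r) + B * (B * (B * r)) * 2 + B * (B * (B * bV)) * 2"
  define U where "U = 3 / 2 * (R + 2 * b\<phi> / r)"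
  have mat: "norm (X *v u) \<le> B * a" if "norm X \<le> B" "norm u \<le> a" for X :: "real^3^3" and u a
    using norm_matrix_vector_mult_le[of X u] mult_mono[OF that] that B_ge_1 by auto
  have "norm (Z s x) \<le> B * max U 0" if s: "s \<in> {0..T}" for s
  proof -
    note c = coeff_B[OF s]
    have c': "norm (transpose (P s)) \<le> B" using c by simp
    define Q where "Q u = transpose (P s) *v (P s *v u)" for u
    have Qadd: "Q (u + v) = Q u + Q v" for u v
      unfolding Q_def by (simp only: matrix_vector_right_distrib)
    have Qb: "norm (Q u) \<le> B * (B * a)" if "norm u \<le> a" for u a
      unfolding Q_def by (intro mat c c' that)
    define u where "u = Q (Z s x)"
    have "N s ** (transpose (P s) ** P s) = mat 1"
      using PN[OF s] matrix_left_right_inverse by blast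
    then have Z: "Z s x = N s *v u"
      by (simp add: u_def Q_def matrix_vector_mul_assoc matrix_mul_assoc del: transpose_matrix_vector)
    have "norm u \<le> max U 0"
    proof (cases "u = 0")
      case False
      define e where "e = (1 / norm u) *\<^sub>R u"
      have e: "norm e = 1" "u = norm u *\<^sub>R e" using False by (auto simp: e_def)
      \<comment> \<open>The slope is taken in the direction of u = P^T P Z at the centre. The whole
        segment stays outside the unit ball, so the momentum equation holds at the intermediate
        point.\<close>
      obtain t where t: "0 < t" "t < r" "\<phi> s (x + r *\<^sub>R e) - \<phi> s x = r * (g\<phi> s (x + t *\<^sub>R e) \<bullet> e)"
        by (rule difference_mvt[OF \<phi>_space[OF s] r(1), of x e], rule that)
      define y where "y = x + t *\<^sub>R e"
      have y: "y \<in> cball x r" using t e by (simp add: y_def dist_norm)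
      have "norm x \<le> norm y + t" using norm_triangle_ineq[of y "- t *\<^sub>R e"] t e by (simp add: y_def)
      then have "1 < norm y" using t r by simp
      then have "g\<phi> s y \<bullet> e = - (1 - q s y) * (y \<bullet> e) - Q (Z s y + L s *v V s y) \<bullet> (M s y *v e)"
        unfolding Q_def by (rule gradient_along[OF s])
      then have "g\<phi> s y \<bullet> e = - ((1 - q s y) * (y \<bullet> e)) - Q (Z s y + L s *v V s y) \<bullet> (M s y *v e)"
        by (simp only: mult_minus_left)
      moreover have "Q (Z s y + L s *v V s y) = u + Q (Z s y - Z s x) + Q (L s *v V s y)"
        unfolding u_def Qadd[symmetric] by simp
      moreover have "\<bar>(1 - q s y) * (y \<bullet> e)\<bar> \<le> (1 + B) * (norm x + r)"
        unfolding abs_mult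
      proof (rule mult_mono)
        show "\<bar>1 - q s y\<bar> \<le> 1 + B" using q_bounds[OF s, of y] B_ge_1 by auto
        show "\<bar>y \<bullet> e\<bar> \<le> norm x + r" using Cauchy_Schwarz_ineq2[of y e] e yb[OF y] by simp
      qed (use B_ge_1 in auto)
      moreover
      have M2: "norm (M s y *v e) \<le> 2" using M_bound[OF s, of y e] e by simp
      have prod: "\<bar>a \<bullet> (M s y *v e)\<bar> \<le> k * 2" if "norm a \<le> k" for a k
        using Cauchy_Schwarz_ineq2[of a "M s y *v e"] mult_mono[OF that M2] order_trans[OF norm_ge_zero that]
        by auto
      have "norm (Z s y - Z s x) \<le> B * r"
        using y B_ge_1
        by (intro order_trans[OF Z_lip[OF s]] mult_left_mono) (auto simp: dist_norm norm_minus_commute)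
      then have "\<bar>Q (Z s y - Z s x) \<bullet> (M s y *v e)\<bar> \<le> B * (B * (B * r)) * 2"
        by (intro prod Qb)
      moreover have "\<bar>Q (L s *v V s y) \<bullet> (M s y *v e)\<bar> \<le> B * (B * (B * bV)) * 2"
        by (intro prod Qb mat c bV s y)
      \<comment> \<open>\<open>M\<close> differs from the identity by at most 1/3 in norm, so e . M
        e \<ge> 2/3 for a unit vector e.\<close>
      moreover have "2 / 3 * norm u \<le> u \<bullet> (M s y *v e)"
      proof -
        have "\<bar>e \<bullet> (D\<theta> s y *v e)\<bar> \<le> 1 / 3"
          using Cauchy_Schwarz_ineq2[of e "D\<theta> s y *v e"] norm_matrix_vector_mult_le[of "D\<theta> s y" e] e D\<theta>_small[OF s, of y]
          by simp
        moreover have "e \<bullet> e = 1" using e by (simp add: norm_eq_1)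
        ultimately have "2 / 3 \<le> e \<bullet> (M s y *v e)"
          by (simp add: M_def matrix_vector_mult_add_rdistrib inner_add_right)
        then have "norm u * (2 / 3) \<le> norm u * (e \<bullet> (M s y *v e))" by (intro mult_left_mono) auto
        also have "\<dots> = u \<bullet> (M s y *v e)" using e(2) by (metis inner_scaleR_left)
        finally show ?thesis by simp
      qed
      ultimately have "g\<phi> s y \<bullet> e \<le> R - 2 / 3 * norm u"
        unfolding R_def by (simp only: inner_add_left)
      then have "r * (g\<phi> s y \<bullet> e) \<le> r * (R - 2 / 3 * norm u)" using r by simp
      moreover have "x \<in> cball x r" "x + r *\<^sub>R e \<in> cball x r" using r e by (auto simp: dist_norm)
      then have "- 2 * b\<phi> \<le> \<phi> s (x + r *\<^sub>R e) - \<phi> s x"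
        using b\<phi>[OF s, of x] b\<phi>[OF s, of "x + r *\<^sub>R e"] by simp
      ultimately have "- 2 * b\<phi> \<le> r * (R - 2 / 3 * norm u)" using t(3) by (simp add: y_def)
      then have "norm u \<le> U" unfolding U_def using r by (simp add: field_simps)
      then show ?thesis by simp
    qed simp
    then show ?thesis unfolding Z by (intro mat c)
  qed
  then have "bounded ((\<lambda>s. Z s x) ` {0..T})"
    unfolding bounded_iff by (intro exI[of _ "B * max U 0"]) auto
  then show ?thesis
    by (rule bounded_image_if_lipschitz[of _ _ _ B]) (use B_ge_1 Z_lip in auto)
qed

text \<open>The weight \<open>W\<close> below lives on a backward cone of slope \<open>K\<close> over a ball around \<open>x\<close> that does not
  meet the unit ball.\<close>

lemma vanishes_outside_cone:
  assumes t: "0 < t" "t \<le> T" and K: "K = 2 * (B^4 / \<kappa>)" and x: "1 + K * t < norm x"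
  shows "\<theta> t x = 0 \<and> V t x = 0"
proof -
  have K0: "0 < K" using K B_ge_1 \<kappa> by simp
  \<comment> \<open>The strict inequalities on both sides matter: r > K t keeps the weight positive
    at the point (t, x), and 1 + r < |x| keeps the base of the cone off the unit ball.\<close>
  obtain r where r: "K * t < r" "1 + r < norm x"
    using dense[of "K * t" "norm x - 1"] x by auto
  have Kt: "0 < K * t" using K0 t by simp
  have r0: "0 < r" using Kt r by linarith
  have sT: "s \<in> {0..T}" if "s \<in> {0..t}" for s using that t by auto
  have out: "1 < norm y" if "y \<in> cball x r" for y
    using that r norm_triangle_ineq[of y "x - y"] by (simp add: dist_norm)
  have Kst: "0 < r - K * s" "r - K * s \<le> r" if "s \<in> {0..t}" for s
  proof -
    have "K * s \<le> K * t" "0 \<le> K * s" using that K0 by (auto intro: mult_left_mono)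
    then show "0 < r - K * s" "r - K * s \<le> r" using r by auto
  qed
  \<comment> \<open>At time s the weight is supported in the ball of radius r - K s around
    \<open>x\<close>. The square in \<open>W\<close> makes it continuously differentiable.\<close>
  define m where "m s y = max 0 ((r - K * s)\<^sup>2 - (y - x) \<bullet> (y - x))" for s y
  define W where "W s y = (m s y)\<^sup>2" for s y
  define Wt where "Wt s y = - (4 * K * m s y * (r - K * s))" for s y
  define gW where "gW s y = (- (4 * m s y)) *\<^sub>R (y - x)" for s y
  define e where "e s y = energy_density \<kappa> (P s) (V s y) (\<phi> s y) (q s y) (\<theta> s y)" for s y
  define d where "d s y = trace (A s y ** DV s y)" for s y
  define et where "et s y = 2 * ((P s *v V s y) \<bullet> (P' s *v V s y + P s *v Z s y))
        + \<kappa> * (2 * \<phi> s y * (- ((1 + \<alpha>) / \<alpha>) * q s y * d s y + (y + \<theta> s y) \<bullet> V s y) / q s y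
             - (\<phi> s y)\<^sup>2 * (- (1 / \<alpha>) * q s y * d s y) / (q s y)\<^sup>2)
        + 2 * (\<theta> s y \<bullet> V s y)" for s y
  \<comment> \<open>The factor 1/2 cancels the factor 2 in front of the coupling terms, so that the
    divergence of \<open>G\<close> below appears with coefficient 1.\<close>
  define F where "F s y = W s y / 2 * (J s y * e s y)" for s y
  define Ft where "Ft s y = Wt s y / 2 * (J s y * e s y)
     + W s y / 2 * (J s y * d s y * e s y + J s y * et s y)" for s y
  define G where "G s y = (W s y * \<phi> s y) *\<^sub>R (adjugate (M s y) *v V s y)" for s y
  define G' where "G' s y h = ((\<phi> s y *\<^sub>R gW s y + W s y *\<^sub>R g\<phi> s y) \<bullet> h) *\<^sub>R (adjugate (M s y) *v V s y) +
     (W s y * \<phi> s y) *\<^sub>R ((mixed_cofactor (M s y) (D2\<theta> s y h) + mixed_cofactor (D2\<theta> s y h) (M s y)) *v V s y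
       + adjugate (M s y) *v (DV s y *v h))" for s y h

  have m_zero: "m s y = 0" if "s \<in> {0..t}" "y \<notin> cball x r" for s y
  proof -
    have "r < norm (y - x)" using that by (simp add: dist_norm norm_minus_commute)
    then have "(r - K * s)\<^sup>2 \<le> (norm (y - x))\<^sup>2" using Kst[OF that(1)] by (intro power_mono) auto
    then show ?thesis by (simp add: m_def power2_norm_eq_inner)
  qed
  have W_time: "((\<lambda>s. W s y) has_real_derivative Wt s y) (at s within {0..t})" for s y
    unfolding W_def m_def Wt_def
    by (rule DERIV_cong[OF DERIV_chain2[OF has_real_derivative_max_square]])
      (auto intro!: derivative_eq_intros)
  have W_space: "(W s has_derivative (\<lambda>h. gW s y \<bullet> h)) (at y)" for s y
    unfolding W_def m_def gW_def
    by (rule has_derivative_eq_rhs[OF has_derivative_compose[OF _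
          has_real_derivative_max_square[unfolded has_field_derivative_def], where s=UNIV]])
      (auto intro!: derivative_eq_intros simp: fun_eq_iff inner_commute algebra_simps)
  have e_time: "((\<lambda>s. e s y) has_real_derivative et s y) (at s within {0..T})" if s: "s \<in> {0..T}" for s y
  proof -
    have Pv: "((\<lambda>s. P s *v V s y) has_vector_derivative (P s *v Z s y + P' s *v V s y)) (at s within {0..T})"
      using bounded_bilinear.has_vector_derivative[OF bounded_bilinear_matrix_vector_mult P_time[OF s] V_time[OF s]] .
    have q0: "q s y \<noteq> 0" using q_bounds[OF s, of y] by simp
    have inner: "((\<lambda>s. f s \<bullet> f s) has_real_derivative 2 * (f s \<bullet> f')) (at s within {0..T})"
      if "(f has_vector_derivative f') (at s within {0..T})" for f :: "real \<Rightarrow> real^3" and f' s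
      using bounded_bilinear.has_vector_derivative[OF bounded_bilinear_inner that that]
      by (simp add: has_real_derivative_iff_has_vector_derivative inner_commute)
    have frac: "((\<lambda>s. \<kappa> * (\<phi> s y)\<^sup>2 / q s y) has_real_derivative
       \<kappa> * (2 * \<phi> s y * b / q s y - (\<phi> s y)\<^sup>2 * c / (q s y)\<^sup>2)) (at s within {0..T})"
      if "((\<lambda>s. \<phi> s y) has_real_derivative b) (at s within {0..T})"
        "((\<lambda>s. q s y) has_real_derivative c) (at s within {0..T})" for b c
      by (rule derivative_eq_intros that refl q0)+
        (use q0 in \<open>simp add: field_simps power2_eq_square\<close>)
    show ?thesis
      unfolding e_def energy_density_def
      by (rule DERIV_cong[OF DERIV_add[OF DERIV_add[OF inner[OF Pv] frac[OF \<phi>_time[OF s] q_time[OF s]]] inner[OF \<theta>_time[OF s]]]])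
        (simp add: et_def d_def add.commute)
  qed
  have F_time: "((\<lambda>s. F s y) has_real_derivative Ft s y) (at s within {0..t})" if s: "s \<in> {0..t}" for s y
  proof -
    have sub: "{0..t} \<subseteq> {0..T}" using t by auto
    note J = DERIV_subset[OF J_time[OF sT[OF s]] sub, of y] and e = DERIV_subset[OF e_time[OF sT[OF s]] sub, of y]
    show ?thesis unfolding F_def
      by (rule DERIV_cong[OF DERIV_mult[OF DERIV_cdivide[OF W_time] DERIV_mult[OF J e]]])
        (simp add: Ft_def d_def algebra_simps)
  qed
  have G_space: "(G s has_derivative G' s y) (at y)"
    and G_div: "(\<Sum>b\<in>Basis. G' s y b \<bullet> b) =
      (\<phi> s y *\<^sub>R gW s y + W s y *\<^sub>R g\<phi> s y) \<bullet> (adjugate (M s y) *v V s y) + W s y * \<phi> s y * trace (adjugate (M s y) ** DV s y)"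
    if s: "s \<in> {0..t}" for s y
  proof -
    have f: "((\<lambda>y. W s y * \<phi> s y) has_derivative (\<lambda>h. (\<phi> s y *\<^sub>R gW s y + W s y *\<^sub>R g\<phi> s y) \<bullet> h)) (at y)"
      by (rule has_derivative_eq_rhs[OF has_derivative_mult[OF W_space \<phi>_space[OF sT[OF s]]]])
        (auto simp: inner_add_left algebra_simps)
    note 1 = f M_space[OF sT[OF s]] D2\<theta>_sym[OF sT[OF s]] V_space[OF sT[OF s]]
    show "(G s has_derivative G' s y) (at y)"
      unfolding G_def G'_def by (rule has_derivative_cofactor_flux[OF 1])
    show "(\<Sum>b\<in>Basis. G' s y b \<bullet> b) =
      (\<phi> s y *\<^sub>R gW s y + W s y *\<^sub>R g\<phi> s y) \<bullet> (adjugate (M s y) *v V s y) + W s y * \<phi> s y * trace (adjugate (M s y) ** DV s y)"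
      unfolding G'_def by (rule divergence_cofactor_flux[OF 1])
  qed
  have e_nonneg: "0 \<le> e s y" if "s \<in> {0..t}" for s y
    unfolding e_def by (rule energy_density_nonneg[OF q_bounds(1)[OF sT[OF that]] \<kappa>(1)])
  have cont: "continuous_on UNIV (F s)" "continuous_on UNIV (\<lambda>y. G' s y v \<bullet> u)" if s: "s \<in> {0..t}" for s u v
  proof -
    note sT' = sT[OF s]
    have c: "continuous_on UNIV f" if "\<And>y. (f has_derivative f' y) (at y)"
      for f :: "real^3 \<Rightarrow> 'z::real_normed_vector" and f'
      by (rule has_derivative_continuous_on[OF has_derivative_at_withinI[OF that]])
    have m_cont: "continuous_on UNIV (m s)" unfolding m_def by (intro continuous_intros)
    note basic = c[OF W_space] c[OF J_space[OF sT']] c[OF q_space[OF sT']] c[OF \<phi>_space[OF sT']]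
      c[OF \<theta>_space[OF sT']] c[OF V_space[OF sT']] c[OF D\<theta>_space[OF sT']] c[OF M_space[OF sT']]
      DV_cont[OF sT'] D2\<theta>_cont[OF sT'] m_cont
    note mult = bounded_bilinear.continuous_on[OF bounded_bilinear_matrix_vector_mult]
      bounded_bilinear.continuous_on[OF bounded_bilinear_matrix_matrix_mult]
      bounded_bilinear.continuous_on[OF bounded_bilinear_mixed_cofactor]
    have adj: "continuous_on UNIV (\<lambda>y. adjugate (M s y))"
      unfolding adjugate_def by (intro mult basic)
    show "continuous_on UNIV (F s)"
      unfolding F_def e_def energy_density_def
      by (intro continuous_intros mult basic continuous_on_const)
        (use q_bounds(1)[OF sT'] in \<open>auto simp: less_le\<close>)
    have tr: "continuous_on UNIV (\<lambda>y. trace (f y))" if "continuous_on UNIV f" for f :: "real^3 \<Rightarrow> real^3^3"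
      unfolding trace_def by (intro continuous_intros that)
    have "continuous_on UNIV (gq s)"
      unfolding gq_def
      by (intro continuous_intros tr mult adj basic continuous_on_const)
        (use J_pos[OF sT'] in \<open>auto simp: less_le\<close>)
    moreover have "continuous_on UNIV (\<lambda>y. transpose (D\<theta> s y))"
      unfolding transpose_def by (intro continuous_intros basic)
    ultimately have g: "continuous_on UNIV (g\<phi> s)"
      unfolding g\<phi>_def by (intro continuous_intros mult basic)
    show "continuous_on UNIV (\<lambda>y. G' s y v \<bullet> u)"
      unfolding G'_def gW_def
      by (intro continuous_intros mult adj basic g continuous_on_const)
  qed
  \<comment> \<open>On the support of the weight |y - x| \<le> r - K s, so the gradient of
    \<open>W\<close> is at most 4 m (r - K s), while its time derivative is -4 K m (r - K s). Half
    of the latter must absorb B^4/\<kappa> times the former; this is where K = 2 B^4/\<kappa> comes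
    from.\<close>
  have cone: "Wt s y / 2 * e s y + \<phi> s y * ((A s y *v V s y) \<bullet> gW s y) \<le> 0" if s: "s \<in> {0..t}" for s y
  proof -
    note sT' = sT[OF s]
    have m0: "0 \<le> m s y" by (simp add: m_def)
    have "m s y * norm (y - x) \<le> m s y * (r - K * s)"
    proof (cases "m s y = 0")
      case False
      then have "(norm (y - x))\<^sup>2 \<le> (r - K * s)\<^sup>2" by (auto simp: m_def max_def power2_norm_eq_inner split: if_splits)
      then have "norm (y - x) \<le> r - K * s" using Kst[OF s] by (auto intro: power2_le_imp_le)
      then show ?thesis using m0 by (intro mult_left_mono) auto
    qed simp
    then have "norm (gW s y) \<le> 4 * (m s y * (r - K * s))" using m0 by (simp add: gW_def abs_mult)
    then have "B^4 / \<kappa> * norm (gW s y) * e s y \<le> B^4 / \<kappa> * (4 * (m s y * (r - K * s))) * e s y"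
      using B_ge_1 \<kappa> e_nonneg[OF s] by (intro mult_right_mono mult_left_mono) auto
    also have "\<dots> = - (Wt s y / 2 * e s y)" by (simp add: Wt_def K)
    finally have "B^4 / \<kappa> * norm (gW s y) * e s y \<le> - (Wt s y / 2 * e s y)" .
    moreover have "\<bar>\<phi> s y * ((A s y *v V s y) \<bullet> gW s y)\<bar> \<le> B^4 / \<kappa> * norm (gW s y) * e s y"
      unfolding e_def
      by (rule flux_bound[OF \<kappa>(1) B_ge_1 q_bounds(1,2)[OF sT'] \<kappa>(2) PN[OF sT'] coeff_B(1,4)[OF sT'] A_B[OF sT']])
    ultimately show ?thesis by linarith
  qed
  let ?S = "{0..t} \<times> cball x r"
  have sub: "?S \<subseteq> {0..T} \<times> cball x r" using sT by auto
  note fb = fields_bounded[of x r, THEN bounded_subset, OF image_mono[OF sub]]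
  have Zb: "bounded ((\<lambda>p. Z (fst p) (snd p)) ` ?S)"
    by (rule bounded_subset[OF acceleration_bounded[OF r0 r(2)] image_mono[OF sub]])
  have B: "bounded ((\<lambda>p. f (fst p) (snd p)) ` ?S)"
    if "\<And>s y. s \<in> {0..t} \<Longrightarrow> norm (f s y) \<le> c" for f :: "real \<Rightarrow> real^3 \<Rightarrow> 'z::real_normed_vector" and c
    unfolding bounded_iff using that by (intro exI[of _ c]) auto
  have Jb: "bounded ((\<lambda>p. J (fst p) (snd p)) ` ?S)"
    by (rule B[of _ "4/3"]) (use J_bounds J_pos sT in \<open>auto simp: abs_of_pos\<close>)
  have qb: "bounded ((\<lambda>p. inverse (q (fst p) (snd p))) ` ?S)"
    by (rule B[of "\<lambda>s y. inverse (q s y)" B]) (use q_bounds sT in \<open>auto simp: abs_of_pos divide_inverse\<close>)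
  have mb: "bounded ((\<lambda>p. m (fst p) (snd p)) ` ?S)"
  proof (rule B[of _ "r\<^sup>2"])
    fix s y assume "s \<in> {0..t}"
    then have "(r - K * s)\<^sup>2 \<le> r\<^sup>2" using Kst by (intro power_mono) (auto simp: less_imp_le)
    then have "(r - K * s)\<^sup>2 - (y - x) \<bullet> (y - x) \<le> r\<^sup>2" using inner_ge_zero[of "y - x"] by linarith
    then show "norm (m s y) \<le> r\<^sup>2" by (auto simp: m_def)
  qed
  have rb: "bounded ((\<lambda>p. r - K * fst p) ` ?S)"
    by (rule B[of "\<lambda>s y. r - K * s" r]) (use Kst in \<open>auto simp: abs_of_pos\<close>)
  have Ab: "bounded ((\<lambda>p. A (fst p) (snd p)) ` ?S)" by (rule B[of _ B]) (use A_B sT in auto)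
  have DVb: "bounded ((\<lambda>p. DV (fst p) (snd p)) ` ?S)" by (rule B[of _ B]) (use DV_B sT in auto)
  have cb: "bounded ((\<lambda>p. P (fst p)) ` ?S)" "bounded ((\<lambda>p. P' (fst p)) ` ?S)"
    by (rule B[of "\<lambda>s y. P s" B]; use coeff_B sT in auto) (rule B[of "\<lambda>s y. P' s" B]; use coeff_B sT in auto)
  have db: "bounded ((\<lambda>p. d (fst p) (snd p)) ` ?S)"
    unfolding d_def by (intro bounded_trace_comp bounded_comp_intros Ab DVb)
  \<comment> \<open>\<open>Ft\<close> contains the acceleration and first derivatives but no second
    derivatives of \<theta>, for which no bound uniform in time is at hand.\<close>
  have Ftb: "bounded ((\<lambda>p. Ft (fst p) (snd p)) ` ?S)"
      unfolding Ft_def W_def Wt_def e_def et_def energy_density_def divide_inverse power2_eq_square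
        inverse_mult_distrib minus_mult_left
      by (intro bounded_comp_intros fb Zb Jb qb mb rb Ab DVb cb db)
  obtain b where b: "\<And>s y. s \<in> {0..t} \<Longrightarrow> y \<in> cball x r \<Longrightarrow> norm (Ft s y) \<le> b"
    using bounded_image_TimesD[OF Ftb] by blast
  obtain c1 where c1: "\<And>s y. s \<in> {0..t} \<Longrightarrow> y \<in> cball x r \<Longrightarrow> norm (\<theta> s y) \<le> c1"
    using bounded_image_TimesD[OF fb(1)] by blast
  obtain c2 where c2: "\<And>s y. s \<in> {0..t} \<Longrightarrow> y \<in> cball x r \<Longrightarrow> norm (d s y) \<le> c2"
    using bounded_image_TimesD[OF db] by blast
  \<comment> \<open>\<open>b'\<close> also bounds y, \<theta> and the divergence on the ball. It may
    grow with |x|, but it enters only the Gronwall constant \<open>C\<close>; the slope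
    \<open>K\<close> is made from \<open>B\<close> and \<kappa>.\<close>
  define b' where "b' = Max {B, c1, c2, norm x + r}"
  have b': "B \<le> b'" "c1 \<le> b'" "c2 \<le> b'" "norm x + r \<le> b'" by (simp_all add: b'_def)
  have yb: "norm y \<le> b'" if "y \<in> cball x r" for y
    using that norm_triangle_ineq[of x "y - x"] b'(4) by (simp add: dist_norm norm_minus_commute)
  define C where "C = 2 * (b' + b' / \<alpha> + 8 * b'^3 * (b'\<^sup>2 / \<kappa>)\<^sup>2)"
  have rate: "d s y * e s y + et s y \<le> C * e s y - 2 * (g\<phi> s y \<bullet> (A s y *v V s y) + \<phi> s y * d s y)"
    if s: "s \<in> {0..t}" and y: "y \<in> cball x r" for s y
  proof -
    note s' = sT[OF s]
    show ?thesis
      unfolding e_def et_def C_def \<kappa>_def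
    proof (rule energy_rate_bound[where L = "L s" and N = "N s" and P' = "P' s" and y = y])
      show "\<phi> s y = (1 + \<alpha>) * (q s y - 1) + y \<bullet> \<theta> s y + \<theta> s y \<bullet> \<theta> s y / 2" by (simp add: \<phi>_def)
      show "Z s y + L s *v V s y + N s *v (transpose (A s y) *v (g\<phi> s y + (1 - q s y) *\<^sub>R y)) = 0"
        by (rule momentum[OF s' out[OF y]])
      show "\<bar>d s y\<bar> \<le> b'" using c2[OF s y] b' by simp
      show "norm (\<theta> s y) \<le> b'" using c1[OF s y] b' by simp
    qed (use \<alpha>_pos B_ge_1 b' q_bounds[OF s', of y] coeff_B[OF s'] PN[OF s'] A_B[OF s', of y] yb[OF y] in auto)
  qed
  have le: "Ft s y \<le> C * F s y - (\<Sum>b\<in>Basis. G' s y b \<bullet> b)" if s: "s \<in> {0..t}" for s y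
  proof (cases "y \<in> cball x r")
    case False
    then show ?thesis unfolding G_div[OF s] Ft_def F_def Wt_def W_def gW_def by (simp add: m_zero[OF s])
  next
    case True
    note J0 = J_pos[OF sT[OF s], of y]
    have "J s y * (Wt s y / 2 * e s y + \<phi> s y * ((A s y *v V s y) \<bullet> gW s y)) \<le> 0"
      using cone[OF s, of y] J0 by (intro mult_nonneg_nonpos) auto
    moreover have "W s y * J s y / 2 * (d s y * e s y + et s y)
        \<le> W s y * J s y / 2 * (C * e s y - 2 * (g\<phi> s y \<bullet> (A s y *v V s y) + \<phi> s y * d s y))"
      using J0 by (intro mult_left_mono rate s True) (auto simp: W_def)
    moreover have "(\<Sum>b\<in>Basis. G' s y b \<bullet> b) = J s y * (\<phi> s y * ((A s y *v V s y) \<bullet> gW s y))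
       + W s y * J s y * (g\<phi> s y \<bullet> (A s y *v V s y) + \<phi> s y * d s y)"
      unfolding G_div[OF s] adjugate_eq[OF sT[OF s]] d_def
      by (simp add: inner_add_left matrix_mult_scaleR trace_scaleR scaleR_matrix_vector_assoc[symmetric]
          inner_commute[of "gW s y"] algebra_simps)
    \<comment> \<open>\<open>k\<close> is to be the flux \<phi> (A V) . gW caused by the gradient of
      the weight: the cone estimate absorbs it, and the -J k left over is part of minus the
      divergence of \<open>G\<close>.\<close>
    moreover have "Ft s y = J s y * (Wt s y / 2 * e s y + k) - J s y * k + W s y * J s y / 2 * (d s y * e s y + et s y)" for k
      by (simp add: Ft_def algebra_simps)
    moreover have "W s y * J s y / 2 * (C * e s y - 2 * k) = C * F s y - W s y * J s y * k" for k
      by (simp add: F_def right_diff_distrib)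
    ultimately show ?thesis by (smt (verit))
  qed
  have Ft_b: "\<bar>Ft s y\<bar> \<le> b * indicator (cball x r) y" if s: "s \<in> {0..t}" for s y
    using b[OF s, of y] by (cases "y \<in> cball x r") (auto simp: Ft_def Wt_def W_def m_zero[OF s])
  have F_init: "F 0 y = 0" for y
  proof (cases "y \<in> cball x r")
    case False
    then show ?thesis using m_zero[of 0 y] t by (simp add: F_def W_def)
  next
    case True
    have T0: "0 \<in> {0..T}" using T_pos by simp
    note y1 = out[OF True]
    \<comment> \<open>The density contains q, hence D\<theta>, so \<theta> has to vanish on an open
      set around \<open>y\<close> and not only at \<open>y\<close>.\<close>
    have op: "open {z::real^3. 1 < norm z}" by (intro open_Collect_less continuous_intros)
    have "((\<lambda>_. 0) has_derivative (\<lambda>h. D\<theta> 0 y *v h)) (at y)"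
      by (rule has_derivative_transform_within_open[OF \<theta>_space[OF T0] op]) (use y1 init in auto)
    then have "(\<lambda>h. D\<theta> 0 y *v h) = (\<lambda>_. 0)"
      by (metis has_derivative_const has_derivative_unique)
    then have "D\<theta> 0 y = 0" by (metis matrix_eq matrix_vector_mult_0)
    then have "q 0 y = 1" by (simp add: q_def J_def M_def)
    then have "e 0 y = 0" using init y1 by (simp add: e_def energy_density_def \<phi>_def)
    then show ?thesis by (simp add: F_def)
  qed
  have F0: "F t x = 0"
  proof (rule local_energy_vanishes[where T=t and F=F and F'=Ft and G=G and G'=G' and B=b and C=C and x=x and r=r])
    show "F s y = 0 \<and> G s y = 0" if "s \<in> {0..t}" "y \<notin> cball x r" for s y
      using m_zero[OF that] by (simp add: F_def G_def W_def)
    show "0 \<le> F s y" if "s \<in> {0..t}" for s y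
      using e_nonneg[OF that, of y] J_pos[OF sT[OF that], of y] by (simp add: F_def W_def)
  qed (use t F_time Ft_b cont F_init G_space le in auto)
  have tt: "t \<in> {0..t}" "t \<in> {0..T}" using t by auto
  \<comment> \<open>The weight is still positive at the point (t, x) itself, so vanishing of
    \<open>F\<close> forces the energy density to vanish there.\<close>
  have "m t x = (r - K * t)\<^sup>2" by (simp add: m_def)
  then have "W t x \<noteq> 0" using Kst(1)[OF tt(1)] by (simp add: W_def)
  then have e0: "e t x = 0" using F0 J_pos[OF tt(2), of x] by (simp add: F_def)
  note coer = energy_density_coercive[OF \<kappa>(1) B_ge_1 q_bounds(1,2)[OF tt(2)] \<kappa>(2) PN[OF tt(2)] coeff_B(1,4)[OF tt(2)]]
  have "norm (V t x) \<le> B\<^sup>2 * sqrt (e t x)" "norm (\<theta> t x) \<le> sqrt (e t x)"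
    unfolding e_def by (rule coer(1), rule coer(3))
  then show ?thesis by (simp add: e0)
qed

theorem finite_propagation_speed:
  "\<exists>K>0. \<forall>\<tau>\<in>{0..T}. \<forall>y::real^3. 1 + K * \<tau> < norm y \<longrightarrow> \<theta> \<tau> y = 0 \<and> V \<tau> y = 0"
proof (intro exI conjI ballI allI impI)
  show "0 < 2 * (B^4 / \<kappa>)" using B_ge_1 \<kappa> by simp
  fix \<tau> and y :: "real^3" assume \<tau>: "\<tau> \<in> {0..T}" and y: "1 + 2 * (B^4 / \<kappa>) * \<tau> < norm y"
  have "\<theta> \<tau> y = 0 \<and> V \<tau> y = 0"
  proof (cases "\<tau> = 0")
    case True
    then show ?thesis using init y by simp
  next
    case False
    then show ?thesis using vanishes_outside_cone[OF _ _ refl y] \<tau> by auto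
  qed
  then show "\<theta> \<tau> y = 0" "V \<tau> y = 0" by auto
qed

end

section \<open>Affine motions\<close>

text \<open>The inverse function theorem on a closed half-line, one-sided at the end point 0. That f
  exceeds every bound makes its image all of \<open>{0..}\<close>.\<close>

lemma
  fixes f f' :: "real \<Rightarrow> real"
  defines "g \<equiv> the_inv_into {0..} f"
  assumes f0: "f 0 = 0"
    and der: "\<And>t. 0 \<le> t \<Longrightarrow> (f has_real_derivative f' t) (at t within {0..})"
    and pos: "\<And>t. 0 \<le> t \<Longrightarrow> 0 < f' t"
    and unbounded: "\<And>\<tau>. \<exists>t\<ge>0. \<tau> \<le> f t"
    and \<tau>: "0 \<le> \<tau>"
  shows half_line_inverse_nonneg: "0 \<le> g \<tau>"
    and half_line_inverse_derivative: "(g has_real_derivative 1 / f' (g \<tau>)) (at \<tau> within {0..})"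
proof -
  have cont: "continuous_on {0..} f" by (rule DERIV_continuous_on[of _ _ f']) (use der in auto)
  have less: "f a < f b" if "0 \<le> a" "a < b" for a b
  proof (rule DERIV_pos_imp_increasing_open[OF \<open>a < b\<close>])
    fix t assume t: "a < t" "t < b"
    then have "at t within {0..} = at t" using that by (intro at_within_interior) auto
    then show "\<exists>y. (f has_real_derivative y) (at t) \<and> 0 < y" using der[of t] pos[of t] t that by auto
  qed (use that in \<open>auto intro: continuous_on_subset[OF cont]\<close>)
  have inj: "inj_on f {0..}" by (rule linorder_inj_onI) (use less in force)+
  have surj: "\<tau> \<in> f ` {0..}" if \<tau>: "0 \<le> \<tau>" for \<tau>
  proof -
    obtain t where t: "t \<ge> 0" "\<tau> \<le> f t" using unbounded by blast
    have "continuous_on {0..t} f" by (rule continuous_on_subset[OF cont]) auto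
    then obtain x where "0 \<le> x" "x \<le> t" "f x = \<tau>" using IVT'[of f 0 \<tau> t] f0 \<tau> t by auto
    then show ?thesis by force
  qed
  have g: "0 \<le> g \<tau>" "f (g \<tau>) = \<tau>" if "0 \<le> \<tau>" for \<tau>
    using the_inv_into_into[OF inj surj[OF that], of "{0..}"] f_the_inv_into_f[OF inj surj[OF that]]
    by (auto simp: g_def)
  have gf: "g (f t) = t" if "0 \<le> t" for t
    unfolding g_def using that by (intro the_inv_into_f_f inj) auto
  show "0 \<le> g \<tau>" using g(1)[OF \<tau>] .
  have g_less: "g a < b" if "0 \<le> a" "a < f b" "0 \<le> b" for a b
    using less[of b "g a"] g[OF that(1)] that by (cases b "g a" rule: linorder_cases) auto
  define b where "b = g \<tau> + 1"
  have b: "0 \<le> b" "\<tau> < f b" using g[OF \<tau>] less[of "g \<tau>" b] by (auto simp: b_def)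
  \<comment> \<open>The inverse is continuous on the image of a compact interval reaching beyond g
    \<tau>, and that image contains a neighbourhood of \<tau> in the half-line.\<close>
  have "continuous_on (f ` {0..b}) g"
    by (rule continuous_on_inv) (use gf in \<open>auto intro: continuous_on_subset[OF cont]\<close>)
  moreover have "{0..<f b} \<subseteq> f ` {0..b}"
  proof
    fix u assume u: "u \<in> {0..<f b}"
    then have "g u < b" using b g_less by auto
    then have "g u \<in> {0..b}" using g[of u] u by auto
    then show "u \<in> f ` {0..b}" using g[of u] u by (metis atLeastLessThan_iff image_eqI)
  qed
  ultimately have "continuous_on {0..<f b} g" by (rule continuous_on_subset)
  then have "continuous (at \<tau> within {0..<f b}) g"
    using b \<tau> by (simp add: continuous_on_eq_continuous_within)
  moreover have nhd: "at \<tau> within {0..<f b} = at \<tau> within {0..}"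
    by (rule at_within_nhd[of _ "{..<f b}"]) (use b in auto)
  ultimately have "(g \<longlongrightarrow> g \<tau>) (at \<tau> within {0..})"
    by (simp add: continuous_within)
  \<comment> \<open>Substituting g into the limit of the difference quotients of f needs g u to
    avoid g \<tau>, because that limit is taken over a punctured neighbourhood.\<close>
  moreover have g_inj: "g u \<noteq> g \<tau>" if "0 \<le> u" "u \<noteq> \<tau>" for u
    using g(2)[OF that(1)] g(2)[OF \<tau>] that(2) by metis
  then have "\<forall>\<^sub>F u in at \<tau> within {0..}. g u \<in> {0..} - {g \<tau>}"
    unfolding eventually_at_filter using g by (intro always_eventually) auto
  ultimately have lim: "filterlim g (at (g \<tau>) within {0..}) (at \<tau> within {0..})"
    by (auto simp: filterlim_at)
  have "((\<lambda>y. (f y - f (g \<tau>)) / (y - g \<tau>)) \<longlongrightarrow> f' (g \<tau>)) (at (g \<tau>) within {0..})"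
    using der[OF g(1)[OF \<tau>]] by (simp add: has_field_derivative_iff)
  from filterlim_compose[OF this lim]
  have "((\<lambda>u. inverse ((f (g u) - f (g \<tau>)) / (g u - g \<tau>))) \<longlongrightarrow> inverse (f' (g \<tau>))) (at \<tau> within {0..})"
    using pos[OF g(1)[OF \<tau>]] by (intro tendsto_inverse) auto
  then have "((\<lambda>u. (g u - g \<tau>) / (u - \<tau>)) \<longlongrightarrow> 1 / f' (g \<tau>)) (at \<tau> within {0..})"
  proof (rule Lim_transform_eventually[THEN tendsto_eq_rhs])
    show "\<forall>\<^sub>F u in at \<tau> within {0..}. inverse ((f (g u) - f (g \<tau>)) / (g u - g \<tau>)) = (g u - g \<tau>) / (u - \<tau>)"
      unfolding eventually_at_filter using g g[OF \<tau>] by (intro always_eventually) auto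
  qed (simp add: divide_inverse)
  then show "(g has_real_derivative 1 / f' (g \<tau>)) (at \<tau> within {0..})"
    by (simp add: has_field_derivative_iff)
qed

lemma at_within_half_line_neq_bot: "0 \<le> x \<Longrightarrow> at x within {0::real..} \<noteq> bot"
proof -
  assume "0 \<le> x"
  then have "x islimpt {x..x+1}" "{x..x+1} \<subseteq> {0..}" by (auto simp: islimpt_Icc)
  then have "x islimpt {0..}" using islimpt_subset by blast
  then show ?thesis by (simp add: trivial_limit_within)
qed

text \<open>The upper bound det A \<le> c (1 + t)^3 keeps the integrand above k/(1 + t) with k =
  c^(-1/3). So the new time grows at least logarithmically and exhausts the half-line, which makes
  its inverse differentiable with derivative 1 over the integrand.\<close>

lemma
  assumes "affine_motion \<alpha> Tbar A" and "0 \<le> \<tau>"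
  shows t_of_nonneg: "0 \<le> t_of A \<tau>"
    and t_of_derivative: "(t_of A has_real_derivative det (A (t_of A \<tau>)) powr (1 / 3)) (at \<tau> within {0..})"
proof -
  obtain A' c where A': "\<And>t. 0 \<le> t \<Longrightarrow> (A has_vector_derivative A' t) (at t within {0..})"
    and c: "c > 0" "\<And>t. 0 \<le> t \<Longrightarrow> inverse c * (1 + t ^ 3) \<le> det (A t)" "\<And>t. 0 \<le> t \<Longrightarrow> det (A t) \<le> c * (1 + t ^ 3)"
    using assms(1) unfolding affine_motion_def by blast
  define f where "f s = 1 / det (A s) powr (1 / 3)" for s
  have dp: "0 < det (A t)" if "0 \<le> t" for t
    using c(2)[OF that] c(1) that
    by (intro less_le_trans[OF _ c(2)[OF that]] mult_pos_pos add_pos_nonneg) auto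
  have fpos: "0 < f t" if "0 \<le> t" for t using dp[OF that] by (simp add: f_def)
  have "continuous_on {0..} A" by (rule continuous_on_vector_derivative) (use A' in auto)
  then have f_cont: "continuous_on {0..} f"
    unfolding f_def det_3
    by (intro continuous_intros) (use dp in \<open>force simp: det_3\<close>)+
  have der: "(tau_of A has_real_derivative f t) (at t within {0..})" if "0 \<le> t" for t
  proof -
    have "continuous_on {0..t + 1} f" by (rule continuous_on_subset[OF f_cont]) auto
    then have "((\<lambda>u. integral {0..u} f) has_vector_derivative f t) (at t within {0..t + 1})"
      by (rule integral_has_vector_derivative) (use that in auto)
    moreover have "at t within {0..t + 1} = at t within {0..}"
      by (rule at_within_nhd[of _ "{..<t + 1}"]) auto
    ultimately show ?thesis
      unfolding tau_of_def f_def by (simp add: has_real_derivative_iff_has_vector_derivative)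
  qed
  define k where "k = 1 / c powr (1 / 3)"
  have k: "0 < k" using c(1) by (simp add: k_def)
  have f_ge: "k / (1 + t) \<le> f t" if "0 \<le> t" for t
  proof -
    have "1 + t ^ 3 \<le> (1 + t) ^ 3" using that by (simp add: power3_eq_cube algebra_simps)
    then have "det (A t) \<le> c * (1 + t) ^ 3"
      using c(3)[OF that] mult_left_mono[of "1 + t ^ 3" "(1 + t) ^ 3" c] c(1) by linarith
    then have "det (A t) powr (1 / 3) \<le> (c * (1 + t) ^ 3) powr (1 / 3)"
      using dp[OF that] by (intro powr_mono2) auto
    also have "\<dots> = c powr (1 / 3) * (1 + t)"
    proof -
      have "((1 + t) ^ 3) powr (1 / 3) = 1 + t"
        using that powr_powr[of "1 + t" 3 "1 / 3"] by (simp add: powr_realpow flip: powr_numeral)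
      then show ?thesis using that c(1) by (simp add: powr_mult)
    qed
    finally have *: "det (A t) powr (1 / 3) \<le> c powr (1 / 3) * (1 + t)" .
    have "1 / (c powr (1 / 3) * (1 + t)) \<le> 1 / det (A t) powr (1 / 3)"
      by (rule frac_le[OF _ _ _ *]) (use dp[OF that] in auto)
    then show ?thesis by (simp add: f_def k_def)
  qed
  have tau_ge: "k * ln (1 + t) \<le> tau_of A t" if "0 \<le> t" for t
  proof -
    have "tau_of A 0 - k * ln (1 + 0) \<le> tau_of A t - k * ln (1 + t)"
    proof (rule DERIV_nonneg_imp_increasing_open[OF that])
      fix s assume s: "0 < s" "s < t"
      then have "at s within {0..} = at s" by (intro at_within_interior) auto
      then have "(tau_of A has_real_derivative f s) (at s)" using der[of s] s by simp
      then have "((\<lambda>t. tau_of A t - k * ln (1 + t)) has_real_derivative f s - k / (1 + s)) (at s)"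
        using s by (auto intro!: derivative_eq_intros)
      then show "\<exists>y. ((\<lambda>t. tau_of A t - k * ln (1 + t)) has_real_derivative y) (at s) \<and> 0 \<le> y"
        using f_ge[of s] s by auto
    next
      have "continuous_on {0..} (tau_of A)" by (rule DERIV_continuous_on[of _ _ f]) (use der in auto)
      then show "continuous_on {0..t} (\<lambda>t. tau_of A t - k * ln (1 + t))"
        by (intro continuous_intros) (auto intro: continuous_on_subset)
    qed
    then show ?thesis by (simp add: tau_of_def)
  qed
  have unb: "\<exists>t\<ge>0. x \<le> tau_of A t" for x
  proof -
    define t where "t = exp (max 0 (x / k)) - 1"
    have t: "0 \<le> t" by (simp add: t_def)
    have "x \<le> k * max 0 (x / k)" using k by (simp add: max_def field_simps)
    also have "\<dots> \<le> tau_of A t" using tau_ge[OF t] by (simp add: t_def)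
    finally show ?thesis using t by blast
  qed
  have "tau_of A 0 = 0" by (simp add: tau_of_def)
  note inv = this der fpos unb assms(2)
  show "0 \<le> t_of A \<tau>" unfolding t_of_def by (rule half_line_inverse_nonneg[OF inv])
  show "(t_of A has_real_derivative det (A (t_of A \<tau>)) powr (1 / 3)) (at \<tau> within {0..})"
    using half_line_inverse_derivative[OF inv] by (simp add: t_of_def f_def)
qed

text \<open>\<open>Lam\<close> is a scalar multiple of the last product, so a scalar multiple of the
  affine motion itself can serve as the symmetrizer \<open>P\<close>.\<close>

lemma matrix_inv_cancel:
  fixes M :: "real^3^3"
  assumes "det M \<noteq> 0"
  shows "transpose M ** M ** (matrix_inv M ** transpose (matrix_inv M)) = mat 1"
proof -
  have "M ** matrix_inv M = mat 1" "matrix_inv M ** M = mat 1"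
    using assms by (simp_all add: matrix_inv_adjugate matrix_mult_scaleR matrix_mult_adjugate adjugate_mult_matrix)
  note inv = this
  have "transpose M ** M ** (matrix_inv M ** transpose (matrix_inv M))
      = transpose M ** ((M ** matrix_inv M) ** transpose (matrix_inv M))"
    by (simp only: matrix_mul_assoc)
  also have "\<dots> = transpose (matrix_inv M ** M)"
    unfolding inv(1) matrix_mul_lid matrix_transpose_mul ..
  finally show ?thesis by (simp add: inv(2) transpose_mat)
qed

section \<open>Continuity of matrix functions and bounds on the coefficients\<close>

lemma continuous_on_adjugate:
  "continuous_on S f \<Longrightarrow> continuous_on S (\<lambda>x. adjugate (f x))"
  unfolding adjugate_def by (rule bounded_bilinear.continuous_on[OF bounded_bilinear_mixed_cofactor])

lemma continuous_on_det3:
  fixes f :: "'a::topological_space \<Rightarrow> real^3^3"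
  shows "continuous_on S f \<Longrightarrow> continuous_on S (\<lambda>x. det (f x))"
  unfolding det_3 by (intro continuous_intros)

lemma det_scaleR3: "det (c *\<^sub>R M) = c ^ 3 * det M" for M :: "real^3^3"
  by (simp add: det_3 power3_eq_cube algebra_simps)

lemma continuous_on_trace:
  fixes f :: "'a::topological_space \<Rightarrow> real^'n^'n"
  shows "continuous_on S f \<Longrightarrow> continuous_on S (\<lambda>x. trace (f x))"
  unfolding trace_def by (intro continuous_intros)

lemma continuous_on_matrix_inv:
  fixes f :: "'a::topological_space \<Rightarrow> real^3^3"
  assumes "continuous_on S f" "\<And>x. x \<in> S \<Longrightarrow> det (f x) \<noteq> 0"
  shows "continuous_on S (\<lambda>x. matrix_inv (f x))"
proof -
  have "continuous_on S (\<lambda>x. inverse (det (f x)) *\<^sub>R adjugate (f x))"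
    using assms by (intro continuous_intros continuous_on_det3 continuous_on_adjugate) auto
  then show ?thesis
    by (rule continuous_on_eq) (use assms(2) in \<open>simp add: matrix_inv_adjugate\<close>)
qed

text \<open>After division by mu^\<sigma> the system has the damping matrix and the pressure matrix
  bounded here. All coefficients are continuous on the half-line, so compactness of [0, T] bounds
  them; \<open>B\<close> may depend on \<open>T\<close>.\<close>

lemma affine_motion_coefficients:
  fixes T :: real
  assumes aff: "affine_motion \<alpha> Tbar A" and "0 < \<alpha>" "0 < Tbar"
  shows "\<exists>B. \<exists>P P' :: real \<Rightarrow> real^3^3. 1 \<le> B \<and> 0 < Cbar \<alpha> Tbar A \<and> (\<forall>\<tau>\<ge>0. 0 < mu A \<tau>) \<and>
    (\<forall>\<tau>\<in>{0..T}. (P has_vector_derivative P' \<tau>) (at \<tau> within {0..T}) \<and>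
      norm (P \<tau>) \<le> B \<and> norm (P' \<tau>) \<le> B \<and>
      norm ((mu_tau A \<tau> / mu A \<tau>) *\<^sub>R mat 1 + 2 *\<^sub>R Gamma_star A \<tau>) \<le> B \<and>
      norm ((Cbar \<alpha> Tbar A * mu A \<tau> powr (- 3 / \<alpha>)) *\<^sub>R Lam A \<tau>) \<le> B \<and>
      transpose (P \<tau>) ** P \<tau> ** ((Cbar \<alpha> Tbar A * mu A \<tau> powr (- 3 / \<alpha>)) *\<^sub>R Lam A \<tau>) = mat 1)"
proof -
  define A2 where "A2 t = (Cbar \<alpha> Tbar A * det (A t) powr (- 1 / \<alpha>)) *\<^sub>R transpose (matrix_inv (A t))" for t
  have "\<exists>A'. \<forall>t\<ge>0. (A has_vector_derivative A' t) (at t within {0..})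
      \<and> (A' has_vector_derivative A2 t) (at t within {0..})"
    using aff unfolding affine_motion_def A2_def by blast
  then obtain A' where A': "\<And>t. 0 \<le> t \<Longrightarrow> (A has_vector_derivative A' t) (at t within {0..})"
    and A'': "\<And>t. 0 \<le> t \<Longrightarrow> (A' has_vector_derivative A2 t) (at t within {0..})"
    by blast
  obtain c where c: "c > 0" "\<And>t. 0 \<le> t \<Longrightarrow> inverse c * (1 + t ^ 3) \<le> det (A t)" and det0: "det (A 0) > 0"
    using aff unfolding affine_motion_def by blast
  have dp: "0 < det (A t)" if "0 \<le> t" for t
    using c(2)[OF that] c(1) that
    by (intro less_le_trans[OF _ c(2)[OF that]] mult_pos_pos add_pos_nonneg) auto
  define C where "C = Cbar \<alpha> Tbar A"
  have C: "0 < C" using det0 \<open>0 < Tbar\<close> by (simp add: C_def Cbar_def)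
  define a where "a \<tau> = A (t_of A \<tau>)" for \<tau>
  note t0 = t_of_nonneg[OF aff]
  have det_a: "0 < det (a \<tau>)" if "0 \<le> \<tau>" for \<tau> using dp t0 that by (simp add: a_def)
  have mu: "mu A \<tau> = det (a \<tau>) powr (1 / 3)" for \<tau> by (simp add: mu_def a_def)
  have mu_pos: "0 < mu A \<tau>" if "0 \<le> \<tau>" for \<tau> using det_a[OF that] by (simp add: mu)
  define a' where "a' \<tau> = mu A \<tau> *\<^sub>R A' (t_of A \<tau>)" for \<tau>
  have t_der: "(t_of A has_vector_derivative mu A \<tau>) (at \<tau> within {0..})" if "0 \<le> \<tau>" for \<tau>
    using t_of_derivative[OF aff that] by (simp add: has_real_derivative_iff_has_vector_derivative mu a_def)
  have a_der: "(a has_vector_derivative a' \<tau>) (at \<tau> within {0..})" if "0 \<le> \<tau>" for \<tau>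
  proof -
    have "(A has_vector_derivative A' (t_of A \<tau>)) (at (t_of A \<tau>) within t_of A ` {0..})"
      by (rule has_vector_derivative_within_subset[OF A']) (use t0 that in auto)
    from vector_diff_chain_within[OF t_der[OF that] this] show ?thesis
      by (simp add: a_def[abs_def] a'_def comp_def)
  qed
  have a_cont: "continuous_on {0..} a" by (rule continuous_on_vector_derivative) (use a_der in auto)
  have det_nz: "det (a \<tau>) \<noteq> 0" if "\<tau> \<in> {0..}" for \<tau> using det_a[of \<tau>] that by auto
  have mu_cont: "continuous_on {0..} (mu A)"
    unfolding mu[abs_def] by (intro continuous_intros continuous_on_det3 a_cont) (use det_nz in auto)
  have mu_nz: "mu A \<tau> \<noteq> 0" if "\<tau> \<in> {0..}" for \<tau> using mu_pos[of \<tau>] that by auto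
  have t_cont: "continuous_on {0..} (t_of A)" by (rule continuous_on_vector_derivative) (use t_der in auto)
  \<comment> \<open>\<open>A'\<close> is continuous because the second-order equation makes it
    differentiable. The derivatives of mu and of O then become continuous as well.\<close>
  have "continuous_on {0..} A'" by (rule continuous_on_vector_derivative) (use A'' in auto)
  then have a'_cont: "continuous_on {0..} a'"
    unfolding a'_def by (intro continuous_intros mu_cont continuous_on_compose2[OF _ t_cont]) (use t0 in auto)
  define m where "m \<tau> = 1 / 3 * det (a \<tau>) powr (1 / 3 - 1) * trace (adjugate (a \<tau>) ** a' \<tau>)" for \<tau>
  have mu_der: "(mu A has_real_derivative m \<tau>) (at \<tau> within {0..})" if "0 \<le> \<tau>" for \<tau>
  proof -
    have "((\<lambda>\<tau>. det (a \<tau>)) has_derivative (\<lambda>h. trace (adjugate (a \<tau>) ** (h *\<^sub>R a' \<tau>)))) (at \<tau> within {0..})"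
      by (rule has_derivative_det[OF a_der[OF that, unfolded has_vector_derivative_def]])
    then have det_der: "((\<lambda>\<tau>. det (a \<tau>)) has_real_derivative trace (adjugate (a \<tau>) ** a' \<tau>)) (at \<tau> within {0..})"
      unfolding has_field_derivative_def
      by (rule has_derivative_eq_rhs) (simp add: fun_eq_iff matrix_mult_scaleR trace_scaleR)
    show ?thesis unfolding mu[abs_def] m_def
      by (rule DERIV_chain2[OF has_real_derivative_powr[OF det_a[OF that]] det_der])
  qed
  have m_cont: "continuous_on {0..} m"
    unfolding m_def
    by (intro continuous_intros continuous_on_trace continuous_on_det3 continuous_on_adjugate a_cont a'_cont
        bounded_bilinear.continuous_on[OF bounded_bilinear_matrix_matrix_mult]) (use det_nz in auto)
  have mu_tau: "mu_tau A \<tau> = m \<tau>" if "0 \<le> \<tau>" for \<tau>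
    unfolding mu_tau_def using mu_der[OF that]
    by (intro vector_derivative_within at_within_half_line_neq_bot that)
      (simp add: has_real_derivative_iff_has_vector_derivative)
  define O' where "O' \<tau> = inverse (mu A \<tau>) *\<^sub>R a' \<tau> + (- (inverse (mu A \<tau>) * m \<tau> * inverse (mu A \<tau>))) *\<^sub>R a \<tau>" for \<tau>
  have O: "Omat A \<tau> = inverse (mu A \<tau>) *\<^sub>R a \<tau>" for \<tau> by (simp add: Omat_def a_def)
  have O_der: "(Omat A has_vector_derivative O' \<tau>) (at \<tau> within {0..})" if "0 \<le> \<tau>" for \<tau>
    unfolding O[abs_def] O'_def
    by (intro has_vector_derivative_scaleR a_der that DERIV_inverse' mu_der) (use mu_pos[OF that] in auto)
  have O_det: "det (Omat A \<tau>) \<noteq> 0" if "\<tau> \<in> {0..}" for \<tau>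
    using det_nz[OF that] mu_nz[OF that] by (simp add: O det_scaleR3)
  have O_cont: "continuous_on {0..} (Omat A)"
    by (rule continuous_on_vector_derivative) (use O_der in auto)
  have Gamma: "Gamma_star A \<tau> = matrix_inv (Omat A \<tau>) ** O' \<tau>" if "0 \<le> \<tau>" for \<tau>
    unfolding Gamma_star_def
    by (simp add: vector_derivative_within[OF at_within_half_line_neq_bot[OF that] O_der[OF that]])
  have O'_cont: "continuous_on {0..} O'"
    unfolding O'_def by (intro continuous_intros mu_cont m_cont a_cont a'_cont) (use mu_nz in auto)
  \<comment> \<open>\<open>N\<close> equals C mu^(2 - 3/\<alpha>) times a^-1 a^-T, and
    \<open>k\<close> is the power -1/2 of that scalar, so k^2 a^T a inverts
    \<open>N\<close>.\<close>
  define k where "k \<tau> = C powr (- 1 / 2) * mu A \<tau> powr (3 / (2 * \<alpha>) - 1)" for \<tau>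
  define k' where "k' \<tau> = C powr (- 1 / 2) * ((3 / (2 * \<alpha>) - 1) * mu A \<tau> powr (3 / (2 * \<alpha>) - 1 - 1) * m \<tau>)" for \<tau>
  have k_der: "(k has_real_derivative k' \<tau>) (at \<tau> within {0..})" if "0 \<le> \<tau>" for \<tau>
    unfolding k_def[abs_def] k'_def
    by (intro DERIV_cmult DERIV_chain2[OF has_real_derivative_powr[OF mu_pos[OF that]] mu_der[OF that]])
  define P where "P \<tau> = k \<tau> *\<^sub>R a \<tau>" for \<tau>
  define P' where "P' \<tau> = k \<tau> *\<^sub>R a' \<tau> + k' \<tau> *\<^sub>R a \<tau>" for \<tau>
  have P_der: "(P has_vector_derivative P' \<tau>) (at \<tau> within {0..})" if "0 \<le> \<tau>" for \<tau>
    unfolding P_def[abs_def] P'_def by (intro has_vector_derivative_scaleR a_der k_der that)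
  have kc: "continuous_on {0..} k" "continuous_on {0..} k'"
    unfolding k_def k'_def by (intro continuous_intros mu_cont m_cont; use mu_nz in auto)+
  define L where "L \<tau> = (mu_tau A \<tau> / mu A \<tau>) *\<^sub>R mat 1 + 2 *\<^sub>R Gamma_star A \<tau>" for \<tau>
  define N where "N \<tau> = (C * mu A \<tau> powr (- 3 / \<alpha>)) *\<^sub>R Lam A \<tau>" for \<tau>
  have Lam: "Lam A \<tau> = (mu A \<tau>)\<^sup>2 *\<^sub>R (matrix_inv (a \<tau>) ** transpose (matrix_inv (a \<tau>)))" if "0 \<le> \<tau>" for \<tau>
  proof -
    have "(mu A \<tau>)\<^sup>2 = det (a \<tau>) powr (2 / 3)"
      using det_a[OF that] powr_add[of "det (a \<tau>)" "1 / 3" "1 / 3"] by (simp add: mu power2_eq_square)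
    then show ?thesis by (simp add: Lam_def a_def)
  qed
  have L_cont: "continuous_on {0..} L"
  proof (rule continuous_on_eq)
    show "continuous_on {0..} (\<lambda>\<tau>. (m \<tau> / mu A \<tau>) *\<^sub>R mat 1 + 2 *\<^sub>R (matrix_inv (Omat A \<tau>) ** O' \<tau>))"
      by (intro continuous_intros mu_cont m_cont O'_cont continuous_on_matrix_inv O_cont
          bounded_bilinear.continuous_on[OF bounded_bilinear_matrix_matrix_mult]) (use mu_nz O_det in auto)
  qed (simp add: L_def mu_tau Gamma)
  have N_cont: "continuous_on {0..} N"
  proof (rule continuous_on_eq)
    have tr: "continuous_on {0..} (\<lambda>\<tau>. transpose (matrix_inv (a \<tau>)))"
      unfolding transpose_def by (intro continuous_intros continuous_on_matrix_inv a_cont det_nz)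
    show "continuous_on {0..} (\<lambda>\<tau>. (C * mu A \<tau> powr (- 3 / \<alpha>)) *\<^sub>R ((mu A \<tau>)\<^sup>2 *\<^sub>R (matrix_inv (a \<tau>) ** transpose (matrix_inv (a \<tau>)))))"
      by (intro continuous_intros mu_cont continuous_on_matrix_inv a_cont det_nz tr
          bounded_bilinear.continuous_on[OF bounded_bilinear_matrix_matrix_mult]) (use mu_nz in auto)
  qed (simp add: N_def Lam)
  have bnd: "\<exists>b. \<forall>\<tau>\<in>{0..T}. norm (f \<tau>) \<le> b" if "continuous_on {0..} f" for f :: "real \<Rightarrow> real^3^3"
  proof -
    have "bounded (f ` {0..T})"
      by (intro compact_imp_bounded compact_continuous_image continuous_on_subset[OF that]) auto
    then show ?thesis by (simp add: bounded_iff)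
  qed
  have "continuous_on {0..} P" unfolding P_def by (intro continuous_intros kc a_cont)
  then obtain b1 where b1: "\<And>\<tau>. \<tau> \<in> {0..T} \<Longrightarrow> norm (P \<tau>) \<le> b1" using bnd[of P] by blast
  have "continuous_on {0..} P'" unfolding P'_def by (intro continuous_intros kc a_cont a'_cont)
  then obtain b2 where b2: "\<And>\<tau>. \<tau> \<in> {0..T} \<Longrightarrow> norm (P' \<tau>) \<le> b2" using bnd[of P'] by blast
  obtain b3 where b3: "\<And>\<tau>. \<tau> \<in> {0..T} \<Longrightarrow> norm (L \<tau>) \<le> b3" using bnd[OF L_cont] by blast
  obtain b4 where b4: "\<And>\<tau>. \<tau> \<in> {0..T} \<Longrightarrow> norm (N \<tau>) \<le> b4" using bnd[OF N_cont] by blast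
  have PN: "transpose (P \<tau>) ** P \<tau> ** N \<tau> = mat 1" if "0 \<le> \<tau>" for \<tau>
  proof -
    have tr: "transpose (P \<tau>) = k \<tau> *\<^sub>R transpose (a \<tau>)" by (simp add: P_def transpose_def vec_eq_iff)
    have "transpose (P \<tau>) ** P \<tau> ** N \<tau> = (C * mu A \<tau> powr (- 3 / \<alpha>) * (mu A \<tau>)\<^sup>2 * (k \<tau>)\<^sup>2) *\<^sub>R
       (transpose (a \<tau>) ** a \<tau> ** (matrix_inv (a \<tau>) ** transpose (matrix_inv (a \<tau>))))"
      unfolding tr by (simp add: P_def N_def Lam[OF that] matrix_mult_scaleR power2_eq_square mult_ac)
    also have "C * mu A \<tau> powr (- 3 / \<alpha>) * (mu A \<tau>)\<^sup>2 * (k \<tau>)\<^sup>2 = 1"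
    proof -
      have "(k \<tau>)\<^sup>2 = C powr (- 1) * mu A \<tau> powr (3 / \<alpha> - 2)"
        using powr_add[of C "- 1 / 2" "- 1 / 2"] powr_add[of "mu A \<tau>" "3 / (2 * \<alpha>) - 1" "3 / (2 * \<alpha>) - 1"]
        by (simp add: k_def power_mult_distrib power2_eq_square mult_ac)
      moreover have "(mu A \<tau>)\<^sup>2 = mu A \<tau> powr 2" using mu_pos[OF that] by simp
      moreover have "C powr (- 1) = 1 / C" using C by (simp add: powr_minus_divide)
      moreover have "mu A \<tau> powr (- 3 / \<alpha>) * mu A \<tau> powr 2 * mu A \<tau> powr (3 / \<alpha> - 2) = 1"
        unfolding powr_add[symmetric] using mu_pos[OF that] by simp
      ultimately show ?thesis using C by simp
    qed
    finally show ?thesis using matrix_inv_cancel[OF det_nz[of \<tau>]] that by simp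
  qed
  define B where "B = Max {1, b1, b2, b3, b4}"
  have B: "1 \<le> B" "b1 \<le> B" "b2 \<le> B" "b3 \<le> B" "b4 \<le> B" by (simp_all add: B_def)
  show ?thesis
  proof (rule exI[of _ B], rule exI[of _ P], rule exI[of _ P'], intro conjI ballI allI impI)
    show "(P has_vector_derivative P' \<tau>) (at \<tau> within {0..T})" if "\<tau> \<in> {0..T}" for \<tau>
      by (rule has_vector_derivative_within_subset[OF P_der]) (use that in auto)
    show "norm (P \<tau>) \<le> B" "norm (P' \<tau>) \<le> B"
      "norm ((mu_tau A \<tau> / mu A \<tau>) *\<^sub>R mat 1 + 2 *\<^sub>R Gamma_star A \<tau>) \<le> B"
      "norm ((Cbar \<alpha> Tbar A * mu A \<tau> powr (- 3 / \<alpha>)) *\<^sub>R Lam A \<tau>) \<le> B"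
      "transpose (P \<tau>) ** P \<tau> ** ((Cbar \<alpha> Tbar A * mu A \<tau> powr (- 3 / \<alpha>)) *\<^sub>R Lam A \<tau>) = mat 1"
      if "\<tau> \<in> {0..T}" for \<tau>
      using order_trans[OF b1[OF that] B(2)] order_trans[OF b2[OF that] B(3)]
        order_trans[OF b3[OF that] B(4)] order_trans[OF b4[OF that] B(5)] PN[of \<tau>] that
      unfolding L_def N_def C_def by simp_all
  qed (use B C mu_pos in \<open>auto simp: C_def\<close>)
qed

section \<open>Reduction of the system\<close>

lemma has_derivative_matrix:
  fixes M :: "'a::real_normed_vector \<Rightarrow> real^3^3"
  assumes "\<And>i k. ((\<lambda>x. M x $ i $ k) has_derivative (\<lambda>h. M' h $ i $ k)) (at x within S)"
  shows "(M has_derivative M') (at x within S)"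
  unfolding has_derivative_componentwise_within[of M]
  using assms by (auto simp: Basis_vec_def inner_axis)

lemma partial_deriv_eq:
  assumes "(f has_derivative f') (at y)"
  shows "partial_deriv k f y = f' (axis k 1)"
  using frechet_derivative_at[OF assms] by (simp add: partial_deriv_def)

lemma D_eq:
  assumes "(f has_derivative (\<lambda>h. X *v h)) (at y)"
  shows "D f y = X"
proof -
  have "frechet_derivative f (at y) = (\<lambda>h. X *v h)" using frechet_derivative_at[OF assms] by simp
  then show ?thesis by (simp add: D_def jacobian_def)
qed

lemma D_works:
  assumes "f differentiable_on UNIV"
  shows "(f has_derivative (\<lambda>h. D f y *v h)) (at y)"
proof -
  have "f differentiable (at y)" using assms by (simp add: differentiable_on_def)
  then show ?thesis by (simp add: D_def jacobian_works)
qed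

lemma D_nth:
  assumes "f differentiable_on UNIV"
  shows "D f y $ i $ k = partial_deriv k f y $ i"
  by (simp add: partial_deriv_eq[OF D_works[OF assms]] matrix_vector_mult_basis column_def)

lemma C_1_D:
  assumes "C_k 1 f"
  shows "(f has_derivative (\<lambda>h. D f y *v h)) (at y)" "continuous_on UNIV (D f)"
proof -
  have f: "f differentiable_on UNIV" and c: "\<And>k. continuous_on UNIV (partial_deriv k f)"
    using assms by auto
  show "(f has_derivative (\<lambda>h. D f y *v h)) (at y)" by (rule D_works[OF f])
  have "D f = (\<lambda>y. \<chi> i k. partial_deriv k f y $ i)" by (simp add: fun_eq_iff vec_eq_iff D_nth[OF f])
  then show "continuous_on UNIV (D f)" by (simp, intro continuous_intros c)
qed

text \<open>The columns of the Jacobian are the partial derivatives, so \<open>D2\<close> is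
  assembled from their Jacobians. Its symmetry is Schwarz's theorem for each component, stated for
  arbitrary directions as the Piola identity requires.\<close>

lemma C_2_second_derivative:
  fixes f :: "real^3 \<Rightarrow> real^3"
  assumes "C_k 2 f"
  obtains D2 where "\<And>y. (D f has_derivative D2 y) (at y)"
    "\<And>u. continuous_on UNIV (\<lambda>y. D2 y u)" "\<And>y u v. D2 y u *v v = D2 y v *v u"
proof -
  have f: "f differentiable_on UNIV" and f1: "\<And>k. C_k 1 (partial_deriv k f)"
    using assms by (auto simp: numeral_2_eq_2)
  define D2 where "D2 y h = (\<chi> i k. (D (partial_deriv k f) y *v h) $ i)" for y h
  have D2: "(D f has_derivative D2 y) (at y)" for y
    by (rule has_derivative_matrix)
      (auto simp: D2_def D_nth[OF f] intro!: bounded_linear.has_derivative[OF bounded_linear_vec_nth] C_1_D f1)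
  have cont: "continuous_on UNIV (\<lambda>y. D2 y u)" for u
    unfolding D2_def
    by (intro continuous_intros bounded_bilinear.continuous_on[OF bounded_bilinear_matrix_vector_mult] C_1_D f1)
  have "(D2 y u *v v) $ i = (D2 y v *v u) $ i" for y u v i
  proof (rule sym, rule mixed_partials_commute[where f = "\<lambda>y. f y $ i" and f' = "\<lambda>x h. (D f x *v h) $ i"
        and fu = "\<lambda>x h. (D2 x h *v u) $ i" and fv = "\<lambda>x h. (D2 x h *v v) $ i"])
    show "((\<lambda>y. f y $ i) has_derivative (\<lambda>h. (D f x *v h) $ i)) (at x)" for x
      by (intro bounded_linear.has_derivative[OF bounded_linear_vec_nth] D_works f)
    have *: "((\<lambda>z. D f z *v u) has_derivative (\<lambda>h. D2 x h *v u)) (at x)" for x u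
      using bounded_bilinear.FDERIV[OF bounded_bilinear_matrix_vector_mult D2 has_derivative_const] by simp
    then show "((\<lambda>z. (D f z *v u) $ i) has_derivative (\<lambda>h. (D2 x h *v u) $ i)) (at x)"
      "((\<lambda>z. (D f z *v v) $ i) has_derivative (\<lambda>h. (D2 x h *v v) $ i)) (at x)" for x
      by (intro bounded_linear.has_derivative[OF bounded_linear_vec_nth] *)+
    show "continuous_on UNIV (\<lambda>x. (D2 x v *v u) $ i)" "continuous_on UNIV (\<lambda>x. (D2 x u *v v) $ i)"
      by (intro continuous_intros bounded_bilinear.continuous_on[OF bounded_bilinear_matrix_vector_mult] cont)+
  qed
  then have "D2 y u *v v = D2 y v *v u" for y u v by (simp add: vec_eq_iff)
  then show ?thesis using that D2 cont by blast
qed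

section \<open>The pressure term and the momentum equation\<close>

lemma w_pos: "0 < w y"
  by (simp add: w_def)

lemma w_has_derivative: "(w has_derivative (\<lambda>h. (- w y *\<^sub>R y) \<bullet> h)) (at y)"
proof -
  have "((\<lambda>y::real^3. exp (- (y \<bullet> y) / 2)) has_derivative (\<lambda>h. exp (- (y \<bullet> y) / 2) * (- (y \<bullet> h + h \<bullet> y) / 2))) (at y)"
    by (auto intro!: derivative_eq_intros simp: fun_eq_iff inner_commute field_simps)
  moreover have w: "w = (\<lambda>y. exp (- (y \<bullet> y) / 2))"
    by (simp add: fun_eq_iff w_def power2_norm_eq_inner)
  ultimately show ?thesis unfolding w by (simp add: inner_commute)
qed

text \<open>Off the support of \<open>\<beta>\<close> the pressure term only sees the gradient of the Jacobian: by the Piola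
  identity no other second derivatives of \<open>\<eta>\<close> survive.\<close>

lemma divergence_pressure:
  fixes M :: "real^3 \<Rightarrow> real^3^3" and \<alpha> :: real and l :: "real^3"
  assumes M: "(M has_derivative M') (at y)" and sym: "\<And>u v. M' u *v v = M' v *v u"
    and det: "\<And>z. 0 < det (M z)" and "0 < \<alpha>" and "open U" "y \<in> U" and \<beta>: "\<And>z. z \<in> U \<Longrightarrow> \<beta> z = 0"
  shows "(\<Sum>k\<in>UNIV. partial_deriv k (\<lambda>z. \<Sum>j\<in>UNIV. w z * l $ j * (1 + \<beta> z) *
               (matrix_inv (M z) $ k $ j * det (M z) powr (- 1 / \<alpha>) - (if k = j then 1 else 0))) y)
    = w y * (y \<bullet> l + ((1 + \<alpha>) *\<^sub>R (\<chi> k. - 1 / \<alpha> * det (M y) powr (- 1 / \<alpha> - 1) * trace (adjugate (M y) ** M' (axis k 1)))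
        - det (M y) powr (- 1 / \<alpha>) *\<^sub>R y) \<bullet> (matrix_inv (M y) *v l))"
proof -
  \<comment> \<open>The adjugate is J times the inverse, so J^(-1/\<alpha>) times the inverse equals
    J^p times the adjugate, the form to which the Piola identity applies.\<close>
  define p where "p = - 1 / \<alpha> - 1"
  define t where "t = (\<chi> k. trace (adjugate (M y) ** M' (axis k 1)))"
  define A where "A z = matrix_inv (M z)" for z
  define J where "J z = det (M z)" for z
  have J: "J z \<noteq> 0" "0 < J z" for z using det[of z] by (auto simp: J_def)
  have adj: "adjugate (M z) = J z *\<^sub>R A z" for z using det[of z] by (simp add: A_def J_def matrix_inv_adjugate)
  have Jd: "(J has_derivative (\<lambda>h. t \<bullet> h)) (at y)"
  proof -
    note * = has_derivative_det[OF M]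
    show ?thesis unfolding J_def
      by (rule has_derivative_eq_rhs[OF *])
        (unfold t_def, rule ext, rule linear_eq_inner_gradient[OF has_derivative_linear[OF *]])
  qed
  have "((\<lambda>x. x powr p) has_real_derivative p * J y powr (p - 1)) (at (J y))"
    using J by (intro has_real_derivative_powr) auto
  then have Jp: "((\<lambda>z. J z powr p) has_derivative (\<lambda>h. p * J y powr (p - 1) * (t \<bullet> h))) (at y)"
    unfolding has_field_derivative_def by (rule has_derivative_compose[OF Jd])
  define g where "g = J y powr p *\<^sub>R (- w y *\<^sub>R y) + (w y * (p * J y powr (p - 1))) *\<^sub>R t"
  have f: "((\<lambda>z. w z * J z powr p) has_derivative (\<lambda>h. g \<bullet> h)) (at y)"
    by (rule has_derivative_eq_rhs[OF has_derivative_mult[OF w_has_derivative Jp]])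
      (simp add: g_def inner_add_left fun_eq_iff algebra_simps)
  have const: "((\<lambda>z. l) has_derivative (\<lambda>h. 0 *v h)) (at y)" by simp
  \<comment> \<open>The row \<open>l\<close> is constant in space. It takes the place of the
    velocity in the cofactor flux, with zero Jacobian, so the trace term drops out.\<close>
  define F where "F z = (w z * J z powr p) *\<^sub>R (adjugate (M z) *v l)" for z
  obtain F' where F': "(F has_derivative F') (at y)"
    and F'_div: "(\<Sum>b\<in>Basis. F' b \<bullet> b) = g \<bullet> (adjugate (M y) *v l) + w y * J y powr p * trace (adjugate (M y) ** 0)"
    using has_derivative_cofactor_flux[OF f M sym const] divergence_cofactor_flux[OF f M sym const]
    unfolding F_def by blast
  have G: "((\<lambda>z. F z - w z *\<^sub>R l) has_derivative (\<lambda>h. F' h - ((- w y *\<^sub>R y) \<bullet> h) *\<^sub>R l)) (at y)"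
    by (intro has_derivative_diff F' has_derivative_scaleR_left w_has_derivative)
  have "partial_deriv k (\<lambda>z. \<Sum>j\<in>UNIV. w z * l $ j * (1 + \<beta> z) *
               (A z $ k $ j * J z powr (- 1 / \<alpha>) - (if k = j then 1 else 0))) y
     = (F' (axis k 1) - ((- w y *\<^sub>R y) \<bullet> axis k 1) *\<^sub>R l) $ k" for k
  proof (rule partial_deriv_eq, rule has_derivative_transform_within_open)
    show "((\<lambda>z. (F z - w z *\<^sub>R l) $ k) has_derivative (\<lambda>h. (F' h - ((- w y *\<^sub>R y) \<bullet> h) *\<^sub>R l) $ k)) (at y)"
      by (intro bounded_linear.has_derivative[OF bounded_linear_vec_nth] G)
    fix z assume z: "z \<in> U"
    have "J z powr p * J z = J z powr (- 1 / \<alpha>)"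
      using powr_add[of "J z" p 1] J[of z] by (simp add: p_def)
    then have Fz: "F z = (w z * J z powr (- 1 / \<alpha>)) *\<^sub>R (A z *v l)"
      unfolding F_def adj by (simp add: scaleR_matrix_vector_assoc[symmetric] mult.assoc)
    then show "(F z - w z *\<^sub>R l) $ k = (\<Sum>j\<in>UNIV. w z * l $ j * (1 + \<beta> z) *
               (A z $ k $ j * J z powr (- 1 / \<alpha>) - (if k = j then 1 else 0)))"
    proof -
      have "(\<Sum>j\<in>UNIV. w z * l $ j * (if k = j then 1 else 0)) = w z * l $ k"
        by (simp add: if_distrib cong: if_cong)
      then show ?thesis
        using Fz \<beta>[OF z]
        by (simp only: right_diff_distrib sum_subtractf)
          (simp add: matrix_vector_mult_def sum_distrib_left mult_ac)
    qed
  qed (use assms in auto)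
  then have "(\<Sum>k\<in>UNIV. partial_deriv k (\<lambda>z. \<Sum>j\<in>UNIV. w z * l $ j * (1 + \<beta> z) *
               (A z $ k $ j * J z powr (- 1 / \<alpha>) - (if k = j then 1 else 0))) y)
     = (\<Sum>b\<in>Basis. F' b \<bullet> b) + w y * (y \<bullet> l)"
  proof -
    have "(F' (axis k 1) - ((- w y *\<^sub>R y) \<bullet> axis k 1) *\<^sub>R l) $ k = F' (axis k 1) \<bullet> axis k 1 + w y * (y $ k * l $ k)" for k
      by (simp add: inner_axis)
    then show ?thesis
      using \<open>\<And>k. partial_deriv k _ y = _\<close>
      by (simp only: sum_Basis_real_vec inner_vec_def[of y l] inner_real_def sum.distrib sum_distrib_left)
  qed
  also have "(\<Sum>b\<in>Basis. F' b \<bullet> b) = J y * (g \<bullet> (A y *v l))"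
    unfolding F'_div adj by (simp add: scaleR_matrix_vector_assoc[symmetric] trace_def matrix_matrix_mult_def)
  \<comment> \<open>Since p = (1 + \<alpha>) (-1/\<alpha>), differentiating J^p gives 1 + \<alpha>
    times the gradient of q; the term -q y comes from the Gaussian weight.\<close>
  also have "J y *\<^sub>R g = w y *\<^sub>R ((1 + \<alpha>) *\<^sub>R ((- 1 / \<alpha> * J y powr p) *\<^sub>R t) - J y powr (- 1 / \<alpha>) *\<^sub>R y)"
  proof -
    have Jpow: "J y powr p * J y = J y powr (p + 1)" for p
      using powr_add[of "J y" p 1] J[of y] by simp
    have "J y powr p * J y = J y powr (- 1 / \<alpha>)" unfolding Jpow by (simp add: p_def)
    moreover have "J y powr (p - 1) * J y = J y powr p" unfolding Jpow by simp
    moreover have "p = (1 + \<alpha>) * (- 1 / \<alpha>)" using \<open>0 < \<alpha>\<close> by (simp add: p_def field_simps)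
    ultimately show ?thesis unfolding g_def by (simp add: scaleR_add_right algebra_simps)
  qed
  then have "J y * (g \<bullet> (A y *v l)) = w y * (((1 + \<alpha>) *\<^sub>R ((- 1 / \<alpha> * J y powr p) *\<^sub>R t) - J y powr (- 1 / \<alpha>) *\<^sub>R y) \<bullet> (A y *v l))"
    by (metis inner_scaleR_left)
  also have "(- 1 / \<alpha> * J y powr p) *\<^sub>R t = (\<chi> k. - 1 / \<alpha> * J y powr p * trace (adjugate (M y) ** M' (axis k 1)))"
    by (simp add: t_def vec_eq_iff)
  finally show ?thesis unfolding A_def J_def p_def by (simp add: algebra_simps)
qed

text \<open>Dividing each component by m^\<sigma> merges the exponents \<sigma> - 3/\<alpha> and
  -\<sigma> into -3/\<alpha>, so \<sigma> disappears, and the weight \<open>c\<close> cancels.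
  Passing to the adjoint of \<open>A\<close> lets the matrix \<open>X\<close> act on one common
  vector.\<close>

lemma momentum_equation:
  fixes z v \<theta> y u :: "real^3" and X G A :: "real^3^3"
  assumes sys: "\<And>i. m powr \<sigma> * z $ i + mt * m powr (- 1 + \<sigma>) * v $ i + 2 * m powr \<sigma> * (\<Sum>j\<in>UNIV. G $ i $ j * v $ j)
      + C * m powr (- (3 / \<alpha> - \<sigma>)) * (\<Sum>l\<in>UNIV. X $ i $ l * \<theta> $ l)
      + C * m powr (- (3 / \<alpha> - \<sigma>)) / c * (c * (y \<bullet> X $ i + u \<bullet> (A *v X $ i))) = 0"
    and m: "0 < m" and "0 < c"
  shows "z + ((mt / m) *\<^sub>R mat 1 + 2 *\<^sub>R G) *v v
     + ((C * m powr (- 3 / \<alpha>)) *\<^sub>R X) *v (\<theta> + y + transpose A *v u) = 0"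
proof -
  have m1: "m powr (- 1 + \<sigma>) = m powr \<sigma> * (1 / m)"
    using m by (simp add: powr_diff)
  have m2: "m powr (- (3 / \<alpha> - \<sigma>)) = m powr \<sigma> * m powr (- 3 / \<alpha>)"
    by (simp flip: powr_add)
  have "z $ i + mt / m * v $ i + 2 * (G $ i \<bullet> v) + C * m powr (- 3 / \<alpha>) * (X $ i \<bullet> (\<theta> + y + transpose A *v u)) = 0" for i
  proof -
    have "u \<bullet> (A *v X $ i) = X $ i \<bullet> (transpose A *v u)"
      using transpose_adjoint[of A u "X $ i"] by (simp only: inner_commute)
    then have "m powr \<sigma> * (z $ i + mt / m * v $ i + 2 * (G $ i \<bullet> v) + C * m powr (- 3 / \<alpha>) * (X $ i \<bullet> (\<theta> + y + transpose A *v u)))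
       = m powr \<sigma> * z $ i + mt * m powr (- 1 + \<sigma>) * v $ i + 2 * m powr \<sigma> * (\<Sum>j\<in>UNIV. G $ i $ j * v $ j)
      + C * m powr (- (3 / \<alpha> - \<sigma>)) * (\<Sum>l\<in>UNIV. X $ i $ l * \<theta> $ l)
      + C * m powr (- (3 / \<alpha> - \<sigma>)) / c * (c * (y \<bullet> X $ i + u \<bullet> (A *v X $ i)))"
      unfolding m1 m2 using \<open>0 < c\<close>
      by (simp add: inner_add_right inner_vec_def[of "G $ i"] inner_vec_def[of "X $ i" \<theta>] inner_commute[of y] algebra_simps
          del: transpose_matrix_vector)
    then show ?thesis using sys[of i] m by simp
  qed
  then show ?thesis
    by (simp add: vec_eq_iff matrix_vector_mult_add_rdistrib matrix_vector_mul_component add.assoc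
        scaleR_matrix_vector_assoc[symmetric] del: transpose_matrix_vector)
qed

lemma Linf_norm_lessD:
  assumes "continuous_on UNIV f" "Linf_norm f < ennreal c" "0 \<le> c"
  shows "norm (f y) \<le> c"
  using norm_le_if_Linf_norm_le[OF assms(1), of c y] assms(2,3) by auto

theorem theorem3p1:
  fixes N :: nat and \<alpha> Tbar \<sigma> :: real and A :: "real \<Rightarrow> real^3^3"
  assumes "N \<ge> 4"
    and "\<alpha> > 0" and "Tbar > 0"
    and "affine_motion \<alpha> Tbar A"
    and "0 < \<sigma>" and "\<sigma> < min (3 / \<alpha>) 2"
  shows "\<exists>lam0>0. \<forall>lam\<in>{0<..lam0}.
    \<forall>(T::real) (\<beta> :: real^3 \<Rightarrow> real) (\<theta>0 :: real^3 \<Rightarrow> real^3) (V0 :: real^3 \<Rightarrow> real^3)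
       (\<theta> :: real \<Rightarrow> real^3 \<Rightarrow> real^3) (V :: real \<Rightarrow> real^3 \<Rightarrow> real^3).
      T > 0 \<longrightarrow>
      smooth \<beta> \<longrightarrow> compact (supp \<beta>) \<longrightarrow>
      unique_finite_energy_solution \<alpha> Tbar A \<sigma> N \<beta> T \<theta>0 V0 \<theta> V \<longrightarrow>
      supp \<theta>0 \<subseteq> cball 0 1 \<longrightarrow> supp V0 \<subseteq> cball 0 1 \<longrightarrow>
      a_priori \<alpha> A \<sigma> N T \<theta> V \<longrightarrow>
      sobolev_normsq (N + 1) \<beta> \<le> ennreal lam \<longrightarrow> supp \<beta> \<subseteq> cball 0 1 \<longrightarrow>
      (\<exists>K>0. \<forall>\<tau>\<in>{0..T}. \<forall>y. norm y > 1 + K * \<tau> \<longrightarrow> \<theta> \<tau> y = 0 \<and> V \<tau> y = 0)"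
proof (rule exI[of _ 1], intro conjI ballI allI impI)
  show "(0::real) < 1" by simp
  fix lam T :: real and \<beta> :: "real^3 \<Rightarrow> real" and \<theta>0 V0 :: "real^3 \<Rightarrow> real^3"
    and \<theta> V :: "real \<Rightarrow> real^3 \<Rightarrow> real^3"
  assume T: "T > 0" and uniq: "unique_finite_energy_solution \<alpha> Tbar A \<sigma> N \<beta> T \<theta>0 V0 \<theta> V"
    and supp0: "supp \<theta>0 \<subseteq> cball 0 1" "supp V0 \<subseteq> cball 0 1"
    and ap: "a_priori \<alpha> A \<sigma> N T \<theta> V" and supp\<beta>: "supp \<beta> \<subseteq> cball 0 1"
  define Z where "Z = time_deriv T V"
  have vanish: "g y = 0" if "supp g \<subseteq> cball 0 1" "1 < norm y" for g :: "real^3 \<Rightarrow> 'z::real_normed_vector" and y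
  proof (rule ccontr)
    assume "g y \<noteq> 0"
    then have "y \<in> supp g" unfolding supp_def by (intro subsetD[OF closure_subset]) simp
    then show False using that by auto
  qed
  have sol: "local_solution \<alpha> Tbar A \<sigma> \<beta> T \<theta>0 V0 \<theta> V"
    using uniq unfolding unique_finite_energy_solution_def finite_energy_solution_def by blast
  have init: "\<theta> 0 y = \<theta>0 y" "V 0 y = V0 y" for y using sol unfolding local_solution_def by auto
  have reg: "C_k 2 (\<theta> \<tau>)" "C_k 1 (V \<tau>)" "C_k 1 (Z \<tau>)"
    and \<theta>_time: "((\<lambda>s. \<theta> s y) has_vector_derivative V \<tau> y) (at \<tau> within {0..T})"
    and V_diff: "(\<lambda>s. V s y) differentiable (at \<tau> within {0..T})"
    and Jpos: "Jdet (\<theta> \<tau>) y > 0"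
    and sys: "system_lhs \<alpha> Tbar A \<sigma> \<beta> T \<theta> V \<tau> y i = 0" if "\<tau> \<in> {0..T}" for \<tau> y i
    using sol that unfolding local_solution_def Z_def by auto
  have V_time: "((\<lambda>s. V s y) has_vector_derivative Z \<tau> y) (at \<tau> within {0..T})" if "\<tau> \<in> {0..T}" for \<tau> y
    using V_diff[OF that] by (simp add: Z_def time_deriv_def vector_derivative_works)
  have reg1: "C_k 1 (\<theta> \<tau>)" if "\<tau> \<in> {0..T}" for \<tau>
  proof -
    have "continuous_on UNIV (partial_deriv k (\<theta> \<tau>))" for k
      using reg(1)[OF that] by (auto simp: numeral_2_eq_2 intro: differentiable_imp_continuous_on)
    then show ?thesis using reg(1)[OF that] by (auto simp: numeral_2_eq_2)
  qed
  note d\<theta> = C_1_D[OF reg1] and dV = C_1_D[OF reg(2)] and dZ = C_1_D[OF reg(3)]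
  have "\<forall>\<tau>. \<exists>D2. \<tau> \<in> {0..T} \<longrightarrow> (\<forall>y. (D (\<theta> \<tau>) has_derivative D2 y) (at y)) \<and>
    (\<forall>u. continuous_on UNIV (\<lambda>y. D2 y u)) \<and> (\<forall>y u v. D2 y u *v v = D2 y v *v u)"
    using C_2_second_derivative[OF reg(1)] by metis
  then obtain D2 where D2: "\<And>\<tau> y. \<tau> \<in> {0..T} \<Longrightarrow> (D (\<theta> \<tau>) has_derivative D2 \<tau> y) (at y)"
    "\<And>\<tau> u. \<tau> \<in> {0..T} \<Longrightarrow> continuous_on UNIV (\<lambda>y. D2 \<tau> y u)"
    "\<And>\<tau> y u v. \<tau> \<in> {0..T} \<Longrightarrow> D2 \<tau> y u *v v = D2 \<tau> y v *v u"
    by metis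
  define M where "M \<tau> y = mat 1 + D (\<theta> \<tau>) y" for \<tau> y
  have M: "D (eta (\<theta> \<tau>)) y = M \<tau> y" if "\<tau> \<in> {0..T}" for \<tau> y
  proof (rule D_eq)
    show "(eta (\<theta> \<tau>) has_derivative (*v) (M \<tau> y)) (at y)"
      unfolding eta_def[abs_def] M_def
      by (rule has_derivative_eq_rhs[OF has_derivative_add[OF has_derivative_ident d\<theta>(1)[OF that]]])
        (simp add: fun_eq_iff matrix_vector_mult_add_rdistrib)
  qed
  have Jdet: "Jdet (\<theta> \<tau>) y = det (M \<tau> y)" and Ainv: "Ainv (\<theta> \<tau>) y = matrix_inv (M \<tau> y)" if "\<tau> \<in> {0..T}" for \<tau> y
    by (simp_all add: Jdet_def Ainv_def M[OF that])
  have Mcont: "continuous_on UNIV (M \<tau>)" if "\<tau> \<in> {0..T}" for \<tau>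
    unfolding M_def by (intro continuous_intros d\<theta>(2)[OF that])
  have detM: "0 < det (M \<tau> y)" if "\<tau> \<in> {0..T}" for \<tau> y using Jpos[OF that] Jdet[OF that] by simp
  obtain C where C: "\<And>\<tau>. \<tau> \<in> {0..T} \<Longrightarrow> Linf_norm (D (V \<tau>)) \<le> ennreal C"
    "\<And>\<tau>. \<tau> \<in> {0..T} \<Longrightarrow> Linf_norm (D (Z \<tau>)) \<le> ennreal C"
    using ap unfolding a_priori_def Z_def by blast
  have ap': "Linf_norm (\<lambda>y. Ainv (\<theta> \<tau>) y - mat 1) < ennreal (1 / 3)" "Linf_norm (D (\<theta> \<tau>)) < ennreal (1 / 3)"
    "Linf_norm (\<lambda>y. Jdet (\<theta> \<tau>) y - 1) < ennreal (1 / 3)" if "\<tau> \<in> {0..T}" for \<tau>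
    using ap that unfolding a_priori_def by blast+
  from affine_motion_coefficients[OF assms(4,2,3), of T]
  obtain B0 :: real and P P' :: "real \<Rightarrow> real^3^3" where B0: "1 \<le> B0" and mu_pos: "\<forall>\<tau>\<ge>0. 0 < mu A \<tau>"
    and c: "\<forall>\<tau>\<in>{0..T}. (P has_vector_derivative P' \<tau>) (at \<tau> within {0..T}) \<and>
      norm (P \<tau>) \<le> B0 \<and> norm (P' \<tau>) \<le> B0 \<and>
      norm ((mu_tau A \<tau> / mu A \<tau>) *\<^sub>R mat 1 + 2 *\<^sub>R Gamma_star A \<tau>) \<le> B0 \<and>
      norm ((Cbar \<alpha> Tbar A * mu A \<tau> powr (- 3 / \<alpha>)) *\<^sub>R Lam A \<tau>) \<le> B0 \<and>
      transpose (P \<tau>) ** P \<tau> ** ((Cbar \<alpha> Tbar A * mu A \<tau> powr (- 3 / \<alpha>)) *\<^sub>R Lam A \<tau>) = mat 1"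
    by (elim exE conjE) (rule that)
  note coeff = c[rule_format, THEN conjunct1] c[rule_format, THEN conjunct2, THEN conjunct1]
    c[rule_format, THEN conjunct2, THEN conjunct2, THEN conjunct1]
    c[rule_format, THEN conjunct2, THEN conjunct2, THEN conjunct2, THEN conjunct1]
    c[rule_format, THEN conjunct2, THEN conjunct2, THEN conjunct2, THEN conjunct2, THEN conjunct1]
    c[rule_format, THEN conjunct2, THEN conjunct2, THEN conjunct2, THEN conjunct2, THEN conjunct2]
  \<comment> \<open>The norm of \<open>mat 1\<close> enters because the a priori assumption bounds
    the inverse Jacobian only relative to the identity; the power of 2/3 is for q and 1/q.\<close>
  define B where "B = Max {B0, C, 1 / 3 + norm (mat 1 :: real^3^3), (2/3) powr (- 1 / \<alpha>)}"
  have B: "B0 \<le> B" "C \<le> B" "1 / 3 + norm (mat 1 :: real^3^3) \<le> B" "(2/3) powr (- 1 / \<alpha>) \<le> B"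
    by (simp_all add: B_def)
  have B1: "1 \<le> B" using B B0 by simp
  have DV: "norm (D (V \<tau>) y) \<le> B" and DZ: "norm (D (Z \<tau>) y) \<le> B" if "\<tau> \<in> {0..T}" for \<tau> y
    using norm_le_if_Linf_norm_le[OF dV(2)[OF that] C(1)[OF that], of y]
      norm_le_if_Linf_norm_le[OF dZ(2)[OF that] C(2)[OF that], of y] B B1 by auto
  have Z_lip: "norm (Z \<tau> y - Z \<tau> z) \<le> B * norm (y - z)" if "\<tau> \<in> {0..T}" for \<tau> y z
    by (rule lipschitz_if_jacobian_bounded[OF dZ(1)[OF that] DZ[OF that]])
  \<comment> \<open>The Lipschitz bound on \<open>Z\<close> permits exchanging the time derivative
    with the spatial one, column by column of the Jacobian.\<close>
  have D\<theta>_time: "((\<lambda>s. D (\<theta> s) y) has_vector_derivative D (V \<tau>) y) (at \<tau> within {0..T})" if \<tau>: "\<tau> \<in> {0..T}" for \<tau> y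
    unfolding has_vector_derivative_def
  proof (rule has_derivative_matrix)
    fix i k
    have "((\<lambda>s. D (\<theta> s) y *v axis k 1) has_vector_derivative D (V \<tau>) y *v axis k 1) (at \<tau> within {0..T})"
      by (rule directional_derivative_time_derivative[OF \<theta>_time V_time d\<theta>(1) dV(1) Z_lip \<tau>])
    from bounded_linear.has_vector_derivative[OF bounded_linear_vec_nth this, of i]
    show "((\<lambda>s. D (\<theta> s) y $ i $ k) has_derivative (\<lambda>h. (h *\<^sub>R D (V \<tau>) y) $ i $ k)) (at \<tau> within {0..T})"
      by (simp add: has_vector_derivative_def matrix_vector_mult_basis column_def)
  qed
  have J_bounds: "2 / 3 \<le> det (M \<tau> y)" "det (M \<tau> y) \<le> 4 / 3" if "\<tau> \<in> {0..T}" for \<tau> y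
  proof -
    have "norm (Jdet (\<theta> \<tau>) y - 1) \<le> 1 / 3"
      by (rule Linf_norm_lessD[OF _ ap'(3)[OF that]])
        (simp_all add: Jdet[OF that], intro continuous_intros continuous_on_det3 Mcont[OF that])
    then show "2 / 3 \<le> det (M \<tau> y)" "det (M \<tau> y) \<le> 4 / 3"
      unfolding Jdet[OF that] real_norm_def by linarith+
  qed
  have A_B: "norm (matrix_inv (M \<tau> y)) \<le> B" if "\<tau> \<in> {0..T}" for \<tau> y
  proof -
    have nz: "det (M \<tau> z) \<noteq> 0" for z using detM[OF that, of z] by simp
    have "norm (Ainv (\<theta> \<tau>) y - mat 1) \<le> 1 / 3"
      by (rule Linf_norm_lessD[OF _ ap'(1)[OF that]])
        (simp_all add: Ainv[OF that], intro continuous_intros continuous_on_matrix_inv Mcont[OF that] nz)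
    then show ?thesis
      using norm_triangle_ineq[of "matrix_inv (M \<tau> y) - mat 1" "mat 1"] B(3) by (simp add: Ainv[OF that])
  qed
  have D\<theta>_B: "norm (D (\<theta> \<tau>) y) \<le> 1 / 3" if "\<tau> \<in> {0..T}" for \<tau> y
    by (rule Linf_norm_lessD[OF d\<theta>(2)[OF that] ap'(2)[OF that]]) simp
  have init0: "\<theta> 0 y = 0" "V 0 y = 0" if "1 < norm y" for y
    using init vanish[OF supp0(1) that] vanish[OF supp0(2) that] by auto
  define J where "J \<tau> y = det (M \<tau> y)" for \<tau> y
  define q where "q \<tau> y = J \<tau> y powr (- 1 / \<alpha>)" for \<tau> y
  define gq where "gq \<tau> y = (\<chi> k. - 1 / \<alpha> * J \<tau> y powr (- 1 / \<alpha> - 1) * trace (adjugate (M \<tau> y) ** D2 \<tau> y (axis k 1)))" for \<tau> y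
  have momentum: "Z \<tau> y + ((mu_tau A \<tau> / mu A \<tau>) *\<^sub>R mat 1 + 2 *\<^sub>R Gamma_star A \<tau>) *v V \<tau> y
      + ((Cbar \<alpha> Tbar A * mu A \<tau> powr (- 3 / \<alpha>)) *\<^sub>R Lam A \<tau>) *v
        (transpose (matrix_inv (M \<tau> y)) *v (((1 + \<alpha>) *\<^sub>R gq \<tau> y + \<theta> \<tau> y + transpose (D (\<theta> \<tau>) y) *v (y + \<theta> \<tau> y))
          + (1 - q \<tau> y) *\<^sub>R y)) = 0"
    if \<tau>: "\<tau> \<in> {0..T}" and y: "1 < norm y" for \<tau> y
  proof -
    let ?A = "matrix_inv (M \<tau> y)"
    define u where "u = (1 + \<alpha>) *\<^sub>R gq \<tau> y - q \<tau> y *\<^sub>R y"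
    have op: "open {z::real^3. 1 < norm z}" by (intro open_Collect_less continuous_intros)
    have M': "(M \<tau> has_derivative D2 \<tau> y) (at y)"
      unfolding M_def using has_derivative_add[OF has_derivative_const D2(1)[OF \<tau>], of "mat 1"] by simp
    have div: "(\<Sum>k\<in>UNIV. partial_deriv k (\<lambda>z. \<Sum>j\<in>UNIV. w z * Lam A \<tau> $ i $ j * (1 + \<beta> z) *
               (Ainv (\<theta> \<tau>) z $ k $ j * Jdet (\<theta> \<tau>) z powr (- 1 / \<alpha>) - (if k = j then 1 else 0))) y)
        = w y * (y \<bullet> Lam A \<tau> $ i + u \<bullet> (?A *v Lam A \<tau> $ i))" for i
      unfolding Ainv[OF \<tau>] Jdet[OF \<tau>] u_def gq_def q_def J_def
      by (rule divergence_pressure[OF M' D2(3)[OF \<tau>] detM[OF \<tau>] assms(2) op])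
        (use y vanish[OF supp\<beta>] in auto)
    have \<beta>: "partial_deriv k (\<lambda>z. w z * \<beta> z) y = 0" for k
    proof -
      have "((\<lambda>z. w z * \<beta> z) has_derivative (\<lambda>h. 0)) (at y)"
        by (rule has_derivative_transform_within_open[OF has_derivative_const op])
          (use y vanish[OF supp\<beta>] in auto)
      from partial_deriv_eq[OF this] show ?thesis .
    qed
    have "Z \<tau> y + ((mu_tau A \<tau> / mu A \<tau>) *\<^sub>R mat 1 + 2 *\<^sub>R Gamma_star A \<tau>) *v V \<tau> y
      + ((Cbar \<alpha> Tbar A * mu A \<tau> powr (- 3 / \<alpha>)) *\<^sub>R Lam A \<tau>) *v (\<theta> \<tau> y + y + transpose ?A *v u) = 0"
    proof (rule momentum_equation[where c = "w y" and \<sigma> = \<sigma>])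
      show "mu A \<tau> powr \<sigma> * Z \<tau> y $ i + mu_tau A \<tau> * mu A \<tau> powr (- 1 + \<sigma>) * V \<tau> y $ i
        + 2 * mu A \<tau> powr \<sigma> * (\<Sum>j\<in>UNIV. Gamma_star A \<tau> $ i $ j * V \<tau> y $ j)
        + Cbar \<alpha> Tbar A * mu A \<tau> powr (- (3 / \<alpha> - \<sigma>)) * (\<Sum>l\<in>UNIV. Lam A \<tau> $ i $ l * \<theta> \<tau> y $ l)
        + Cbar \<alpha> Tbar A * mu A \<tau> powr (- (3 / \<alpha> - \<sigma>)) / w y
          * (w y * (y \<bullet> Lam A \<tau> $ i + u \<bullet> (?A *v Lam A \<tau> $ i))) = 0" for i
        using sys[OF \<tau>, of y i] unfolding system_lhs_def div \<beta> delta_def Z_def by simp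
      show "0 < mu A \<tau>" using mu_pos \<tau> by simp
    qed (rule w_pos)
    \<comment> \<open>\<open>transpose ?A\<close> inverts the transpose of \<open>M\<close>, so
      \<theta> + y can be pulled under it as the gradient of |y + \<theta>|^2/2; splitting off the
      gradient of |y|^2/2 leaves the remainder (1 - q) y.\<close>
    moreover have "transpose ?A *v (((1 + \<alpha>) *\<^sub>R gq \<tau> y + \<theta> \<tau> y + transpose (D (\<theta> \<tau>) y) *v (y + \<theta> \<tau> y)) + (1 - q \<tau> y) *\<^sub>R y)
        = \<theta> \<tau> y + y + transpose ?A *v u"
    proof -
      have MA: "M \<tau> y ** ?A = mat 1"
        using detM[OF \<tau>, of y] by (simp add: matrix_inv_adjugate matrix_mult_scaleR matrix_mult_adjugate)
      have "transpose (M \<tau> y) *v x = x + transpose (D (\<theta> \<tau>) y) *v x" for x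
      proof -
        have "transpose (M \<tau> y) = mat 1 + transpose (D (\<theta> \<tau>) y)"
          by (auto simp: M_def transpose_def vec_eq_iff mat_def)
        then show ?thesis by (simp add: matrix_vector_mult_add_rdistrib del: transpose_matrix_vector)
      qed
      then have "((1 + \<alpha>) *\<^sub>R gq \<tau> y + \<theta> \<tau> y + transpose (D (\<theta> \<tau>) y) *v (y + \<theta> \<tau> y)) + (1 - q \<tau> y) *\<^sub>R y
          = transpose (M \<tau> y) *v (y + \<theta> \<tau> y) + u"
        by (simp add: u_def algebra_simps del: transpose_matrix_vector)
      moreover have "transpose ?A *v (transpose (M \<tau> y) *v x) = x" for x
        using MA by (simp add: matrix_vector_mul_assoc flip: matrix_transpose_mul del: transpose_matrix_vector)
      ultimately show ?thesis
        by (simp only: matrix_vector_right_distrib) (simp add: add.commute)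
    qed
    ultimately show ?thesis by simp
  qed
  interpret lagrangian_flow \<alpha> T B \<theta> V Z "\<lambda>\<tau>. D (\<theta> \<tau>)" "\<lambda>\<tau>. D (V \<tau>)" D2 P P'
    "\<lambda>\<tau>. (mu_tau A \<tau> / mu A \<tau>) *\<^sub>R mat 1 + 2 *\<^sub>R Gamma_star A \<tau>"
    "\<lambda>\<tau>. (Cbar \<alpha> Tbar A * mu A \<tau> powr (- 3 / \<alpha>)) *\<^sub>R Lam A \<tau>"
    "\<lambda>\<tau> y. mat 1 + D (\<theta> \<tau>) y" "\<lambda>\<tau> y. matrix_inv (mat 1 + D (\<theta> \<tau>) y)"
    "\<lambda>\<tau> y. det (mat 1 + D (\<theta> \<tau>) y)" "\<lambda>\<tau> y. det (mat 1 + D (\<theta> \<tau>) y) powr (- 1 / \<alpha>)"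
    "\<lambda>\<tau> y. (1 + \<alpha>) * (det (mat 1 + D (\<theta> \<tau>) y) powr (- 1 / \<alpha>) - 1) + y \<bullet> \<theta> \<tau> y + \<theta> \<tau> y \<bullet> \<theta> \<tau> y / 2"
    "\<lambda>\<tau> y. \<chi> k. - 1 / \<alpha> * det (mat 1 + D (\<theta> \<tau>) y) powr (- 1 / \<alpha> - 1) * trace (adjugate (mat 1 + D (\<theta> \<tau>) y) ** D2 \<tau> y (axis k 1))"
    "\<lambda>\<tau> y. (1 + \<alpha>) *\<^sub>R (\<chi> k. - 1 / \<alpha> * det (mat 1 + D (\<theta> \<tau>) y) powr (- 1 / \<alpha> - 1) * trace (adjugate (mat 1 + D (\<theta> \<tau>) y) ** D2 \<tau> y (axis k 1)))
       + \<theta> \<tau> y + transpose (D (\<theta> \<tau>) y) *v (y + \<theta> \<tau> y)"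
    using T assms(2) B1 B(4) d\<theta>(1) D2 dV Z_lip \<theta>_time V_time D\<theta>_time D\<theta>_B DV A_B[unfolded M_def]
      J_bounds[unfolded M_def] coeff(1) order_trans[OF coeff(2) B(1)] order_trans[OF coeff(3) B(1)]
      order_trans[OF coeff(4) B(1)] order_trans[OF coeff(5) B(1)] coeff(6)
      momentum[unfolded q_def gq_def J_def M_def] init0
    by unfold_locales
  show "\<exists>K>0. \<forall>\<tau>\<in>{0..T}. \<forall>y. norm y > 1 + K * \<tau> \<longrightarrow> \<theta> \<tau> y = 0 \<and> V \<tau> y = 0"
    by (rule finite_propagation_speed)
qed

end
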